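(* Let $\theta\in(-\frac{\pi}{2},\frac{\pi}{2})$, let $(B,\mu)$ be the complex Wiener space, let $\{T_t\}_{t\ge0}$ be the nonsymmetric Ornstein-Uhlenbeck semigroup with parameter $\theta$ and $L$ its generator. Let $\mathbf{m}=\{m_k\}_{k\ge1}$ and $\mathbf{n}=\{n_k\}_{k\ge1}$ be sequences of nonnegative integers with finite sums $m=|\mathbf{m}|=\sum_k m_k$ and $n=|\mathbf{n}|=\sum_k n_k$, and let $\mathbf{J}_{\mathbf{m},\mathbf{n}}$ be the corresponding Fourier-Hermite-Itô polynomial. Then $$L\,\mathbf{J}_{\mathbf{m},\mathbf{n}}(x)=-[(m+n)\cos\theta+\mathrm{i}(m-n)\sin\theta]\,\mathbf{J}_{\mathbf{m},\mathbf{n}}(x),$$ and, for all $t\ge 0$, $$T_t\,\mathbf{J}_{\mathbf{m},\mathbf{n}}(x)=e^{-[(m+n)\cos\theta+\mathrm{i}(m-n)\sin\theta]t}\,\mathbf{J}_{\mathbf{m},\mathbf{n}}(x).$$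
   Context: Fix $T>0$. $B=C_0([0,T]\to\mathbb{C})$ is the Banach space of continuous $\mathbb{C}$-valued paths on $[0,T]$ vanishing at $0$, with the sup norm, and $\mu$ is the law on $B$ of the standard planar Brownian motion written in complex form $B^1+\mathrm{i}B^2$ ($B^1,B^2$ independent standard real Brownian motions). $H=H_1+\mathrm{i}H_1$, where $H_1$ is the one-dimensional Cameron-Martin space (absolutely continuous real paths starting at $0$ with derivative in $L^2[0,T]$), with inner product $(h,k)_H=\int_0^T\dot h(s)\overline{\dot k(s)}\,ds$. $B^*$ denotes the continuous complex-linear functionals $\varphi:B\to\mathbb{C}$, $\langle x,\varphi\rangle=\varphi(x)$, and $B^*$ is viewed as a subspace of the dual Hilbert space $H^*$ by restriction to $H$. Semigroup: for bounded Borel $F:B\to\mathbb{C}$, $$T_tF(x)=\int_B F\big(e^{-(\cos\theta+\mathrm{i}\sin\theta)t}x+\sqrt{1-e^{-2t\cos\theta}}\,y\big)\,\mu(dy),\quad t\ge 0.$$ It extends to a strongly continuous contraction semigroup on $L^p(B,\mu)$ for every $p\in[1,\infty)$. $L$ denotes its generator. Hermite-Laguerre-Itô polynomials: with $\partial=\partial/\partial z$, $\bar\partial=\partial/\partial\bar z$ and $d\nu=\frac{1}{2\pi}e^{-(x^2+y^2)/2}dx\,dy$ on $\mathbb{C}$, let $\partial^*,\bar\partial^*$ be the adjoints in $L^2_{\mathbb{C}}(\nu)$, i.e. $\partial^*g=-\frac{\partial g}{\partial\bar z}+\frac{z}{2}g$ and $\bar\partial^*g=-\frac{\partial g}{\partial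 z}+\frac{\bar z}{2}g$. For integers $m,n\ge0$, $J_{m,n}(z)=2^{m+n}(\partial^* )^m(\bar\partial^* )^n1$, so $J_{0,0}=1$. Fourier-Hermite-Itô polynomials: fix a complete orthonormal system $\{\varphi_k\}_{k\ge1}\subseteq B^*$ of $H^*$ (so that under $\mu$ the variables $\langle x,\varphi_k\rangle$ are independent with law $\nu$). For sequences $\mathbf{m},\mathbf{n}$ of nonnegative integers with finite sum, $$\mathbf{J}_{\mathbf{m},\mathbf{n}}(x)=\prod_k\frac{1}{\sqrt{2^{m_k+n_k}\,m_k!\,n_k!}}\,J_{m_k,n_k}(\langle x,\varphi_k\rangle).$$ *)

theory Defs
  imports "HOL-Probability.Probability"
begin

section \<open>The path space and its dual\<close>

text \<open>
  \<open>C\<^sub>0([0,T] \<rightarrow> \<complex>)\<close> is rendered as the set of bounded continuous functions on the whole real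
  line that vanish at 0 and are constant on \<open>(-\<infinity>,0]\<close> and on \<open>[T,\<infinity>)\<close>: every path on \<open>[0,T]\<close> has
  exactly one such extension, and the norm of \<^typ>\<open>real \<Rightarrow>\<^sub>C complex\<close> (supremum over the line) is
  then the supremum over \<open>[0,T]\<close>.
\<close>

definition path_space :: "real \<Rightarrow> (real \<Rightarrow>\<^sub>C complex) set" where
  "path_space T = {x. apply_bcontfun x 0 = 0 \<and>
     (\<forall>t\<le>0. apply_bcontfun x t = apply_bcontfun x 0) \<and>
     (\<forall>t\<ge>T. apply_bcontfun x t = apply_bcontfun x T)}"

text \<open>The library provides only the real vector space structure of \<^typ>\<open>real \<Rightarrow>\<^sub>C complex\<close>.\<close>

definition scale_path :: "complex \<Rightarrow> (real \<Rightarrow>\<^sub>C complex) \<Rightarrow> (real \<Rightarrow>\<^sub>C complex)" where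
  "scale_path c x = Bcontfun (\<lambda>t. c * apply_bcontfun x t)"

lemma apply_scale_path: "apply_bcontfun (scale_path c x) t = c * apply_bcontfun x t"
proof -
  have "bounded ((*) c ` range (apply_bcontfun x))"
    by (rule bounded_linear_image[OF bounded_apply_bcontfun bounded_linear_mult_right])
  then have "(\<lambda>t. c * apply_bcontfun x t) \<in> bcontfun"
    by (auto simp: bcontfun_def image_image intro!: continuous_intros)
  then show ?thesis
    by (simp add: scale_path_def Bcontfun_inverse)
qed

definition complex_linear_on ::
  "(real \<Rightarrow>\<^sub>C complex) set \<Rightarrow> ((real \<Rightarrow>\<^sub>C complex) \<Rightarrow> complex) \<Rightarrow> bool" where
  "complex_linear_on S \<phi> \<longleftrightarrow>
     (\<forall>x\<in>S. \<forall>y\<in>S. \<phi> (x + y) = \<phi> x + \<phi> y) \<and> (\<forall>c. \<forall>x\<in>S. \<phi> (scale_path c x) = c * \<phi> x)"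

text \<open>Elements of \<open>B\<^sup>*\<close> are HOL functions whose values outside \<open>B\<close> are immaterial.\<close>

definition path_dual :: "real \<Rightarrow> ((real \<Rightarrow>\<^sub>C complex) \<Rightarrow> complex) set" where
  "path_dual T = {\<phi>. complex_linear_on (path_space T) \<phi> \<and> continuous_on (path_space T) \<phi>}"


section \<open>Wiener measure\<close>

definition brownian_motion :: "'a measure \<Rightarrow> real \<Rightarrow> (real \<Rightarrow> 'a \<Rightarrow> real) \<Rightarrow> bool" where
  "brownian_motion M T W \<longleftrightarrow>
     prob_space M \<and>
     (\<forall>t\<in>{0..T}. W t \<in> borel_measurable M) \<and>
     (\<forall>\<omega>\<in>space M. W 0 \<omega> = 0 \<and> continuous_on {0..T} (\<lambda>t. W t \<omega>)) \<and>
     (\<forall>s t. 0 \<le> s \<and> s < t \<and> t \<le> T \<longrightarrow>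
        distributed M lborel (\<lambda>\<omega>. W t \<omega> - W s \<omega>) (normal_density 0 (sqrt (t - s)))) \<and>
     (\<forall>(n::nat) \<tau>. 0 \<le> \<tau> 0 \<and> (\<forall>i<n. \<tau> i < \<tau> (Suc i)) \<and> \<tau> n \<le> T \<longrightarrow>
        prob_space.indep_vars M (\<lambda>_. borel) (\<lambda>i \<omega>. W (\<tau> (Suc i)) \<omega> - W (\<tau> i) \<omega>) {..<n})"

text \<open>Independence of the two coordinates is independence of the whole processes on \<open>[0,T]\<close>.\<close>

definition planar_brownian_motion :: "'a measure \<Rightarrow> real \<Rightarrow> (real \<Rightarrow> 'a \<Rightarrow> complex) \<Rightarrow> bool" where
  "planar_brownian_motion M T Z \<longleftrightarrow>
     brownian_motion M T (\<lambda>t \<omega>. Re (Z t \<omega>)) \<and>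
     brownian_motion M T (\<lambda>t \<omega>. Im (Z t \<omega>)) \<and>
     prob_space.indep_var M
       (\<Pi>\<^sub>M t\<in>{0..T}. borel) (\<lambda>\<omega>. \<lambda>t\<in>{0..T}. Re (Z t \<omega>))
       (\<Pi>\<^sub>M t\<in>{0..T}. borel) (\<lambda>\<omega>. \<lambda>t\<in>{0..T}. Im (Z t \<omega>))"

text \<open>
  The law of planar Brownian motion on \<open>B\<close>: the Borel probability measure under which the
  coordinate process is a planar Brownian motion.
\<close>

definition complex_wiener_measure :: "real \<Rightarrow> (real \<Rightarrow>\<^sub>C complex) measure \<Rightarrow> bool" where
  "complex_wiener_measure T \<mu> \<longleftrightarrow>
     prob_space \<mu> \<and> sets \<mu> = sets (restrict_space borel (path_space T)) \<and>
     planar_brownian_motion \<mu> T (\<lambda>t x. apply_bcontfun x t)"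


section \<open>The Cameron-Martin space and its dual\<close>

definition abs_continuous_on :: "real set \<Rightarrow> (real \<Rightarrow> real) \<Rightarrow> bool" where
  "abs_continuous_on S f \<longleftrightarrow>
     (\<forall>\<epsilon>>0. \<exists>\<delta>>0. \<forall>D. D division_of (\<Union>D) \<and> \<Union>D \<subseteq> S \<and> (\<Sum>K\<in>D. measure lborel K) < \<delta> \<longrightarrow>
        (\<Sum>K\<in>D. \<bar>f (Sup K) - f (Inf K)\<bar>) < \<epsilon>)"

definition cameron_martin_real :: "real \<Rightarrow> (real \<Rightarrow> real) \<Rightarrow> bool" where
  "cameron_martin_real T f \<longleftrightarrow>
     f 0 = 0 \<and> abs_continuous_on {0..T} f \<and>
     (\<exists>g. (AE s in lebesgue. s \<in> {0..T} \<longrightarrow> (f has_real_derivative g s) (at s)) \<and>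
          set_borel_measurable lebesgue {0..T} g \<and>
          set_integrable lebesgue {0..T} (\<lambda>s. (g s)\<^sup>2))"

definition cameron_martin :: "real \<Rightarrow> (real \<Rightarrow>\<^sub>C complex) set" where
  "cameron_martin T = {h \<in> path_space T.
     cameron_martin_real T (\<lambda>t. Re (apply_bcontfun h t)) \<and>
     cameron_martin_real T (\<lambda>t. Im (apply_bcontfun h t))}"

text \<open>On the null set where a path is not differentiable the integrand has an irrelevant value.\<close>

definition cm_inner :: "real \<Rightarrow> (real \<Rightarrow>\<^sub>C complex) \<Rightarrow> (real \<Rightarrow>\<^sub>C complex) \<Rightarrow> complex" where
  "cm_inner T h k = set_lebesgue_integral lebesgue {0..T}
     (\<lambda>s. vector_derivative (apply_bcontfun h) (at s) * cnj (vector_derivative (apply_bcontfun k) (at s)))"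

definition cm_norm :: "real \<Rightarrow> (real \<Rightarrow>\<^sub>C complex) \<Rightarrow> real" where
  "cm_norm T h = sqrt (Re (cm_inner T h h))"

definition cm_dual :: "real \<Rightarrow> ((real \<Rightarrow>\<^sub>C complex) \<Rightarrow> complex) set" where
  "cm_dual T = {\<psi>. complex_linear_on (cameron_martin T) \<psi> \<and>
     (\<exists>C. \<forall>h\<in>cameron_martin T. cmod (\<psi> h) \<le> C * cm_norm T h)}"

definition riesz_representer ::
  "real \<Rightarrow> ((real \<Rightarrow>\<^sub>C complex) \<Rightarrow> complex) \<Rightarrow> (real \<Rightarrow>\<^sub>C complex) \<Rightarrow> bool" where
  "riesz_representer T \<psi> h \<longleftrightarrow> h \<in> cameron_martin T \<and> (\<forall>k\<in>cameron_martin T. \<psi> k = cm_inner T k h)"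

text \<open>
  \<open>cm_dual_inner T \<psi> \<xi> c\<close> reads \<open>(\<psi>,\<xi>) = c\<close> for the inner product of \<open>H\<^sup>*\<close>. As the Riesz map is
  conjugate linear, the representers appear in swapped order.
\<close>

definition cm_dual_inner :: "real \<Rightarrow> ((real \<Rightarrow>\<^sub>C complex) \<Rightarrow> complex) \<Rightarrow>
    ((real \<Rightarrow>\<^sub>C complex) \<Rightarrow> complex) \<Rightarrow> complex \<Rightarrow> bool" where
  "cm_dual_inner T \<psi> \<xi> c \<longleftrightarrow>
     (\<exists>h k. riesz_representer T \<psi> h \<and> riesz_representer T \<xi> k \<and> c = cm_inner T k h)"

definition complete_orthonormal_system ::
  "real \<Rightarrow> (nat \<Rightarrow> (real \<Rightarrow>\<^sub>C complex) \<Rightarrow> complex) \<Rightarrow> bool" where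
  "complete_orthonormal_system T \<phi> \<longleftrightarrow>
     (\<forall>k. \<phi> k \<in> path_dual T) \<and>
     (\<forall>j k. cm_dual_inner T (\<phi> j) (\<phi> k) (if j = k then 1 else 0)) \<and>
     (\<forall>\<psi>\<in>cm_dual T. (\<forall>k. cm_dual_inner T \<psi> (\<phi> k) 0) \<longrightarrow> (\<forall>h\<in>cameron_martin T. \<psi> h = 0))"


section \<open>\<open>L\<^sup>p\<close> spaces and generators\<close>

text \<open>
  Elements of \<open>L\<^sup>p\<close> are represented by functions, and equality in \<open>L\<^sup>p\<close> by almost everywhere equality.
\<close>

definition Lp :: "'a measure \<Rightarrow> real \<Rightarrow> ('a \<Rightarrow> complex) set" where
  "Lp M p = {F \<in> borel_measurable M. integrable M (\<lambda>x. cmod (F x) powr p)}"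

definition Lp_norm :: "'a measure \<Rightarrow> real \<Rightarrow> ('a \<Rightarrow> complex) \<Rightarrow> real" where
  "Lp_norm M p F = (\<integral>x. cmod (F x) powr p \<partial>M) powr (1 / p)"

definition Lp_tendsto ::
  "'a measure \<Rightarrow> real \<Rightarrow> ('i \<Rightarrow> 'a \<Rightarrow> complex) \<Rightarrow> ('a \<Rightarrow> complex) \<Rightarrow> 'i filter \<Rightarrow> bool" where
  "Lp_tendsto M p Fs F \<A> \<longleftrightarrow>
     F \<in> Lp M p \<and> eventually (\<lambda>i. Fs i \<in> Lp M p) \<A> \<and>
     ((\<lambda>i. Lp_norm M p (\<lambda>x. Fs i x - F x)) \<longlongrightarrow> 0) \<A>"

text \<open>
  \<open>Lp_generator M p S F G\<close>: the element \<open>F\<close> is in the domain of the generator of the semigroup \<open>S\<close>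
  on \<open>L\<^sup>p\<close>, and the generator maps it to \<open>G\<close>.
\<close>

definition Lp_generator :: "'a measure \<Rightarrow> real \<Rightarrow> (real \<Rightarrow> ('a \<Rightarrow> complex) \<Rightarrow> 'a \<Rightarrow> complex) \<Rightarrow>
    ('a \<Rightarrow> complex) \<Rightarrow> ('a \<Rightarrow> complex) \<Rightarrow> bool" where
  "Lp_generator M p S F G \<longleftrightarrow>
     F \<in> Lp M p \<and> Lp_tendsto M p (\<lambda>t x. (S t F x - F x) / of_real t) G (at_right 0)"


section \<open>The nonsymmetric Ornstein-Uhlenbeck semigroup\<close>

definition ou_integral :: "(real \<Rightarrow>\<^sub>C complex) measure \<Rightarrow> real \<Rightarrow> real \<Rightarrow>
    ((real \<Rightarrow>\<^sub>C complex) \<Rightarrow> complex) \<Rightarrow> (real \<Rightarrow>\<^sub>C complex) \<Rightarrow> complex" where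
  "ou_integral \<mu> \<theta> t F x =
     (\<integral>y. F (scale_path (exp (- (of_real (cos \<theta>) + \<i> * of_real (sin \<theta>)) * of_real t)) x
            + scale_path (of_real (sqrt (1 - exp (- 2 * t * cos \<theta>)))) y) \<partial>\<mu>)"

definition bounded_borel :: "'a measure \<Rightarrow> ('a \<Rightarrow> complex) \<Rightarrow> bool" where
  "bounded_borel M F \<longleftrightarrow> F \<in> borel_measurable M \<and> bounded (F ` space M)"

text \<open>
  The continuous extension to \<open>L\<^sup>p\<close> of the operator given by \<open>ou_integral\<close> on bounded Borel functions.
  These being dense in \<open>L\<^sup>p\<close>, the value is determined up to almost everywhere equality.
\<close>

definition ou_semigroup :: "(real \<Rightarrow>\<^sub>C complex) measure \<Rightarrow> real \<Rightarrow> real \<Rightarrow> real \<Rightarrow>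
    ((real \<Rightarrow>\<^sub>C complex) \<Rightarrow> complex) \<Rightarrow> (real \<Rightarrow>\<^sub>C complex) \<Rightarrow> complex" where
  "ou_semigroup \<mu> \<theta> p t F = (SOME G. G \<in> Lp \<mu> p \<and>
     (\<forall>Fs :: nat \<Rightarrow> _. (\<forall>j. bounded_borel \<mu> (Fs j)) \<and> Lp_tendsto \<mu> p Fs F sequentially \<longrightarrow>
        Lp_tendsto \<mu> p (\<lambda>j. ou_integral \<mu> \<theta> t (Fs j)) G sequentially))"


section \<open>Hermite-Laguerre-Ito polynomials\<close>

definition partial_re :: "(complex \<Rightarrow> complex) \<Rightarrow> complex \<Rightarrow> complex" where
  "partial_re g z = vector_derivative (\<lambda>s. g (Complex s (Im z))) (at (Re z))"

definition partial_im :: "(complex \<Rightarrow> complex) \<Rightarrow> complex \<Rightarrow> complex" where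
  "partial_im g z = vector_derivative (\<lambda>s. g (Complex (Re z) s)) (at (Im z))"

definition wirtinger :: "(complex \<Rightarrow> complex) \<Rightarrow> complex \<Rightarrow> complex" where
  "wirtinger g z = (partial_re g z - \<i> * partial_im g z) / 2"

definition wirtinger_bar :: "(complex \<Rightarrow> complex) \<Rightarrow> complex \<Rightarrow> complex" where
  "wirtinger_bar g z = (partial_re g z + \<i> * partial_im g z) / 2"

text \<open>
  The adjoints of \<^const>\<open>wirtinger\<close> and \<^const>\<open>wirtinger_bar\<close> in \<open>L\<^sup>2(\<nu>)\<close>, where
  \<open>d\<nu> = (2\<pi>)\<^bsup>-1\<^esup> exp (-(x\<^sup>2 + y\<^sup>2)/2) dx dy\<close>.
\<close>

definition wirtinger_adj :: "(complex \<Rightarrow> complex) \<Rightarrow> complex \<Rightarrow> complex" where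
  "wirtinger_adj g z = - wirtinger_bar g z + z / 2 * g z"

definition wirtinger_bar_adj :: "(complex \<Rightarrow> complex) \<Rightarrow> complex \<Rightarrow> complex" where
  "wirtinger_bar_adj g z = - wirtinger g z + cnj z / 2 * g z"

definition hermite_laguerre_ito :: "nat \<Rightarrow> nat \<Rightarrow> complex \<Rightarrow> complex" where
  "hermite_laguerre_ito m n z =
     2 ^ (m + n) * (wirtinger_adj ^^ m) ((wirtinger_bar_adj ^^ n) (\<lambda>_. 1)) z"

text \<open>All but finitely many factors are 1 when \<open>ms\<close> and \<open>ns\<close> have finite sums.\<close>

definition fourier_hermite_ito :: "(nat \<Rightarrow> (real \<Rightarrow>\<^sub>C complex) \<Rightarrow> complex) \<Rightarrow> (nat \<Rightarrow> nat) \<Rightarrow>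
    (nat \<Rightarrow> nat) \<Rightarrow> (real \<Rightarrow>\<^sub>C complex) \<Rightarrow> complex" where
  "fourier_hermite_ito \<phi> ms ns x = prodinf (\<lambda>k.
     1 / of_real (sqrt (2 ^ (ms k + ns k) * fact (ms k) * fact (ns k)))
       * hermite_laguerre_ito (ms k) (ns k) (\<phi> k x))"

end

theory Submission
  imports Defs
begin

text \<open>
  A path is the uniform limit of its piecewise linear interpolations, which are linear images of the
  independent Gaussian increments. Computing characteristic functions of the increments shows that
  \<open>a x + b y\<close> has law \<open>\<mu>\<close> under \<open>\<mu> \<otimes> \<mu>\<close> whenever \<open>|a|\<^sup>2 + b\<^sup>2 = 1\<close>, hence the Ornstein-Uhlenbeck operators
  contract \<open>L\<^sup>p\<close> and their extension is determined by truncation. The same computation, with the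
  representers of the functionals \<open>\<phi>\<^sub>k\<close> giving the covariances, shows that the \<open>\<phi>\<^sub>k\<close> are independent
  standard complex Gaussians. By independence the eigenvalue relation reduces to the one-variable
  identity \<open>E J\<^bsub>m,n\<^esub>(a z + b W) = a\<^sup>m (cnj a)\<^sup>n J\<^bsub>m,n\<^esub>(z)\<close>, which follows by induction on \<open>m\<close> and \<open>n\<close> from
  Gaussian integration by parts.
\<close>

section \<open>Characteristic functions determine joint laws\<close>

text \<open>The ambient space of all bounded continuous functions is not separable, so continuity of
  addition does not by itself make \<open>mehler\<close> measurable for the product sigma-algebra on
  pairs of paths. An interpolation depends on finitely many increments only, and measurability as
  well as equality of laws pass to the limit.

  The semigroup is a choice (\<open>SOME\<close>) among the continuous extensions, so its values
  cannot be computed directly. The polynomial J is unbounded, but its Mehler integral converges at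
  every path. It may therefore be subtracted pointwise from the integral of a bounded approximant,
  and contraction shows that the explicit integral is an admissible value of the extension; any
  other admissible value agrees with it almost everywhere.

  Integration by parts is needed for polynomials only, so it rests on the moment recursion of the
  standard normal law instead of on differentiating densities.\<close>

lemma weighted_char_unique:
  fixes X W :: "'a \<Rightarrow> real" and Y V :: "'b \<Rightarrow> real"
  assumes [measurable]: "X \<in> borel_measurable M" "Y \<in> borel_measurable N"
    and W: "integrable M W" "\<And>x. 0 \<le> W x" and V: "integrable N V" "\<And>x. 0 \<le> V x"
    and eq: "\<And>t. (CLINT x|M. of_real (W x) * iexp (t * X x)) = (CLINT x|N. of_real (V x) * iexp (t * Y x))"
    and [measurable]: "A \<in> sets borel"
  shows "(LINT x|M. W x * indicator A (X x)) = (LINT x|N. V x * indicator A (Y x))"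
proof -
  have [measurable]: "W \<in> borel_measurable M" "V \<in> borel_measurable N"
    using W V by auto
  define c where "c = (LINT x|M. W x)"
  have "complex_of_real (LINT x|M. W x) = complex_of_real (LINT x|N. V x)"
    using eq[of 0] by simp
  then have cV: "c = (LINT x|N. V x)" unfolding c_def using of_real_eq_iff by blast
  \<comment> \<open>The value t = 0 has just given equal total masses. Dividing by the common mass
    \<open>c > 0\<close> turns both weights into probability densities, under which \<open>X\<close>
    and \<open>Y\<close> have equal characteristic functions.\<close>
  show ?thesis
  proof (cases "c = 0")
    case True
    then have "AE x in M. W x = 0" "AE x in N. V x = 0"
      using integral_nonneg_eq_0_iff_AE[OF W(1)] integral_nonneg_eq_0_iff_AE[OF V(1)] W V cV
      by (auto simp: c_def)
    then have "(LINT x|M. W x * indicator A (X x)) = 0" "(LINT x|N. V x * indicator A (Y x)) = 0"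
      by (auto intro!: integral_eq_zero_AE)
    then show ?thesis by simp
  next
    case False
    moreover have "0 \<le> c" unfolding c_def using W by simp
    ultimately have c: "0 < c" by simp
    have law: "real_distribution (distr (density L (\<lambda>x. U x / c)) borel Z) \<and>
        (\<forall>t. char (distr (density L (\<lambda>x. U x / c)) borel Z) t = (CLINT x|L. of_real (U x) * iexp (t * Z x)) / c) \<and>
        measure (distr (density L (\<lambda>x. U x / c)) borel Z) A = (LINT x|L. U x * indicator A (Z x)) / c"
      if [measurable]: "Z \<in> borel_measurable L" and U: "integrable L U" "\<And>x. 0 \<le> U x" "c = (LINT x|L. U x)"
      for L :: "'z measure" and U Z :: "'z \<Rightarrow> real"
    proof -
      have [measurable]: "U \<in> borel_measurable L" using U by auto
      have "prob_space (density L (\<lambda>x. U x / c))"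
      proof
        have "emeasure (density L (\<lambda>x. U x / c)) (space L) = (\<integral>\<^sup>+ x. U x / c \<partial>L)"
          by (subst emeasure_density) (auto intro!: nn_integral_cong)
        also have "\<dots> = ennreal (LINT x|L. U x / c)"
          using c U by (intro nn_integral_eq_integral) auto
        finally show "emeasure (density L (\<lambda>x. U x / c)) (space (density L (\<lambda>x. U x / c))) = 1"
          using c U by simp
      qed
      then interpret D: prob_space "density L (\<lambda>x. U x / c)" .
      have rd: "real_distribution (distr (density L (\<lambda>x. U x / c)) borel Z)"
        by (rule D.real_distribution_distr) simp
      have ch: "char (distr (density L (\<lambda>x. U x / c)) borel Z) t = (CLINT x|L. of_real (U x) * iexp (t * Z x)) / c" for t
      proof -
        have "char (distr (density L (\<lambda>x. U x / c)) borel Z) t = (CLINT x|density L (\<lambda>x. U x / c). iexp (t * Z x))"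
          unfolding char_def by (subst integral_distr) auto
        also have "\<dots> = (CLINT x|L. (U x / c) *\<^sub>R iexp (t * Z x))"
          using c U by (intro integral_density) auto
        also have "\<dots> = (CLINT x|L. of_real (U x) * iexp (t * Z x) / c)"
          by (intro Bochner_Integration.integral_cong) (auto simp: scaleR_conv_of_real)
        finally show ?thesis by simp
      qed
      interpret E: real_distribution "distr (density L (\<lambda>x. U x / c)) borel Z" by (rule rd)
      have "measure (distr (density L (\<lambda>x. U x / c)) borel Z) A = (LINT x|distr (density L (\<lambda>x. U x / c)) borel Z. indicator A x)"
        by simp
      also have "\<dots> = (LINT x|density L (\<lambda>x. U x / c). indicator A (Z x))"
        by (subst integral_distr) auto
      also have "\<dots> = (LINT x|L. (U x / c) *\<^sub>R indicator A (Z x))"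
        using c U by (intro integral_density) auto
      also have "\<dots> = (LINT x|L. U x * indicator A (Z x) / c)"
        by (intro Bochner_Integration.integral_cong) auto
      finally show ?thesis using rd ch by simp
    qed
    note M = law[of X M W, OF _ W c_def, simplified]
    note N = law[of Y N V, OF _ V cV, simplified]
    have "distr (density M (\<lambda>x. W x / c)) borel X = distr (density N (\<lambda>x. V x / c)) borel Y"
      by (rule Levy_uniqueness) (use M N eq in auto)
    then show ?thesis using M N c by auto
  qed
qed

text \<open>
  Exponentials are traded for indicators one coordinate at a time. The one-dimensional uniqueness
  theorem needs nonnegative weights, so the phase \<open>p\<close> of the remaining coordinates enters through
  the weights \<open>1 + cos p\<close> and \<open>1 + sin p\<close>.
\<close>

lemma weighted_joint_char_unique:
  fixes X :: "'i \<Rightarrow> 'a \<Rightarrow> real" and Y :: "'i \<Rightarrow> 'b \<Rightarrow> real"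
  assumes "finite_measure M" "finite_measure N"
    and "finite I"
    and "\<And>i. i \<in> I \<Longrightarrow> X i \<in> borel_measurable M" "\<And>i. i \<in> I \<Longrightarrow> Y i \<in> borel_measurable N"
    and "\<And>i. i \<in> I \<Longrightarrow> A i \<in> sets borel"
    and "W \<in> borel_measurable M" "V \<in> borel_measurable N"
    and "\<And>x. 0 \<le> W x \<and> W x \<le> (1::real)" "\<And>x. 0 \<le> V x \<and> V x \<le> (1::real)"
    and "\<And>s. (CLINT x|M. of_real (W x) * iexp (\<Sum>i\<in>I. s i * X i x)) =
      (CLINT x|N. of_real (V x) * iexp (\<Sum>i\<in>I. s i * Y i x))"
  shows "(LINT x|M. W x * (\<Prod>i\<in>I. indicator (A i) (X i x))) = (LINT x|N. V x * (\<Prod>i\<in>I. indicator (A i) (Y i x)))"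
  using assms(3-)
proof (induction I arbitrary: W V rule: finite_induct)
  case empty
  have "complex_of_real (LINT x|M. W x) = complex_of_real (LINT x|N. V x)"
    using empty.prems(8)[of "\<lambda>_. 0"] by simp
  then show ?case using of_real_eq_iff[where 'a=complex] by simp
next
  case (insert j I)
  have [measurable]: "X i \<in> borel_measurable M" "Y i \<in> borel_measurable N" "A i \<in> sets borel" if "i \<in> insert j I" for i
    using insert.prems that by auto
  have [measurable]: "W \<in> borel_measurable M" "V \<in> borel_measurable N" using insert.prems by auto
  interpret M: finite_measure M by fact
  interpret N: finite_measure N by fact
  note bd = insert.prems(6,7)
  have key: "(CLINT x|M. of_real (W x) * iexp (\<Sum>i\<in>insert j I. s i * X i x)) =
      (CLINT x|N. of_real (V x) * iexp (\<Sum>i\<in>insert j I. s i * Y i x))" for s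
    by (rule insert.prems)
  have intM: "integrable M (\<lambda>x. of_real (W x) * iexp (f x))" if [measurable]: "f \<in> borel_measurable M" for f
    by (rule M.integrable_const_bound[where B=1]) (use bd in \<open>auto simp: norm_mult\<close>)
  have intN: "integrable N (\<lambda>x. of_real (V x) * iexp (f x))" if [measurable]: "f \<in> borel_measurable N" for f
    by (rule N.integrable_const_bound[where B=1]) (use bd in \<open>auto simp: norm_mult\<close>)
  have rM: "integrable M (\<lambda>x. W x * g x)" if [measurable]: "g \<in> borel_measurable M" and "\<And>x. \<bar>g x\<bar> \<le> 2" for g
    by (rule M.integrable_const_bound[where B=2])
      (use bd that in \<open>auto simp: abs_mult intro!: order_trans[OF mult_left_le_one_le]\<close>)
  have rN: "integrable N (\<lambda>x. V x * g x)" if [measurable]: "g \<in> borel_measurable N" and "\<And>x. \<bar>g x\<bar> \<le> 2" for g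
    by (rule N.integrable_const_bound[where B=2])
      (use bd that in \<open>auto simp: abs_mult intro!: order_trans[OF mult_left_le_one_le]\<close>)
  \<comment> \<open>The indicator of coordinate \<open>j\<close> joins the weight, which stays
    between 0 and 1, so the induction hypothesis covers the remaining coordinates.\<close>
  have step: "(CLINT x|M. of_real (W x * indicator (A j) (X j x)) * iexp (\<Sum>i\<in>I. s i * X i x)) =
      (CLINT x|N. of_real (V x * indicator (A j) (Y j x)) * iexp (\<Sum>i\<in>I. s i * Y i x))" for s
  proof -
    define p where "p = (\<lambda>x. \<Sum>i\<in>I. s i * X i x)"
    define q where "q = (\<lambda>x. \<Sum>i\<in>I. s i * Y i x)"
    have [measurable]: "p \<in> borel_measurable M" "q \<in> borel_measurable N" unfolding p_def q_def by measurable
    have k: "(CLINT x|M. of_real (W x) * iexp (t * X j x + c * p x)) =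
      (CLINT x|N. of_real (V x) * iexp (t * Y j x + c * q x))" for t c
    proof -
      have "(\<Sum>i\<in>insert j I. (if i = j then t else c * s i) * X i x) = t * X j x + c * p x" for x
        using insert.hyps by (auto simp: p_def sum_distrib_left mult.assoc intro!: sum.cong)
      moreover have "(\<Sum>i\<in>insert j I. (if i = j then t else c * s i) * Y i x) = t * Y j x + c * q x" for x
        using insert.hyps by (auto simp: q_def sum_distrib_left mult.assoc intro!: sum.cong)
      ultimately show ?thesis using key[of "\<lambda>i. if i = j then t else c * s i"] by simp
    qed
    have w0: "(LINT x|M. W x * indicator (A j) (X j x)) = (LINT x|N. V x * indicator (A j) (Y j x))"
      by (rule weighted_char_unique) (use bd k[of _ 0] rM[of "\<lambda>_. 1"] rN[of "\<lambda>_. 1"] in auto)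
    \<comment> \<open>Euler's formula leaves the phase \<open>p\<close> only with the multiples 0, 1
      and -1, which are the values of \<open>c\<close> at which \<open>k\<close> is used.\<close>
    have ecos: "complex_of_real (w * (1 + cos p)) * iexp u = of_real w * iexp (u + 0 * p) +
        (of_real w * iexp (u + 1 * p) + of_real w * iexp (u + (-1) * p)) / 2" for w p u :: real
      by (simp add: cos_of_real[symmetric] cos_exp_eq exp_add[symmetric] algebra_simps add_divide_distrib) 
    have esin: "complex_of_real (w * (1 + sin p)) * iexp u = of_real w * iexp (u + 0 * p) +
        (of_real w * iexp (u + 1 * p) - of_real w * iexp (u + (-1) * p)) / (2 * \<i>)" for w p u :: real
      by (simp add: sin_of_real[symmetric] sin_exp_eq exp_add[symmetric] algebra_simps diff_divide_distrib)
    have lin: "(CLINT x|L. f x + (g x + h x) / c) = (CLINT x|L. f x) + ((CLINT x|L. g x) + (CLINT x|L. h x)) / c"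
      if "integrable L f" "integrable L g" "integrable L h" for L :: "'z measure" and f g h :: "'z \<Rightarrow> complex" and c
      using that by simp
    have lin': "(CLINT x|L. f x + (g x - h x) / c) = (CLINT x|L. f x) + ((CLINT x|L. g x) - (CLINT x|L. h x)) / c"
      if "integrable L f" "integrable L g" "integrable L h" for L :: "'z measure" and f g h :: "'z \<Rightarrow> complex" and c
      using that by simp
    have tr: "0 \<le> 1 + cos u" "0 \<le> 1 + sin u" "\<bar>1 + cos u\<bar> \<le> 2" "\<bar>1 + sin u\<bar> \<le> 2" for u :: real
      using cos_ge_minus_one[of u] sin_ge_minus_one[of u] cos_le_one[of u] sin_le_one[of u]
      by (auto simp: abs_le_iff simp del: cos_ge_minus_one sin_ge_minus_one cos_le_one sin_le_one)
    have c1: "(LINT x|M. W x * (1 + cos (p x)) * indicator (A j) (X j x)) =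
        (LINT x|N. V x * (1 + cos (q x)) * indicator (A j) (Y j x))"
    proof (rule weighted_char_unique)
      show "(CLINT x|M. of_real (W x * (1 + cos (p x))) * iexp (t * X j x)) =
        (CLINT x|N. of_real (V x * (1 + cos (q x))) * iexp (t * Y j x))" for t
        unfolding ecos by (subst (1 2) lin; ((rule intM intN; measurable) | (simp only: k)))
    qed (use bd in \<open>auto intro!: rM rN mult_nonneg_nonneg tr\<close>)
    have s1: "(LINT x|M. W x * (1 + sin (p x)) * indicator (A j) (X j x)) =
        (LINT x|N. V x * (1 + sin (q x)) * indicator (A j) (Y j x))"
    proof (rule weighted_char_unique)
      show "(CLINT x|M. of_real (W x * (1 + sin (p x))) * iexp (t * X j x)) =
        (CLINT x|N. of_real (V x * (1 + sin (q x))) * iexp (t * Y j x))" for t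
        unfolding esin by (subst (1 2) lin'; ((rule intM intN; measurable) | (simp only: k)))
    qed (use bd in \<open>auto intro!: rM rN mult_nonneg_nonneg tr\<close>)
    have ind: "\<bar>indicator (A j) y * g\<bar> \<le> 2" if "\<bar>g\<bar> \<le> 1" for y g :: real
      using that by (auto simp: indicator_def)
    have split: "(LINT x|M. W x * (1 + g x) * indicator (A j) (X j x)) =
        (LINT x|M. W x * indicator (A j) (X j x)) + (LINT x|M. W x * (indicator (A j) (X j x) * g x))"
      if [measurable]: "g \<in> borel_measurable M" and "\<And>x. \<bar>g x\<bar> \<le> 1" for g
      using that by (subst Bochner_Integration.integral_add[symmetric])
        (auto intro!: rM ind order_trans[OF that(2), where z=2] Bochner_Integration.integral_cong simp: algebra_simps indicator_def)
    have split': "(LINT x|N. V x * (1 + g x) * indicator (A j) (Y j x)) =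
        (LINT x|N. V x * indicator (A j) (Y j x)) + (LINT x|N. V x * (indicator (A j) (Y j x) * g x))"
      if [measurable]: "g \<in> borel_measurable N" and "\<And>x. \<bar>g x\<bar> \<le> 1" for g
      using that by (subst Bochner_Integration.integral_add[symmetric])
        (auto intro!: rN ind order_trans[OF that(2), where z=2] Bochner_Integration.integral_cong simp: algebra_simps indicator_def)
    \<comment> \<open>Subtracting the identity \<open>w0\<close> removes the summand 1 that had made
      the weight nonnegative.\<close>
    have cc: "(LINT x|M. W x * (indicator (A j) (X j x) * cos (p x))) = (LINT x|N. V x * (indicator (A j) (Y j x) * cos (q x)))"
      using c1 w0 by (simp add: split split')
    have ss: "(LINT x|M. W x * (indicator (A j) (X j x) * sin (p x))) = (LINT x|N. V x * (indicator (A j) (Y j x) * sin (q x)))"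
      using s1 w0 by (simp add: split split')
    have cis: "complex_of_real (w * a) * iexp u = of_real (w * (a * cos u)) + \<i> * of_real (w * (a * sin u))" for w a u :: real
      by (simp add: exp_Euler cos_of_real sin_of_real algebra_simps)
    have iM: "integrable M (\<lambda>x. complex_of_real (W x * (indicator (A j) (X j x) * g x)))" 
      if [measurable]: "g \<in> borel_measurable M" and "\<And>x. \<bar>g x\<bar> \<le> 1" for g
      using that by (intro integrable_of_real rM ind) auto
    have iN: "integrable N (\<lambda>x. complex_of_real (V x * (indicator (A j) (Y j x) * g x)))" 
      if [measurable]: "g \<in> borel_measurable N" and "\<And>x. \<bar>g x\<bar> \<le> 1" for g
      using that by (intro integrable_of_real rN ind) auto
    have "(CLINT x|M. of_real (W x * indicator (A j) (X j x)) * iexp (p x)) =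
        of_real (LINT x|M. W x * (indicator (A j) (X j x) * cos (p x))) + \<i> * of_real (LINT x|M. W x * (indicator (A j) (X j x) * sin (p x)))"
      unfolding cis by (subst Bochner_Integration.integral_add) (auto intro!: iM simp del: of_real_mult)
    also have "\<dots> = (CLINT x|N. of_real (V x * indicator (A j) (Y j x)) * iexp (q x))"
      unfolding cis cc ss by (subst Bochner_Integration.integral_add) (auto intro!: iN simp del: of_real_mult)
    finally show ?thesis unfolding p_def q_def .
  qed
  have "(LINT x|M. (W x * indicator (A j) (X j x)) * (\<Prod>i\<in>I. indicator (A i) (X i x))) =
      (LINT x|N. (V x * indicator (A j) (Y j x)) * (\<Prod>i\<in>I. indicator (A i) (Y i x)))"
    by (rule insert.IH) (use bd step in \<open>auto simp: indicator_def intro!: measurable\<close>)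
  then show ?case using insert.hyps by (simp add: mult.assoc)
qed

text \<open>Rectangles form an intersection-stable generator, and the probability of one is the
  integral of a product of indicators, to which the weighted uniqueness applies with weight
  1.\<close>

lemma distr_PiM_eq_if_char_eq:
  fixes X :: "'i \<Rightarrow> 'a \<Rightarrow> real" and Y :: "'i \<Rightarrow> 'b \<Rightarrow> real"
  assumes M: "prob_space M" and N: "prob_space N" and I: "finite I"
    and X: "\<And>i. i \<in> I \<Longrightarrow> X i \<in> borel_measurable M" and Y: "\<And>i. i \<in> I \<Longrightarrow> Y i \<in> borel_measurable N"
    and eq: "\<And>s. (CLINT x|M. iexp (\<Sum>i\<in>I. s i * X i x)) = (CLINT x|N. iexp (\<Sum>i\<in>I. s i * Y i x))"
  shows "distr M (PiM I (\<lambda>_. borel)) (\<lambda>x. \<lambda>i\<in>I. X i x) = distr N (PiM I (\<lambda>_. borel)) (\<lambda>x. \<lambda>i\<in>I. Y i x)"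
proof -
  interpret M: prob_space M by fact
  interpret N: prob_space N by fact
  have mX: "(\<lambda>x. \<lambda>i\<in>I. X i x) \<in> measurable M (PiM I (\<lambda>_. borel))" using X by (rule measurable_restrict)
  have mY: "(\<lambda>x. \<lambda>i\<in>I. Y i x) \<in> measurable N (PiM I (\<lambda>_. borel))" using Y by (rule measurable_restrict)
  have rect: "emeasure (distr L (PiM I (\<lambda>_. borel)) (\<lambda>x. \<lambda>i\<in>I. Z i x)) (Pi\<^sub>E I A) =
      ennreal (LINT x|L. 1 * (\<Prod>i\<in>I. indicator (A i) (Z i x)))"
    if L: "prob_space L" and Z: "\<And>i. i \<in> I \<Longrightarrow> Z i \<in> borel_measurable L" and A: "\<And>i. i \<in> I \<Longrightarrow> A i \<in> sets borel"
    for L :: "'z measure" and Z :: "'i \<Rightarrow> 'z \<Rightarrow> real" and A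
  proof -
    interpret prob_space L by fact
    have A': "Pi\<^sub>E I A \<in> sets (PiM I (\<lambda>_. borel))" using I A by (intro sets_PiM_I_finite) auto
    have S: "(\<lambda>x. \<lambda>i\<in>I. Z i x) -` Pi\<^sub>E I A \<inter> space L \<in> sets L"
      by (rule measurable_sets[OF measurable_restrict A']) (use Z in auto)
    have "emeasure (distr L (PiM I (\<lambda>_. borel)) (\<lambda>x. \<lambda>i\<in>I. Z i x)) (Pi\<^sub>E I A) =
        emeasure L ((\<lambda>x. \<lambda>i\<in>I. Z i x) -` Pi\<^sub>E I A \<inter> space L)"
      using A' Z by (intro emeasure_distr measurable_restrict) auto
    also have "\<dots> = ennreal (LINT x|L. indicator ((\<lambda>x. \<lambda>i\<in>I. Z i x) -` Pi\<^sub>E I A \<inter> space L) x)"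
      using S by (simp add: emeasure_eq_measure)
    also have "(LINT x|L. indicator ((\<lambda>x. \<lambda>i\<in>I. Z i x) -` Pi\<^sub>E I A \<inter> space L) x) = (LINT x|L. 1 * (\<Prod>i\<in>I. indicator (A i) (Z i x) :: real))"
      using I by (intro Bochner_Integration.integral_cong) (auto simp: indicator_def PiE_iff intro!: prod_zero)
    finally show ?thesis .
  qed
  show ?thesis
  proof (rule measure_eqI_PiM_finite[OF I])
    fix A :: "'i \<Rightarrow> real set" assume A: "\<And>i. i \<in> I \<Longrightarrow> A i \<in> sets borel"
    have "(LINT x|M. 1 * (\<Prod>i\<in>I. indicator (A i) (X i x))) = (LINT x|N. 1 * (\<Prod>i\<in>I. indicator (A i) (Y i x) :: real))"
      using I X Y A eq by (intro weighted_joint_char_unique) (auto intro: M.finite_measure_axioms N.finite_measure_axioms)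
    then show "emeasure (distr M (PiM I (\<lambda>_. borel)) (\<lambda>x. \<lambda>i\<in>I. X i x)) (Pi\<^sub>E I A) =
        emeasure (distr N (PiM I (\<lambda>_. borel)) (\<lambda>x. \<lambda>i\<in>I. Y i x)) (Pi\<^sub>E I A)"
      using rect[OF M X A] rect[OF N Y A] by simp
  next
    show "range (\<lambda>_::nat. Pi\<^sub>E I (\<lambda>_. UNIV)) \<subseteq> prod_algebra I (\<lambda>_. borel)"
      using I by (auto intro!: prod_algebraI_finite)
    show "(\<Union>_::nat. Pi\<^sub>E I (\<lambda>_. UNIV)) = space (PiM I (\<lambda>_. borel :: real measure))" by (simp add: space_PiM)
    interpret prob_space "distr M (PiM I (\<lambda>_. borel)) (\<lambda>x. \<lambda>i\<in>I. X i x)" by (rule M.prob_space_distr[OF mX])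
    show "emeasure (distr M (PiM I (\<lambda>_. borel)) (\<lambda>x. \<lambda>i\<in>I. X i x)) (Pi\<^sub>E I (\<lambda>_. UNIV)) \<noteq> \<infinity>" for i :: nat
      by simp
  qed auto
qed

section \<open>Piecewise linear interpolation of paths\<close>

lemma scale_path_0 [simp]: "scale_path 0 x = 0"
  by (rule bcontfun_eqI) (simp add: apply_scale_path)

lemma norm_scale_path_le: "norm (scale_path c x) \<le> cmod c * norm x"
  by (rule norm_bound) (auto simp: apply_scale_path norm_mult intro!: mult_left_mono norm_bounded)

lemma bounded_linear_scale_path_left: "bounded_linear (\<lambda>c. scale_path c x)"
  by (rule bounded_linear_intro[where K="norm x"])
    (auto intro!: bcontfun_eqI norm_scale_path_le simp: apply_scale_path algebra_simps)

lemma path_space_iff: "x \<in> path_space T \<longleftrightarrow>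
    (\<forall>t\<le>0. apply_bcontfun x t = 0) \<and> (\<forall>t>T. apply_bcontfun x t = apply_bcontfun x T)"
  unfolding path_space_def mem_Collect_eq by (metis order.refl order_less_le)

lemma path_space_0 [simp]: "0 \<in> path_space T"
  by (auto simp: path_space_iff)

lemma path_space_add [intro]: "x \<in> path_space T \<Longrightarrow> y \<in> path_space T \<Longrightarrow> x + y \<in> path_space T"
  by (auto simp: path_space_iff)

lemma path_space_scale [intro]: "x \<in> path_space T \<Longrightarrow> scale_path c x \<in> path_space T"
  by (auto simp: path_space_iff apply_scale_path)

lemma path_space_sum [intro]: "(\<And>i. i \<in> I \<Longrightarrow> f i \<in> path_space T) \<Longrightarrow> (\<Sum>i\<in>I. f i) \<in> path_space T"
  by (induction I rule: infinite_finite_induct) auto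

lemma bounded_linear_apply_bcontfun: "bounded_linear (\<lambda>x. apply_bcontfun x t)"
  by (rule bounded_linear_intro[where K=1]) (auto simp: norm_bounded)

section \<open>Ramps, grids and the interpolation operator\<close>

definition ramp :: "real \<Rightarrow> real \<Rightarrow> real \<Rightarrow>\<^sub>C complex" where
  "ramp a b = Bcontfun (\<lambda>t. of_real (max 0 (min 1 ((t - a) / (b - a)))))"

lemma apply_ramp: "apply_bcontfun (ramp a b) t = of_real (max 0 (min 1 ((t - a) / (b - a))))"
proof -
  have "(\<lambda>t. complex_of_real (max 0 (min 1 ((t - a) / (b - a))))) \<in> bcontfun"
    unfolding bcontfun_def divide_inverse
    by (auto intro!: continuous_intros boundedI[where B=1])
  then show ?thesis by (simp add: ramp_def Bcontfun_inverse)
qed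

lemma ramp_left: "a < b \<Longrightarrow> t \<le> a \<Longrightarrow> apply_bcontfun (ramp a b) t = 0"
  by (auto simp: apply_ramp max_def min_def field_simps)

lemma ramp_right: "a < b \<Longrightarrow> b \<le> t \<Longrightarrow> apply_bcontfun (ramp a b) t = 1"
  by (auto simp: apply_ramp max_def min_def field_simps)

lemma ramp_mid: "a < b \<Longrightarrow> a \<le> t \<Longrightarrow> t \<le> b \<Longrightarrow> apply_bcontfun (ramp a b) t = of_real ((t - a) / (b - a))"
  by (auto simp: apply_ramp max_def min_def field_simps)

lemma ramp_in_path_space: "0 \<le> a \<Longrightarrow> a < b \<Longrightarrow> b \<le> T \<Longrightarrow> ramp a b \<in> path_space T"
  by (auto simp: path_space_iff ramp_left ramp_right)

definition grid :: "real \<Rightarrow> nat \<Rightarrow> nat \<Rightarrow> real" where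
  "grid T n i = T * real i / real n"

definition incr :: "real \<Rightarrow> nat \<Rightarrow> (real \<Rightarrow>\<^sub>C complex) \<Rightarrow> nat \<Rightarrow> complex" where
  "incr T n x i = apply_bcontfun x (grid T n (Suc i)) - apply_bcontfun x (grid T n i)"

text \<open>The parameters are increments rather than values at grid points, since the increments
  are the independent variables under Wiener measure. Only the first \<open>n\<close> entries of
  \<open>d\<close> matter.\<close>

definition interpolate :: "real \<Rightarrow> nat \<Rightarrow> (nat \<Rightarrow> complex) \<Rightarrow> real \<Rightarrow>\<^sub>C complex" where
  "interpolate T n d = (\<Sum>i<n. scale_path (d i) (ramp (grid T n i) (grid T n (Suc i))))"

lemma grid_0 [simp]: "grid T n 0 = 0" by (simp add: grid_def)

lemma grid_last: "0 < n \<Longrightarrow> grid T n n = T" by (simp add: grid_def)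

lemma grid_mono: "0 < T \<Longrightarrow> i \<le> j \<Longrightarrow> grid T n i \<le> grid T n j"
  by (auto simp: grid_def divide_right_mono)

lemma grid_diff: "grid T n (Suc i) - grid T n i = T / n"
  by (simp add: grid_def field_simps add_divide_distrib)

lemma grid_less: "0 < T \<Longrightarrow> 0 < n \<Longrightarrow> grid T n i < grid T n (Suc i)"
  by (simp add: grid_def divide_strict_right_mono)

lemma grid_bounds: "0 < T \<Longrightarrow> i \<le> n \<Longrightarrow> 0 \<le> grid T n i \<and> grid T n i \<le> T"
  by (cases "n = 0") (auto simp: grid_def field_simps)

lemma grid_ramp_in_path_space: "0 < T \<Longrightarrow> i < n \<Longrightarrow> ramp (grid T n i) (grid T n (Suc i)) \<in> path_space T"
  using grid_bounds[of T i n] grid_bounds[of T "Suc i" n] grid_less[of T n i]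
  by (intro ramp_in_path_space) auto

lemma interpolate_in_path_space: "0 < T \<Longrightarrow> interpolate T n d \<in> path_space T"
  unfolding interpolate_def by (intro path_space_sum path_space_scale grid_ramp_in_path_space) auto

lemma incr_scale_add:
  "incr T n (scale_path a x + scale_path b y) i = a * incr T n x i + b * incr T n y i"
  by (simp add: incr_def apply_scale_path algebra_simps)

lemma apply_bcontfun_sum: "apply_bcontfun (\<Sum>i\<in>I. f i) t = (\<Sum>i\<in>I. apply_bcontfun (f i) t)"
  by (induction I rule: infinite_finite_induct) auto

text \<open>On cell \<open>j\<close> the earlier ramps have already reached 1 and the later ones are
  still 0.\<close>

lemma apply_interpolate:
  assumes "0 < T" "j < n" "grid T n j \<le> t" "t \<le> grid T n (Suc j)"
  shows "apply_bcontfun (interpolate T n d) t = (\<Sum>i<j. d i) + d j * of_real ((t - grid T n j) / (T / n))"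
proof -
  have eq: "d i * apply_bcontfun (ramp (grid T n i) (grid T n (Suc i))) t =
      (if i < j then d i else if i = j then d j * of_real ((t - grid T n j) / (T / n)) else 0)" for i
  proof -
    have n: "0 < n" using assms by simp
    consider "i < j" | "i = j" | "j < i" by linarith
    then show ?thesis
    proof cases
      case 1
      then have "grid T n (Suc i) \<le> grid T n j" using assms by (intro grid_mono) auto
      then show ?thesis using 1 assms n by (simp add: ramp_right grid_less)
    next
      case 2
      then show ?thesis using assms n ramp_mid[OF grid_less[of T n j], of t] by (simp add: grid_diff)
    next
      case 3
      then have "grid T n (Suc j) \<le> grid T n i" using assms by (intro grid_mono) auto
      then show ?thesis using 3 assms n by (simp add: ramp_left grid_less)
    qed
  qed
  have "apply_bcontfun (interpolate T n d) t =
    (\<Sum>i<n. if i < j then d i else if i = j then d j * of_real ((t - grid T n j) / (T / n)) else 0)"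
    unfolding interpolate_def apply_bcontfun_sum apply_scale_path eq ..
  also have "\<dots> = (\<Sum>i<Suc j. if i < j then d i else if i = j then d j * of_real ((t - grid T n j) / (T / n)) else 0)"
    using assms by (intro sum.mono_neutral_right) auto
  finally show ?thesis by simp
qed

lemma sum_incr: "x \<in> path_space T \<Longrightarrow> (\<Sum>i<j. incr T n x i) = apply_bcontfun x (grid T n j)"
  using sum_lessThan_telescope[of "\<lambda>i. apply_bcontfun x (grid T n i)" j]
  by (simp add: incr_def path_space_iff)

lemma grid_locate:
  assumes "0 < T" "0 < n" "0 \<le> t" "t \<le> T"
  obtains j where "j < n" "grid T n j \<le> t" "t \<le> grid T n (Suc j)"
\<comment> \<open>The floor below would give \<open>n\<close> at \<open>t = T\<close>, one beyond
  the last cell.\<close>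
proof (cases "t = T")
  case True
  have "n - 1 < n" "grid T n (n - 1) \<le> t" "t \<le> grid T n (Suc (n - 1))"
    using True assms grid_last[of n T] less_imp_le[OF grid_less[of T n "n - 1"]] by simp_all
  then show ?thesis by (rule that)
next
  case False
  define j where "j = nat \<lfloor>t * n / T\<rfloor>"
  have p: "0 \<le> t * n / T" using assms by simp
  have j: "real j \<le> t * n / T" "t * n / T < real j + 1"
    using p unfolding j_def by linarith+
  have "t * n / T < n" using assms False by (simp add: field_simps)
  then have "j < n" using j by simp
  moreover have "grid T n j \<le> t" "t \<le> grid T n (Suc j)"
    using j assms by (simp_all add: grid_def pos_divide_le_eq pos_le_divide_eq pos_divide_less_eq mult.commute algebra_simps)
  ultimately show ?thesis by (rule that)
qed

text \<open>At any time of the line a path takes its value at that time clamped to [0,T].\<close>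

lemma norm_path_le:
  assumes "x \<in> path_space T" "0 < T" "\<And>t. 0 \<le> t \<Longrightarrow> t \<le> T \<Longrightarrow> cmod (apply_bcontfun x t) \<le> e"
  shows "norm x \<le> e"
proof (rule norm_bound)
  fix t
  have "apply_bcontfun x t = apply_bcontfun x (max 0 (min T t))"
  proof -
    consider "t \<le> 0" | "0 \<le> t" "t \<le> T" | "T \<le> t" by linarith
    then show ?thesis
      using assms(1,2) by cases (auto simp: path_space_iff order_le_less)
  qed
  then show "norm (apply_bcontfun x t) \<le> e" using assms(2,3) by simp
qed

lemma path_space_diff [intro]: "x \<in> path_space T \<Longrightarrow> y \<in> path_space T \<Longrightarrow> x - y \<in> path_space T"
  by (auto simp: path_space_iff)

text \<open>Uniform continuity on [0,T] bounds by e/4 both the oscillation of \<open>x\<close> from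
  the left grid point and the fraction of one increment that the interpolation adds. Grid sizes
  \<open>Suc n\<close> avoid the empty grid.\<close>

lemma interpolate_incr_tendsto:
  assumes T: "0 < T" and x: "x \<in> path_space T"
  shows "(\<lambda>n. interpolate T (Suc n) (incr T (Suc n) x)) \<longlonglongrightarrow> x"
proof (rule LIMSEQ_I)
  fix e :: real assume "0 < e"
  have e4: "0 < e / 4" using \<open>0 < e\<close> by simp
  have uc: "uniformly_continuous_on {0..T} (apply_bcontfun x)"
    by (intro compact_uniformly_continuous continuous_intros) auto
  obtain d where d: "d > 0" "\<And>s t. s \<in> {0..T} \<Longrightarrow> t \<in> {0..T} \<Longrightarrow> dist t s < d \<Longrightarrow>
      dist (apply_bcontfun x t) (apply_bcontfun x s) < e / 4"
    using uc[unfolded uniformly_continuous_on_def, rule_format, OF e4] by blast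
  obtain K where K: "T / d < real K" using reals_Archimedean2 by blast
  have "norm (interpolate T (Suc n) (incr T (Suc n) x) - x) < e" if "n \<ge> K" for n
  proof -
    have "T / d < real (Suc n)" using K that by (auto simp: of_nat_diff)
    then have small: "T / Suc n < d" using d T by (simp add: field_simps)
    have "norm (interpolate T (Suc n) (incr T (Suc n) x) - x) \<le> e / 2"
    proof (rule norm_path_le[OF _ T])
      fix t assume t: "0 \<le> t" "t \<le> T"
      obtain j where j: "j < Suc n" "grid T (Suc n) j \<le> t" "t \<le> grid T (Suc n) (Suc j)"
        using grid_locate[OF T _ t] by blast
      let ?a = "grid T (Suc n) j" and ?b = "grid T (Suc n) (Suc j)"
      let ?r = "(t - ?a) / (T / Suc n)"
      have b: "0 \<le> ?a" "?b \<le> T" using j T grid_bounds[of T j "Suc n"] grid_bounds[of T "Suc j" "Suc n"] by auto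
      have df: "?b - ?a = T / Suc n" by (rule grid_diff)
      have p: "0 < T / Suc n" using T by simp
      have r: "0 \<le> ?r" "?r \<le> 1"
        using j df p T unfolding divide_le_eq_1_pos[OF p] by (simp_all del: of_nat_Suc)
      have "cmod (incr T (Suc n) x j) \<le> e / 4" 
        using d(2)[of ?a ?b] b j t df small unfolding incr_def by (simp add: dist_norm)
      then have c: "cmod (incr T (Suc n) x j * of_real ?r) \<le> e / 4"
        using r unfolding norm_mult norm_of_real
        by (intro order_trans[OF mult_left_le[of _ "cmod (incr T (Suc n) x j)"]]) auto
      have a: "cmod (apply_bcontfun x ?a - apply_bcontfun x t) \<le> e / 4"
        using d(2)[of t ?a] b j t df small by (simp add: dist_norm)
      have eq: "apply_bcontfun (interpolate T (Suc n) (incr T (Suc n) x) - x) t =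
          (apply_bcontfun x ?a - apply_bcontfun x t) + incr T (Suc n) x j * of_real ?r"
        using apply_interpolate[OF T j] sum_incr[OF x] by simp
      show "cmod (apply_bcontfun (interpolate T (Suc n) (incr T (Suc n) x) - x) t) \<le> e / 2"
        unfolding eq using a c by (intro norm_triangle_le) linarith
    qed (use x interpolate_in_path_space[OF T] in auto)
    then show ?thesis using \<open>0 < e\<close> by simp
  qed
  then show "\<exists>no. \<forall>n\<ge>no. norm (interpolate T (Suc n) (incr T (Suc n) x) - x) < e" by blast
qed

section \<open>Functionals of the dual along interpolations\<close>

lemma path_dual_add: "\<phi> \<in> path_dual T \<Longrightarrow> x \<in> path_space T \<Longrightarrow> y \<in> path_space T \<Longrightarrow> \<phi> (x + y) = \<phi> x + \<phi> y"
  and path_dual_scale: "\<phi> \<in> path_dual T \<Longrightarrow> x \<in> path_space T \<Longrightarrow> \<phi> (scale_path c x) = c * \<phi> x"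
  by (auto simp: path_dual_def complex_linear_on_def)

lemma path_dual_0: "\<phi> \<in> path_dual T \<Longrightarrow> \<phi> 0 = 0"
  using path_dual_scale[of \<phi> T 0 0] by simp

lemma path_dual_sum: "\<phi> \<in> path_dual T \<Longrightarrow> (\<And>i. i \<in> I \<Longrightarrow> f i \<in> path_space T) \<Longrightarrow> \<phi> (\<Sum>i\<in>I. f i) = (\<Sum>i\<in>I. \<phi> (f i))"
  by (induction I rule: infinite_finite_induct) (auto simp: path_dual_0 path_dual_add path_space_sum)

lemma path_dual_interpolate:
  "0 < T \<Longrightarrow> \<phi> \<in> path_dual T \<Longrightarrow>
    \<phi> (interpolate T n d) = (\<Sum>i<n. d i * \<phi> (ramp (grid T n i) (grid T n (Suc i))))"
  unfolding interpolate_def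
  by (subst path_dual_sum) (auto intro!: path_space_scale grid_ramp_in_path_space sum.cong simp: path_dual_scale[OF _ grid_ramp_in_path_space])

lemma path_dual_interpolate_tendsto:
  assumes "0 < T" "\<phi> \<in> path_dual T" "x \<in> path_space T"
  shows "(\<lambda>n. \<phi> (interpolate T (Suc n) (incr T (Suc n) x))) \<longlonglongrightarrow> \<phi> x"
proof -
  have "continuous_on (path_space T) \<phi>" using assms by (simp add: path_dual_def)
  then show ?thesis
    by (rule continuous_on_tendsto_compose[OF _ interpolate_incr_tendsto])
      (use assms interpolate_in_path_space in auto)
qed

lemma continuous_interpolate: "continuous_on UNIV (interpolate T n)"
  unfolding interpolate_def
  by (intro continuous_intros bounded_linear.continuous_on[OF bounded_linear_scale_path_left]
    continuous_on_product_coordinates)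

lemma measurable_interpolate:
  assumes "\<And>i. i < n \<Longrightarrow> (\<lambda>x. d x i) \<in> borel_measurable M"
  shows "(\<lambda>x. interpolate T n (d x)) \<in> borel_measurable M"
proof -
  \<comment> \<open>Continuity of \<open>interpolate\<close> refers to whole sequences, whereas only
    the first \<open>n\<close> coordinates are known to be measurable; padding with 0 bridges
    this.\<close>
  have "(\<lambda>x. interpolate T n (d x)) = (\<lambda>x. interpolate T n (\<lambda>i. if i < n then d x i else 0))"
    unfolding interpolate_def by (intro ext sum.cong) auto
  also have "\<dots> \<in> borel_measurable M"
  proof (rule borel_measurable_continuous_on[OF continuous_interpolate], rule measurable_coordinatewise_then_product)
    show "(\<lambda>x. if i < n then d x i else 0) \<in> borel_measurable M" for i
      using assms[of i] by (cases "i < n") auto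
  qed
  finally show ?thesis .
qed

lemma measurable_apply_bcontfun: "(\<lambda>x :: real \<Rightarrow>\<^sub>C complex. apply_bcontfun x t) \<in> borel_measurable borel"
  by (intro borel_measurable_continuous_onI linear_continuous_on[OF bounded_linear_apply_bcontfun])

section \<open>Absolutely continuous functions and Riesz representers\<close>

text \<open>
  In a Riemann sum, the intervals tagged in the exceptional null set lie in an open set of small
  measure, so absolute continuity controls the increments of \<open>f\<close> over them.
\<close>

lemma ftc_abs_continuous:
  fixes f g :: "real \<Rightarrow> real"
  assumes ac: "abs_continuous_on S f" and S: "{a..b} \<subseteq> S" and ab: "a \<le> b"
    and N: "negligible N"
    and deriv: "\<And>x. x \<in> {a..b} - N \<Longrightarrow> (f has_real_derivative g x) (at x)"
  shows "(g has_integral (f b - f a)) {a..b}"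
proof -
  \<comment> \<open>Tags in \<open>N\<close> then contribute nothing to the Riemann sum, whatever
    \<open>g\<close> is there; only the increments of \<open>f\<close> over their intervals
    remain.\<close>
  define h where "h x = (if x \<in> N then 0 else g x)" for x
  have "(h has_integral (f b - f a)) {a..b}"
    unfolding has_integral_real
  proof (intro allI impI)
    fix e :: real assume e: "0 < e"
    \<comment> \<open>The summand 1 makes the bound strict and admits \<open>a = b\<close>.\<close>
    define c where "c = e / (2 * (b - a + 1))"
    have c: "0 < c" "c * (b - a) < e / 2"
      using e ab by (auto simp: c_def field_simps)
    obtain \<delta> where \<delta>: "\<delta> > 0" and
      ac': "\<And>D. D division_of (\<Union>D) \<Longrightarrow> \<Union>D \<subseteq> S \<Longrightarrow> (\<Sum>K\<in>D. measure lborel K) < \<delta> \<Longrightarrow>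
        (\<Sum>K\<in>D. \<bar>f (Sup K) - f (Inf K)\<bar>) < e / 2"
      using ac e unfolding abs_continuous_on_def by (meson half_gt_zero)
    have Nl: "N \<in> null_sets lebesgue" using N by (simp add: negligible_iff_null_sets)
    then obtain U where U: "open U" "N \<subseteq> U" "U - N \<in> lmeasurable" "emeasure lebesgue (U - N) < ennreal \<delta>"
      using sets_lebesgue_outer_open[OF _ \<delta>] by blast
    have "U \<in> sets lebesgue" using U(1) by (metis borel_open sets_completionI_sets sets_lborel)
    then have "emeasure lebesgue (U - N) = emeasure lebesgue U"
      by (intro emeasure_Diff_null_set Nl)
    then have eU: "emeasure lebesgue U < ennreal \<delta>" using U by simp
    have "\<exists>d>0. \<forall>y. \<bar>y - x\<bar> < d \<longrightarrow> \<bar>f y - f x - g x * (y - x)\<bar> \<le> c * \<bar>y - x\<bar>" if "x \<in> {a..b} - N" for x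
      using deriv[OF that] c(1) unfolding has_field_derivative_def has_derivative_within_alt by auto
    then obtain d where d: "\<And>x. x \<in> {a..b} - N \<Longrightarrow> 0 < d x"
      "\<And>x y. x \<in> {a..b} - N \<Longrightarrow> \<bar>y - x\<bar> < d x \<Longrightarrow> \<bar>f y - f x - g x * (y - x)\<bar> \<le> c * \<bar>y - x\<bar>"
      by metis
    define \<gamma> where "\<gamma> x = (if x \<in> N then U else if x \<in> {a..b} then ball x (d x) else UNIV)" for x
    have g: "gauge \<gamma>"
      using U d(1) by (auto simp: gauge_def \<gamma>_def)
    have main: "norm ((\<Sum>(x,K)\<in>p. measure lborel K *\<^sub>R h x) - (f b - f a)) < e"
      if p: "p tagged_division_of {a..b}" and fine: "\<gamma> fine p" for p
    proof -
      have fin: "finite p" using p by blast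
      define df where "df = (\<lambda>K. f (Sup K) - f (Inf K))"
      define p1 where "p1 = {(x,K)\<in>p. x \<notin> N}"
      define p2 where "p2 = {(x,K)\<in>p. x \<in> N}"
      have pp: "p = p1 \<union> p2" "p1 \<inter> p2 = {}" "finite p1" "finite p2" "p1 \<subseteq> p" "p2 \<subseteq> p"
        using fin by (auto simp: p1_def p2_def intro: finite_subset[OF _ fin])
      have K: "\<exists>u v. K = {u..v} \<and> u \<le> v \<and> x \<in> {u..v} \<and> {u..v} \<subseteq> {a..b}" if "(x, K) \<in> p" for x K
        using tagged_division_ofD(2,3,4)[OF p that] by (metis atLeastAtMost_iff box_real(2) order_trans)
      have "f b - f a = (\<Sum>(x,K)\<in>p. df K)"
        unfolding df_def by (rule additive_tagged_division_1[OF ab p, symmetric])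
      then have "(\<Sum>(x,K)\<in>p. measure lborel K *\<^sub>R h x) - (f b - f a) = (\<Sum>(x,K)\<in>p. measure lborel K * h x - df K)"
        by (simp add: sum_subtractf[symmetric] case_prod_beta)
      also have "\<dots> = (\<Sum>(x,K)\<in>p1. measure lborel K * h x - df K) + (\<Sum>(x,K)\<in>p2. measure lborel K * h x - df K)"
        by (subst pp(1)) (rule sum.union_disjoint[OF pp(3,4,2)])
      also have "norm \<dots> \<le> norm (\<Sum>(x,K)\<in>p1. measure lborel K * h x - df K) + norm (\<Sum>(x,K)\<in>p2. measure lborel K * h x - df K)"
        by (rule norm_triangle_ineq)
      \<comment> \<open>Straddle estimate: the tag lies between the endpoints, so the errors of
        linear approximation at the two endpoints add up to at most \<open>c\<close> times the
        length.\<close>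
      also have "norm (\<Sum>(x,K)\<in>p1. measure lborel K * h x - df K) \<le> (\<Sum>(x,K)\<in>p1. c * measure lborel K)"
      proof (rule sum_norm_le, clarify)
        fix x K assume xK: "(x, K) \<in> p1"
        then have xp: "(x, K) \<in> p" and xN: "x \<notin> N" by (auto simp: p1_def)
        obtain u v where uv: "K = {u..v}" "u \<le> v" "x \<in> {u..v}" "{u..v} \<subseteq> {a..b}" using K[OF xp] by blast
        have x: "x \<in> {a..b} - N" using uv xN by auto
        have "K \<subseteq> ball x (d x)" using fineD[OF fine xp] x by (simp add: \<gamma>_def)
        moreover have "u \<in> K" "v \<in> K" using uv by auto
        ultimately have "u \<in> ball x (d x)" "v \<in> ball x (d x)" by auto
        then have "\<bar>u - x\<bar> < d x" "\<bar>v - x\<bar> < d x" by (auto simp: dist_real_def abs_minus_commute)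
        then have "\<bar>f u - f x - g x * (u - x)\<bar> \<le> c * \<bar>u - x\<bar>" "\<bar>f v - f x - g x * (v - x)\<bar> \<le> c * \<bar>v - x\<bar>"
          using d(2)[OF x] by auto
        then have "\<bar>f u - f x - g x * (u - x)\<bar> \<le> c * x - c * u" "\<bar>f v - f x - g x * (v - x)\<bar> \<le> c * v - c * x"
          using uv by (auto simp: algebra_simps)
        then have "\<bar>(v - u) * g x - (f v - f u)\<bar> \<le> c * v - c * u"
          by (auto simp: algebra_simps abs_le_iff)
        then show "norm (measure lborel K * h x - df K) \<le> c * measure lborel K"
          using uv xN by (simp add: df_def h_def algebra_simps)
      qed
      also have "(\<Sum>(x,K)\<in>p1. c * measure lborel K) \<le> (\<Sum>(x,K)\<in>p. c * measure lborel K)"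
        using c pp fin by (intro sum_mono2) (auto intro!: mult_nonneg_nonneg)
      also have "(\<Sum>(x,K)\<in>p. c * measure lborel K) = c * (\<Sum>(x,K)\<in>p. measure lborel K)"
        by (simp add: sum_distrib_left case_prod_beta)
      also have "\<dots> = c * (b - a)"
        using additive_content_tagged_division[of p a b] p ab by simp
      \<comment> \<open>The guard is there because \<open>f\<close> is uncontrolled at
        \<open>Sup {}\<close> and \<open>Inf {}\<close>, while the passage from tagged pairs to
        intervals below requires degenerate intervals to contribute 0.\<close>
      also have "norm (\<Sum>(x,K)\<in>p2. measure lborel K * h x - df K) \<le> (\<Sum>(x,K)\<in>p2. if K = {} then 0 else \<bar>df K\<bar>)"
        by (rule sum_norm_le) (use K in \<open>fastforce simp: p2_def h_def\<close>)
      also have "\<dots> < e / 2"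
      proof -
        have pd: "p2 tagged_partial_division_of {a..b}"
          using p pp tagged_partial_division_subset tagged_division_of_def by metis
        have pd2: "p2 tagged_division_of \<Union>(snd ` p2)" by (rule tagged_partial_division_of_Union_self[OF pd])
        have div: "snd ` p2 division_of \<Union>(snd ` p2)" by (rule division_of_tagged_division[OF pd2])
        have sub: "\<Union>(snd ` p2) \<subseteq> {a..b}" using tagged_partial_division_ofD(3)[OF pd] by force
        have subU: "\<Union>(snd ` p2) \<subseteq> U"
          using fineD[OF fine] by (fastforce simp: p2_def \<gamma>_def)
        have "(\<Sum>K\<in>snd ` p2. measure lborel K) = (\<Sum>K\<in>snd ` p2. measure lebesgue K)"
        proof (intro sum.cong refl)
          fix K assume "K \<in> snd ` p2"
          then obtain u v where "K = cbox u v" using division_ofD(4)[OF div] by blast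
          then show "measure lborel K = measure lebesgue K" by simp
        qed
        also have "\<dots> = measure lebesgue (\<Union>(snd ` p2))" by (rule content_division[OF div])
        also have "\<dots> < \<delta>"
        proof -
          have "emeasure lebesgue (\<Union>(snd ` p2)) < ennreal \<delta>"
            using emeasure_mono[OF subU, of lebesgue] \<open>U \<in> sets lebesgue\<close> eU by (metis order_le_less_trans)
          then show ?thesis using \<delta> unfolding measure_def
            by (cases "emeasure lebesgue (\<Union>(snd ` p2))") (auto simp: ennreal_less_iff)
        qed
        finally have small: "(\<Sum>K\<in>snd ` p2. measure lborel K) < \<delta>" .
        have "(\<Sum>(x,K)\<in>p2. if K = {} then 0 else \<bar>df K\<bar>) = (\<Sum>K\<in>snd ` p2. if K = {} then 0 else \<bar>df K\<bar>)"
          by (rule sum.over_tagged_division_lemma[OF pd2]) (auto simp: df_def)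
        also have "\<dots> \<le> (\<Sum>K\<in>snd ` p2. \<bar>f (Sup K) - f (Inf K)\<bar>)"
          by (intro sum_mono) (auto simp: df_def)
        also have "\<dots> < e / 2" by (rule ac'[OF div _ small]) (use sub S in auto)
        finally show ?thesis .
      qed
      finally show ?thesis using c by simp
    qed
    show "\<exists>\<gamma>. gauge \<gamma> \<and> (\<forall>p. p tagged_division_of {a..b} \<and> \<gamma> fine p \<longrightarrow>
        norm ((\<Sum>(x,K)\<in>p. measure lborel K *\<^sub>R h x) - (f b - f a)) < e)"
      by (intro exI[of _ \<gamma>] conjI allI impI g main) auto
  qed
  then show ?thesis
    by (rule has_integral_spike[OF N, rotated]) (simp add: h_def)
qed

section \<open>Derivatives of Cameron-Martin paths\<close>

lemma integrable_indicator_Icc: "integrable lebesgue (indicat_real {a..b::real})"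
  by (metis lmeasurable_iff_integrable lmeasurable_cbox box_real(2))

text \<open>Off a null set both components are differentiable and \<open>vector_derivative\<close>
  is the combination of their derivatives; integrability and the value of the integral ignore the
  exceptional set.\<close>

lemma cameron_martin_deriv:
  assumes h: "h \<in> cameron_martin T"
  shows cameron_martin_set_integrable: "set_integrable lebesgue {0..T} (\<lambda>s. vector_derivative (apply_bcontfun h) (at s))"
    and cameron_martin_ftc: "0 \<le> a \<Longrightarrow> a \<le> b \<Longrightarrow> b \<le> T \<Longrightarrow>
      ((\<lambda>s. vector_derivative (apply_bcontfun h) (at s)) has_integral
        (apply_bcontfun h b - apply_bcontfun h a)) {a..b}"
proof -
  let ?v = "\<lambda>s. vector_derivative (apply_bcontfun h) (at s)"
  have real: "\<exists>g N. negligible N \<and> (\<forall>s\<in>{0..T} - N. (f has_real_derivative g s) (at s)) \<and>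
      set_integrable lebesgue {0..T} g" if f: "cameron_martin_real T f" for f
  proof -
    obtain g where g: "AE s in lebesgue. s \<in> {0..T} \<longrightarrow> (f has_real_derivative g s) (at s)"
      "set_borel_measurable lebesgue {0..T} g" "set_integrable lebesgue {0..T} (\<lambda>s. (g s)\<^sup>2)"
      using f unfolding cameron_martin_real_def by blast
    obtain N where N: "negligible N" "\<forall>s\<in>{0..T} - N. (f has_real_derivative g s) (at s)"
      using g(1) unfolding eventually_ae_filter_negligible by blast
    \<comment> \<open>Square integrability gives integrability on a bounded interval through
      \<open>\<bar>y\<bar> \<le> 1 + y\<^sup>2\<close>.\<close>
    have "set_integrable lebesgue {0..T} g"
      unfolding set_integrable_def
    proof (rule Bochner_Integration.integrable_bound)
      have "set_integrable lebesgue {0..T} (\<lambda>s. 1 :: real)"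
        by (simp add: set_integrable_def integrable_indicator_Icc)
      from set_integral_add(1)[OF this g(3)]
      show "integrable lebesgue (\<lambda>s. indicator {0..T} s *\<^sub>R (1 + (g s)\<^sup>2))"
        by (simp add: set_integrable_def)
      show "(\<lambda>s. indicator {0..T} s *\<^sub>R g s) \<in> borel_measurable lebesgue"
        using g(2) by (simp add: set_borel_measurable_def)
      have "\<bar>y\<bar> \<le> 1 + y\<^sup>2" for y :: real
        using zero_le_power2[of "\<bar>y\<bar> - 1"] unfolding power2_diff by simp
      then show "AE s in lebesgue. norm (indicator {0..T} s *\<^sub>R g s) \<le> norm (indicator {0..T} s *\<^sub>R (1 + (g s)\<^sup>2))"
        by (auto simp: indicator_def intro!: AE_I2 order_trans[OF _ abs_ge_self])
    qed
    then show ?thesis using N by blast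
  qed
  have re: "cameron_martin_real T (\<lambda>t. Re (apply_bcontfun h t))" 
    and im: "cameron_martin_real T (\<lambda>t. Im (apply_bcontfun h t))"
    using h by (auto simp: cameron_martin_def)
  obtain g1 N1 where 1: "negligible N1" "\<And>s. s \<in> {0..T} - N1 \<Longrightarrow> ((\<lambda>t. Re (apply_bcontfun h t)) has_real_derivative g1 s) (at s)"
    "set_integrable lebesgue {0..T} g1"
    using real[OF re] by blast
  obtain g2 N2 where 2: "negligible N2" "\<And>s. s \<in> {0..T} - N2 \<Longrightarrow> ((\<lambda>t. Im (apply_bcontfun h t)) has_real_derivative g2 s) (at s)"
    "set_integrable lebesgue {0..T} g2"
    using real[OF im] by blast
  have N: "negligible (N1 \<union> N2)" using 1 2 by simp
  have v: "?v s = of_real (g1 s) + \<i> * of_real (g2 s)" if "s \<in> {0..T} - (N1 \<union> N2)" for s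
  proof -
    have "(apply_bcontfun h has_vector_derivative Complex (g1 s) (g2 s)) (at s)"
      using 1(2)[of s] 2(2)[of s] that by (simp add: has_vector_derivative_complex_iff)
    then have "?v s = Complex (g1 s) (g2 s)" by (rule vector_derivative_at)
    then show ?thesis by (simp add: complex_eq_iff)
  qed
  have c: "set_integrable lebesgue {0..T} (\<lambda>s. complex_of_real (g s))" if "set_integrable lebesgue {0..T} g" for g
    using integrable_of_real[OF that[unfolded set_integrable_def], where 'a=complex]
    unfolding set_integrable_def by (simp add: scaleR_conv_of_real)
  have "set_integrable lebesgue {0..T} (\<lambda>s. complex_of_real (g1 s) + \<i> * of_real (g2 s))"
    by (intro set_integral_add set_integrable_mult_right c 1(3) 2(3))
  then show "set_integrable lebesgue {0..T} ?v"
    by (rule absolutely_integrable_spike[OF _ N v])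
  assume ab: "0 \<le> a" "a \<le> b" "b \<le> T"
  have *: "((\<lambda>s. complex_of_real (f s)) has_integral of_real I) S" if "(f has_integral I) S" for f I and S :: "real set"
    using has_integral_linear[OF that bounded_linear_of_real[where 'a=complex]] by (simp add: o_def)
  have i1: "(g1 has_integral (Re (apply_bcontfun h b) - Re (apply_bcontfun h a))) {a..b}"
    by (rule ftc_abs_continuous[of "{0..T}" _ _ _ N1]) (use re ab 1 in \<open>auto simp: cameron_martin_real_def\<close>)
  have i2: "(g2 has_integral (Im (apply_bcontfun h b) - Im (apply_bcontfun h a))) {a..b}"
    by (rule ftc_abs_continuous[of "{0..T}" _ _ _ N2]) (use im ab 2 in \<open>auto simp: cameron_martin_real_def\<close>)
  have "((\<lambda>s. of_real (g1 s) + \<i> * of_real (g2 s)) has_integral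
      (of_real (Re (apply_bcontfun h b) - Re (apply_bcontfun h a)) + \<i> * of_real (Im (apply_bcontfun h b) - Im (apply_bcontfun h a)))) {a..b}"
    by (intro has_integral_add has_integral_mult_right * i1 i2)
  also have "(of_real (Re (apply_bcontfun h b) - Re (apply_bcontfun h a)) + \<i> * of_real (Im (apply_bcontfun h b) - Im (apply_bcontfun h a)))
    = apply_bcontfun h b - apply_bcontfun h a" by (simp add: complex_eq_iff)
  finally show "(?v has_integral (apply_bcontfun h b - apply_bcontfun h a)) {a..b}"
    by (rule has_integral_spike[OF N, rotated]) (use v ab in auto)
qed

text \<open>The ramp is Lipschitz with constant 1/(b-a), so \<open>e * (b - a)\<close> serves as the
  delta of absolute continuity; \<open>a\<close> and \<open>b\<close> form the exceptional set of
  the derivative.\<close>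

lemma ramp_in_cameron_martin:
  assumes ab: "0 \<le> a" "a < b" "b \<le> T"
  shows "ramp a b \<in> cameron_martin T"
proof -
  define f where "f t = max 0 (min 1 ((t - a) / (b - a)))" for t
  define g where "g t = (if a < t \<and> t < b then 1 / (b - a) else 0)" for t
  have lip: "\<bar>f v - f u\<bar> \<le> (1 / (b - a)) * (v - u)" if "u \<le> v" for u v
  proof -
    have "(u - a) / (b - a) \<le> (v - a) / (b - a)" using that ab by (simp add: divide_right_mono)
    moreover have "(v - a) / (b - a) - (u - a) / (b - a) = (1 / (b - a)) * (v - u)"
      by (simp add: diff_divide_distrib[symmetric])
    ultimately show ?thesis unfolding f_def max_def min_def by auto
  qed
  have ac: "abs_continuous_on {0..T} f"
    unfolding abs_continuous_on_def
  proof (intro allI impI)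
    fix e :: real assume e: "0 < e"
    have "(\<Sum>K\<in>D. \<bar>f (Sup K) - f (Inf K)\<bar>) < e"
      if D: "D division_of (\<Union>D)" and small: "(\<Sum>K\<in>D. measure lborel K) < e * (b - a)" for D
    proof -
      have "(\<Sum>K\<in>D. \<bar>f (Sup K) - f (Inf K)\<bar>) \<le> (\<Sum>K\<in>D. (1 / (b - a)) * measure lborel K)"
      proof (rule sum_mono)
        fix K assume "K \<in> D"
        then obtain u v where "K = cbox u v" "K \<noteq> {}" using division_ofD(3,4)[OF D] by blast
        then show "\<bar>f (Sup K) - f (Inf K)\<bar> \<le> (1 / (b - a)) * measure lborel K"
          using lip[of u v] by auto
      qed
      also have "\<dots> = (1 / (b - a)) * (\<Sum>K\<in>D. measure lborel K)" by (simp add: sum_distrib_left)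
      also have "\<dots> < (1 / (b - a)) * (e * (b - a))" using small ab by (intro mult_strict_left_mono) auto
      finally show ?thesis using ab by simp
    qed
    moreover have "0 < e * (b - a)" using e ab by simp
    ultimately show "\<exists>\<delta>>0. \<forall>D. D division_of \<Union>D \<and> \<Union>D \<subseteq> {0..T} \<and> (\<Sum>K\<in>D. measure lborel K) < \<delta> \<longrightarrow>
          (\<Sum>K\<in>D. \<bar>f (Sup K) - f (Inf K)\<bar>) < e"
      by (intro exI[of _ "e * (b - a)"]) auto
  qed
  have der: "(f has_real_derivative g s) (at s)" if "s \<notin> {a, b}" for s
  proof -
    consider "s < a" | "a < s" "s < b" | "b < s" using \<open>s \<notin> {a, b}\<close> by fastforce
    then show ?thesis
    proof cases
      case 1
      have "(f has_real_derivative 0) (at s)"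
        by (rule has_field_derivative_transform_within_open[where f="\<lambda>_. 0" and S="{..<a}"])
          (use 1 ab in \<open>auto simp: f_def max_def min_def field_simps\<close>)
      then show ?thesis using 1 by (simp add: g_def)
    next
      case 2
      have "((\<lambda>t. (t - a) / (b - a)) has_real_derivative 1 / (b - a)) (at s)"
        using ab by (auto intro!: derivative_eq_intros)
      then have "(f has_real_derivative 1 / (b - a)) (at s)"
        by (rule has_field_derivative_transform_within_open[where S="{a<..<b}"])
          (use 2 ab in \<open>auto simp: f_def max_def min_def field_simps\<close>)
      then show ?thesis using 2 by (simp add: g_def)
    next
      case 3
      have "(f has_real_derivative 0) (at s)"
        by (rule has_field_derivative_transform_within_open[where f="\<lambda>_. 1" and S="{b<..}"])
          (use 3 ab in \<open>auto simp: f_def max_def min_def field_simps\<close>)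
      then show ?thesis using 3 by (simp add: g_def)
    qed
  qed
  have gm: "g \<in> borel_measurable borel" unfolding g_def by measurable
  have "cameron_martin_real T f"
    unfolding cameron_martin_real_def
  proof (intro conjI exI[of _ g])
    show "f 0 = 0" using ab by (simp add: f_def field_simps)
    show "AE s in lebesgue. s \<in> {0..T} \<longrightarrow> (f has_real_derivative g s) (at s)"
      unfolding eventually_ae_filter_negligible using der by (intro exI[of _ "{a,b}"]) auto
    show "set_borel_measurable lebesgue {0..T} g"
      using gm unfolding set_borel_measurable_def
      by (intro measurable_completion) measurable
    show "set_integrable lebesgue {0..T} (\<lambda>s. (g s)\<^sup>2)"
      unfolding set_integrable_def
    proof (rule Bochner_Integration.integrable_bound[where f="\<lambda>s. indicator {0..T} s *\<^sub>R (1 / (b - a))\<^sup>2"])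
      show "(\<lambda>s. indicator {0..T} s *\<^sub>R (g s)\<^sup>2) \<in> borel_measurable lebesgue"
        using gm by (intro measurable_completion) measurable
      show "integrable lebesgue (\<lambda>s. indicator {0..T} s *\<^sub>R (1 / (b - a))\<^sup>2)"
        using integrable_indicator_Icc[of 0 T] by simp
    qed (auto simp: g_def indicator_def)
  qed (rule ac)
  moreover have "cameron_martin_real T (\<lambda>_. 0)"
    unfolding cameron_martin_real_def abs_continuous_on_def
    by (intro conjI exI[of _ "\<lambda>_. 0"]) (auto simp: set_borel_measurable_def set_integrable_def intro: exI[of _ 1])
  ultimately show ?thesis
    using ramp_in_path_space[OF ab] by (simp add: cameron_martin_def apply_ramp f_def[abs_def])
qed

text \<open>Up to the two kinks, the derivative of a ramp is 1/(b-a) on [a,b] and 0 elsewhere, so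
  the inner product is the mean over [a,b] of the conjugated derivative of \<open>h\<close>, which
  the fundamental theorem evaluates.\<close>

lemma cm_inner_ramp:
  assumes h: "h \<in> cameron_martin T" and ab: "0 \<le> a" "a < b" "b \<le> T"
  shows "cm_inner T (ramp a b) h = cnj (apply_bcontfun h b - apply_bcontfun h a) / of_real (b - a)"
proof -
  let ?v = "\<lambda>s. vector_derivative (apply_bcontfun h) (at s)"
  let ?e = "\<lambda>s. vector_derivative (apply_bcontfun (ramp a b)) (at s)"
  define k where "k s = (if s \<in> {a..b} then cnj (?v s) / of_real (b - a) else 0)" for s
  have e: "?e s = (if s \<in> {a..b} then 1 / of_real (b - a) else 0)" if "s \<notin> {a, b}" for s
  proof -
    consider "s < a" | "a < s" "s < b" | "b < s" using \<open>s \<notin> {a, b}\<close> by fastforce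
    then show ?thesis
    proof cases
      case 1
      have "(apply_bcontfun (ramp a b) has_vector_derivative 0) (at s)"
        by (rule has_vector_derivative_transform_within_open[where f="\<lambda>_. 0" and S="{..<a}"])
          (use 1 ab in \<open>auto simp: ramp_left\<close>)
      then show ?thesis using 1 by (auto intro: vector_derivative_at)
    next
      case 2
      have "((\<lambda>t. complex_of_real ((t - a) / (b - a))) has_vector_derivative of_real (1 / (b - a))) (at s)"
        using ab by (intro has_vector_derivative_of_real) (auto intro!: derivative_eq_intros)
      then have "(apply_bcontfun (ramp a b) has_vector_derivative of_real (1 / (b - a))) (at s)"
        by (rule has_vector_derivative_transform_within_open[where S="{a<..<b}"])
          (use 2 ab in \<open>auto simp: ramp_mid\<close>)
      then show ?thesis using 2 by (auto intro: vector_derivative_at)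
    next
      case 3
      have "(apply_bcontfun (ramp a b) has_vector_derivative 0) (at s)"
        by (rule has_vector_derivative_transform_within_open[where f="\<lambda>_. 1" and S="{b<..}"])
          (use 3 ab in \<open>auto simp: ramp_right\<close>)
      then show ?thesis using 3 by (auto intro: vector_derivative_at)
    qed
  qed
  have neg: "negligible {a, b}" by simp
  have "set_integrable lebesgue {a..b} ?v"
    by (rule set_integrable_subset[OF cameron_martin_set_integrable[OF h]]) (use ab in auto)
  then have "integrable lebesgue (\<lambda>s. cnj (indicator {a..b} s *\<^sub>R ?v s) / of_real (b - a))"
    unfolding set_integrable_def
    by (intro Bochner_Integration.integrable_divide integrable_bounded_linear[OF bounded_linear_cnj])
  moreover have "(\<lambda>s. cnj (indicator {a..b} s *\<^sub>R ?v s) / of_real (b - a)) = (\<lambda>s. indicator {0..T} s *\<^sub>R k s)"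
    using ab by (auto simp: k_def indicator_def fun_eq_iff)
  ultimately have "set_integrable lebesgue {0..T} k"
    unfolding set_integrable_def by simp
  then have "set_integrable lebesgue {0..T} (\<lambda>s. ?e s * cnj (?v s))"
    by (rule absolutely_integrable_spike[OF _ neg]) (auto simp: e k_def)
  from has_integral_set_lebesgue[OF this]
  have "((\<lambda>s. ?e s * cnj (?v s)) has_integral cm_inner T (ramp a b) h) {0..T}"
    by (simp add: cm_inner_def)
  moreover have "((\<lambda>s. ?e s * cnj (?v s)) has_integral (cnj (apply_bcontfun h b - apply_bcontfun h a) / of_real (b - a))) {0..T}"
  proof (rule has_integral_spike[OF neg])
    have "(cnj \<circ> ?v has_integral cnj (apply_bcontfun h b - apply_bcontfun h a)) {a..b}"
      unfolding has_integral_cnj by (rule cameron_martin_ftc[OF h]) (use ab in auto)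
    then have "((\<lambda>s. cnj (?v s) / of_real (b - a)) has_integral (cnj (apply_bcontfun h b - apply_bcontfun h a) / of_real (b - a))) {a..b}"
      unfolding o_def by (rule has_integral_divide)
    then show "(k has_integral (cnj (apply_bcontfun h b - apply_bcontfun h a) / of_real (b - a))) {0..T}"
      unfolding k_def using ab by (subst has_integral_restrict) auto
  qed (auto simp: e k_def)
  ultimately show ?thesis by (rule has_integral_unique)
qed

text \<open>
  The covariance of two functionals on the discretised path is one functional evaluated at the
  interpolated representer of the other. This avoids any convergence statement in \<open>H\<close>.
\<close>

lemma path_dual_gram_interpolate:
  assumes T: "0 < T" and \<phi>: "\<phi> \<in> path_dual T" and k: "riesz_representer T \<psi> k" and n: "0 < n"
  shows "of_real (T / n) * (\<Sum>i<n. \<phi> (ramp (grid T n i) (grid T n (Suc i))) * cnj (\<psi> (ramp (grid T n i) (grid T n (Suc i)))))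
    = \<phi> (interpolate T n (incr T n k))"
proof -
  have kc: "k \<in> cameron_martin T" using k by (simp add: riesz_representer_def)
  \<comment> \<open>Testing the representer against a ramp reads off one increment of
    \<open>k\<close>; the conjugation and the factor \<open>T / n\<close> undo those in
    \<open>cm_inner_ramp\<close>.\<close>
  have eq: "of_real (T / n) * cnj (\<psi> (ramp (grid T n i) (grid T n (Suc i)))) = incr T n k i" if "i < n" for i
  proof -
    have b: "0 \<le> grid T n i" "grid T n i < grid T n (Suc i)" "grid T n (Suc i) \<le> T"
      using grid_bounds[of T i n] grid_bounds[of T "Suc i" n] grid_less[of T n i] T n that by auto
    have "\<psi> (ramp (grid T n i) (grid T n (Suc i))) = cm_inner T (ramp (grid T n i) (grid T n (Suc i))) k"
      using k ramp_in_cameron_martin[OF b] by (auto simp: riesz_representer_def)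
    also have "\<dots> = cnj (incr T n k i) / of_real (T / n)"
      using cm_inner_ramp[OF kc b] grid_diff[of T n i] by (simp add: incr_def)
    finally show ?thesis using T n by simp
  qed
  show ?thesis
    unfolding path_dual_interpolate[OF T \<phi>] sum_distrib_left
    by (intro sum.cong refl) (simp add: eq[symmetric] mult_ac)
qed

lemma path_dual_gram_tendsto:
  assumes T: "0 < T" and \<phi>: "\<phi> \<in> path_dual T" and k: "riesz_representer T \<psi> k"
  shows "(\<lambda>n. of_real (T / Suc n) * (\<Sum>i<Suc n. \<phi> (ramp (grid T (Suc n) i) (grid T (Suc n) (Suc i))) *
      cnj (\<psi> (ramp (grid T (Suc n) i) (grid T (Suc n) (Suc i)))))) \<longlonglongrightarrow> \<phi> k"
  unfolding path_dual_gram_interpolate[OF T \<phi> k zero_less_Suc]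
  by (rule path_dual_interpolate_tendsto[OF T \<phi>]) (use k in \<open>simp add: riesz_representer_def cameron_martin_def\<close>)

section \<open>The law of the increments and invariance of Wiener measure\<close>

text \<open>The hypothesis is the characteristic function of a product of standard normal laws, so
  joint uniqueness identifies the joint law with that product; marginals and independence are read
  off from it.\<close>

lemma (in prob_space) indep_std_normal_if_char:
  fixes X :: "'i \<Rightarrow> 'a \<Rightarrow> real"
  assumes I: "finite I" and X: "\<And>i. i \<in> I \<Longrightarrow> X i \<in> borel_measurable M"
    and ch: "\<And>s. (CLINT x|M. iexp (\<Sum>i\<in>I. s i * X i x)) = exp (- of_real (\<Sum>i\<in>I. (s i)\<^sup>2) / 2)"
  shows "indep_vars (\<lambda>_. borel) X I"
    and "i \<in> I \<Longrightarrow> distr M borel (X i) = std_normal_distribution"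
proof -
  let ?P = "PiM I (\<lambda>_. borel :: real measure)"
  let ?N = "PiM I (\<lambda>_. std_normal_distribution)"
  have std: "prob_space std_normal_distribution"
    using prob_space_normal_density by simp
  then interpret prod: product_prob_space "\<lambda>_. std_normal_distribution" I
    by (auto simp: product_prob_space_def product_prob_space_axioms_def product_sigma_finite_def
      intro: prob_space_imp_sigma_finite)
  have setsN: "sets ?N = sets ?P" by (intro sets_PiM_cong) auto
  have comp: "(\<lambda>\<omega>. \<omega> i) \<in> borel_measurable ?N" if "i \<in> I" for i
    using measurable_component_singleton[OF that, of "\<lambda>_. std_normal_distribution"] by simp
  have chN: "(CLINT \<omega>|?N. iexp (\<Sum>i\<in>I. s i * \<omega> i)) = exp (- of_real (\<Sum>i\<in>I. (s i)\<^sup>2) / 2)" for s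
  proof -
    have "(CLINT \<omega>|?N. iexp (\<Sum>i\<in>I. s i * \<omega> i)) = (CLINT \<omega>|?N. (\<Prod>i\<in>I. iexp (s i * \<omega> i)))"
      using I by (simp add: sum_distrib_left exp_sum)
    also have "\<dots> = (\<Prod>i\<in>I. (CLINT x|std_normal_distribution. iexp (s i * x)))"
      by (rule prod.product_integral_prod[OF I]) (rule prob_space.integrable_iexp[OF std], auto)
    also have "\<dots> = (\<Prod>i\<in>I. exp (- of_real ((s i)\<^sup>2) / 2))"
      using char_std_normal_distribution unfolding char_def fun_eq_iff
      by (intro prod.cong) (simp_all add: exp_of_real[symmetric])
    also have "\<dots> = exp (- of_real (\<Sum>i\<in>I. (s i)\<^sup>2) / 2)"
      using I by (simp add: exp_sum[symmetric] sum_negf sum_divide_distrib)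
    finally show ?thesis .
  qed
  have "distr M ?P (\<lambda>x. \<lambda>i\<in>I. X i x) = distr ?N ?P (\<lambda>x. \<lambda>i\<in>I. x i)"
    by (rule distr_PiM_eq_if_char_eq)
      (use I X comp ch chN in \<open>auto simp: prod.prob_space_axioms intro: prob_space_axioms\<close>)
  also have "\<dots> = distr ?N ?N (\<lambda>x. x)"
    by (rule distr_cong) (auto simp: space_PiM PiE_iff restrict_def extensional_def setsN)
  finally have law: "distr M ?P (\<lambda>x. \<lambda>i\<in>I. X i x) = ?N" by (simp add: distr_id)
  show one: "distr M borel (X i) = std_normal_distribution" if i: "i \<in> I" for i
  proof -
    have mX: "(\<lambda>x. \<lambda>i\<in>I. X i x) \<in> measurable M ?P" using X by (rule measurable_restrict)
    have "distr M borel (X i) = distr (distr M ?P (\<lambda>x. \<lambda>i\<in>I. X i x)) borel (\<lambda>\<omega>. \<omega> i)"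
      using i by (subst distr_distr[OF measurable_component_singleton mX]) (auto simp: o_def)
    also have "\<dots> = distr ?N std_normal_distribution (\<lambda>\<omega>. \<omega> i)"
      unfolding law by (rule distr_cong) auto
    also have "\<dots> = std_normal_distribution"
      by (rule distr_PiM_component) (use i std in auto)
    finally show ?thesis .
  qed
  show "indep_vars (\<lambda>_. borel) X I"
  proof (cases "I = {}")
    case False
    have "?N = PiM I (\<lambda>i. distr M borel (X i))" by (intro PiM_cong refl) (simp add: one)
    then show ?thesis
      using X law by (subst indep_vars_iff_distr_eq_PiM'[OF False]) auto
  qed (simp add: indep_vars_def indep_sets_def)
qed

lemma (in prob_space) integrable_iexp_real:
  fixes f :: "'a \<Rightarrow> real"
  shows "f \<in> borel_measurable M \<Longrightarrow> integrable M (\<lambda>x. iexp (f x))"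
  by (rule integrable_iexp) auto

text \<open>Every cell has length \<open>T / n\<close>, so the increments divided by
  \<open>sqrt (T / n)\<close> are standard normal, and independence factors the exponential of the
  sum.\<close>

lemma brownian_motion_char:
  assumes W: "brownian_motion M T W" and T: "0 < T" and n: "0 < n"
  shows "(CLINT x|M. iexp (\<Sum>i<n. s i * (W (grid T n (Suc i)) x - W (grid T n i) x))) =
    exp (- of_real (T / n * (\<Sum>i<n. (s i)\<^sup>2)) / 2)"
proof -
  interpret prob_space M using W by (simp add: brownian_motion_def)
  let ?D = "\<lambda>i x. W (grid T n (Suc i)) x - W (grid T n i) x"
  have ind: "indep_vars (\<lambda>_. borel) ?D {..<n}"
    using W T n grid_last[of n T] grid_less[of T n] unfolding brownian_motion_def by auto
  have one: "(CLINT x|M. iexp (c * ?D i x)) = exp (- of_real (T / n * c\<^sup>2) / 2)" if i: "i < n" for i c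
  proof -
    let ?\<sigma> = "sqrt (T / n)"
    have \<sigma>: "0 < ?\<sigma>" "?\<sigma>\<^sup>2 = T / n" using T n by auto
    have "distributed M lborel (?D i) (normal_density 0 (sqrt (grid T n (Suc i) - grid T n i)))"
      using W i T n grid_bounds[of T i n] grid_bounds[of T "Suc i" n] grid_less[of T n i]
      unfolding brownian_motion_def by auto
    then have "distributed M lborel (?D i) (normal_density 0 ?\<sigma>)" by (simp add: grid_diff)
    then have Z: "distributed M lborel (\<lambda>x. ?D i x / ?\<sigma>) std_normal_density"
      using normal_standard_normal_convert[OF \<sigma>(1), of "?D i" 0] by simp
    have mZ: "(\<lambda>x. ?D i x / ?\<sigma>) \<in> borel_measurable M"
      using distributed_measurable[OF Z] by simp
    have "distr M borel (\<lambda>x. ?D i x / ?\<sigma>) = distr M lborel (\<lambda>x. ?D i x / ?\<sigma>)"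
      by (rule distr_cong) auto
    also have "\<dots> = std_normal_distribution" using Z by (simp add: distributed_def)
    finally have dZ: "distr M borel (\<lambda>x. ?D i x / ?\<sigma>) = std_normal_distribution" .
    have "(CLINT x|M. iexp (c * ?D i x)) = (CLINT x|M. iexp ((c * ?\<sigma>) * (?D i x / ?\<sigma>)))"
      using T n by simp
    also have "\<dots> = char (distr M borel (\<lambda>x. ?D i x / ?\<sigma>)) (c * ?\<sigma>)"
      unfolding char_def using mZ by (subst integral_distr) auto
    also have "\<dots> = exp (- of_real ((c * ?\<sigma>)\<^sup>2) / 2)"
      unfolding dZ char_std_normal_distribution by (simp add: exp_of_real[symmetric])
    finally show ?thesis unfolding power_mult_distrib \<sigma>(2) by (simp add: mult.commute)
  qed
  have "(CLINT x|M. iexp (\<Sum>i<n. s i * ?D i x)) = (CLINT x|M. (\<Prod>i<n. iexp (s i * ?D i x)))"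
    by (simp add: sum_distrib_left exp_sum)
  also have "\<dots> = (\<Prod>i<n. (CLINT x|M. iexp (s i * ?D i x)))"
  proof (rule indep_vars_lebesgue_integral)
    show "indep_vars (\<lambda>_. borel) (\<lambda>i x. iexp (s i * ?D i x)) {..<n}"
      by (rule indep_vars_compose2[OF ind]) auto
    show "integrable M (\<lambda>x. iexp (s i * ?D i x))" if "i \<in> {..<n}" for i
      using ind that by (intro integrable_iexp_real borel_measurable_times) (auto simp: indep_vars_def)
  qed simp
  also have "\<dots> = (\<Prod>i<n. exp (- of_real (T / n * (s i)\<^sup>2) / 2))"
    by (intro prod.cong one) auto
  also have "\<dots> = exp (- of_real (T / n * (\<Sum>i<n. (s i)\<^sup>2)) / 2)"
    by (simp add: exp_sum[symmetric] sum_negf sum_divide_distrib sum_distrib_left)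
  finally show ?thesis .
qed

section \<open>Measurability and increments on Wiener space\<close>

locale wiener_space =
  fixes T :: real and \<mu> :: "(real \<Rightarrow>\<^sub>C complex) measure"
  assumes T_pos: "0 < T" and wiener: "complex_wiener_measure T \<mu>"
begin

sublocale prob_space \<mu>
  using wiener by (simp add: complex_wiener_measure_def)

lemma sets_wiener: "sets \<mu> = sets (restrict_space borel (path_space T))"
  using wiener by (simp add: complex_wiener_measure_def)

lemma space_wiener: "space \<mu> = path_space T"
  using sets_eq_imp_space_eq[OF sets_wiener] by (simp add: space_restrict_space)

lemma measurable_from_wiener: "f \<in> borel_measurable borel \<Longrightarrow> f \<in> borel_measurable \<mu>"
  by (subst measurable_cong_sets[OF sets_wiener refl]) (rule measurable_restrict_space1)

lemma measurable_to_wiener: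
  "f \<in> borel_measurable M \<Longrightarrow> (\<And>x. x \<in> space M \<Longrightarrow> f x \<in> path_space T) \<Longrightarrow> f \<in> measurable M \<mu>"
  by (subst measurable_cong_sets[OF refl sets_wiener]) (auto intro: measurable_restrict_space2)

lemma measurable_path_dual: "\<phi> \<in> path_dual T \<Longrightarrow> \<phi> \<in> borel_measurable \<mu>"
  unfolding path_dual_def
  by (subst measurable_cong_sets[OF sets_wiener refl]) (auto intro: borel_measurable_continuous_on_restrict)

lemma measurable_id_wiener: "(\<lambda>x. x) \<in> borel_measurable \<mu>"
  by (rule measurable_from_wiener) simp

lemma measurable_incr: "(\<lambda>x. incr T n x i) \<in> borel_measurable \<mu>"
  unfolding incr_def by (intro borel_measurable_diff measurable_from_wiener measurable_apply_bcontfun)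

text \<open>Since Re (d w) = Re d Re w - Im d Im w, the phase is a linear form in the real
  increments plus one, with coefficients \<open>- Im (d i)\<close>, in the imaginary increments;
  these are functionals of independent processes.\<close>

lemma char_incr:
  assumes n: "0 < n"
  shows "(CLINT x|\<mu>. iexp (Re (\<Sum>i<n. d i * incr T n x i))) = exp (- of_real (T / n * (\<Sum>i<n. (cmod (d i))\<^sup>2)) / 2)"
proof -
  let ?B = "\<Pi>\<^sub>M t\<in>{0..T}. borel :: real measure"
  define f where "f s \<omega> = (\<Sum>i<n. s i * (\<omega> (grid T n (Suc i)) - \<omega> (grid T n i)))" for s and \<omega> :: "real \<Rightarrow> real"
  have grid: "grid T n i \<in> {0..T}" if "i \<le> n" for i
    using grid_bounds[OF T_pos that] by simp
  have fm: "f s \<in> borel_measurable ?B" for s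
    unfolding f_def by (intro borel_measurable_sum borel_measurable_times borel_measurable_diff
      measurable_component_singleton grid) auto
  \<comment> \<open>Independence is available for the processes restricted to [0,T], and all grid
    points lie there.\<close>
  have fr: "f s (\<lambda>t\<in>{0..T}. g t) = f s g" for s g
    unfolding f_def using grid by (intro sum.cong) auto
  have bm: "brownian_motion \<mu> T (\<lambda>t x. Re (apply_bcontfun x t))" "brownian_motion \<mu> T (\<lambda>t x. Im (apply_bcontfun x t))"
    and ind: "indep_var ?B (\<lambda>x. \<lambda>t\<in>{0..T}. Re (apply_bcontfun x t)) ?B (\<lambda>x. \<lambda>t\<in>{0..T}. Im (apply_bcontfun x t))"
    using wiener by (auto simp: complex_wiener_measure_def planar_brownian_motion_def)
  let ?X = "\<lambda>x. iexp (f (\<lambda>i. Re (d i)) (\<lambda>t. Re (apply_bcontfun x t)))"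
  let ?Y = "\<lambda>x. iexp (f (\<lambda>i. - Im (d i)) (\<lambda>t. Im (apply_bcontfun x t)))"
  have "indep_var borel ?X borel ?Y"
    using indep_var_compose[OF ind, of "\<lambda>\<omega>. iexp (f (\<lambda>i. Re (d i)) \<omega>)" borel "\<lambda>\<omega>. iexp (f (\<lambda>i. - Im (d i)) \<omega>)" borel] fm
    by (simp add: o_def fr)
  moreover have "integrable \<mu> ?X" 
    unfolding f_def
    by (intro integrable_iexp_real borel_measurable_sum borel_measurable_times borel_measurable_diff borel_measurable_const
      measurable_from_wiener borel_measurable_Re borel_measurable_Im measurable_compose[OF measurable_apply_bcontfun])
  moreover have "integrable \<mu> ?Y"
    unfolding f_def
    by (intro integrable_iexp_real borel_measurable_sum borel_measurable_times borel_measurable_diff borel_measurable_const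
      measurable_from_wiener borel_measurable_Re borel_measurable_Im measurable_compose[OF measurable_apply_bcontfun])
  ultimately have "(CLINT x|\<mu>. ?X x * ?Y x) = (CLINT x|\<mu>. ?X x) * (CLINT x|\<mu>. ?Y x)"
    by (rule indep_var_lebesgue_integral)
  also have "(CLINT x|\<mu>. ?X x) = exp (- of_real (T / n * (\<Sum>i<n. (Re (d i))\<^sup>2)) / 2)"
    unfolding f_def by (rule brownian_motion_char[OF bm(1) T_pos n])
  also have "(CLINT x|\<mu>. ?Y x) = exp (- of_real (T / n * (\<Sum>i<n. (- Im (d i))\<^sup>2)) / 2)"
    unfolding f_def by (rule brownian_motion_char[OF bm(2) T_pos n])
  also have "exp (- complex_of_real (T / n * (\<Sum>i<n. (Re (d i))\<^sup>2)) / 2) * exp (- of_real (T / n * (\<Sum>i<n. (- Im (d i))\<^sup>2)) / 2)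
      = exp (- of_real (T / n * (\<Sum>i<n. (cmod (d i))\<^sup>2)) / 2)"
    by (simp add: exp_add[symmetric] cmod_power2 sum.distrib algebra_simps add_divide_distrib diff_divide_distrib)
  also have "(\<lambda>x. ?X x * ?Y x) = (\<lambda>x. iexp (Re (\<Sum>i<n. d i * incr T n x i)))"
  proof
    fix x
    have eq: "f (\<lambda>i. Re (d i)) (\<lambda>t. Re (apply_bcontfun x t)) + f (\<lambda>i. - Im (d i)) (\<lambda>t. Im (apply_bcontfun x t))
       = Re (\<Sum>i<n. d i * incr T n x i)"
      by (simp add: f_def incr_def sum.distrib[symmetric] algebra_simps)
    show "?X x * ?Y x = iexp (Re (\<Sum>i<n. d i * incr T n x i))"
      by (simp only: eq[symmetric] of_real_add distrib_left exp_add)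
  qed
  finally show ?thesis .
qed

end

text \<open>Closed sets generate the Borel sets and are stable under intersection; the indicator of
  one is the limit of the continuous functions
  \<open>max 0 (1 - real k * infdist z C)\<close>.\<close>

lemma distr_borel_eq_if_continuous_integrals_eq:
  fixes X :: "'a \<Rightarrow> 'c :: metric_space" and Y :: "'b \<Rightarrow> 'c"
  assumes M: "prob_space M" and N: "prob_space N"
    and [measurable]: "X \<in> borel_measurable M" "Y \<in> borel_measurable N"
    and eq: "\<And>f :: 'c \<Rightarrow> real. continuous_on UNIV f \<Longrightarrow> (\<And>z. \<bar>f z\<bar> \<le> 1) \<Longrightarrow>
      (LINT x|M. f (X x)) = (LINT y|N. f (Y y))"
  shows "distr M borel X = distr N borel Y"
proof (rule measure_eqI_generator_eq[where \<Omega>=UNIV and E="Collect closed" and A="\<lambda>_. UNIV"])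
  interpret M: prob_space M by fact
  interpret N: prob_space N by fact
  show "Int_stable (Collect (closed :: 'c set \<Rightarrow> bool))" by (auto simp: Int_stable_def)
  show "sets (distr M borel X) = sigma_sets UNIV (Collect closed)" 
    "sets (distr N borel Y) = sigma_sets UNIV (Collect closed)"
    unfolding sets_distr borel_eq_closed by (simp_all add: sets_measure_of)
  have 1: "emeasure (distr M borel X) UNIV = 1"
    using M.emeasure_space_1 by (simp add: emeasure_distr)
  then show "emeasure (distr M borel X) UNIV \<noteq> \<infinity>" for i :: nat by simp
  fix C :: "'c set" assume "C \<in> Collect closed"
  then have C: "closed C" by simp
  then have [measurable]: "C \<in> sets borel" by simp
  show "emeasure (distr M borel X) C = emeasure (distr N borel Y) C"
  \<comment> \<open>The empty set is separate because \<open>infdist z {}\<close> is 0, which would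
    give the limit 1.\<close>
  proof (cases "C = {}")
    case False
    define g where "g k z = max 0 (1 - real k * infdist z C)" for k z
    have gc: "continuous_on UNIV (g k)" for k unfolding g_def by (intro continuous_intros)
    then have [measurable]: "g k \<in> borel_measurable borel" for k by (rule borel_measurable_continuous_onI)
    have gb: "\<bar>g k z\<bar> \<le> 1" for k z using infdist_nonneg[of z C] by (auto simp: g_def max_def)
    have lim: "(\<lambda>k. g k z) \<longlonglongrightarrow> indicator C z" for z
    proof (cases "z \<in> C")
      case True
      then show ?thesis by (simp add: g_def)
    next
      case z: False
      then have p: "0 < infdist z C"
        using in_closed_iff_infdist_zero[OF C False] infdist_nonneg[of z C] by (metis order_less_le)
      obtain K where K: "1 / infdist z C < real K" using reals_Archimedean2 by blast
      have "g k z = indicator C z" if "K \<le> k" for k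
      proof -
        have "1 / infdist z C < real k" using K that by linarith
        then show ?thesis using p z by (simp add: g_def field_simps)
      qed
      then show ?thesis by (intro tendsto_eventually eventually_sequentiallyI[of K]) auto
    qed
    have "(\<lambda>k. LINT x|M. g k (X x)) \<longlonglongrightarrow> (LINT x|M. indicator C (X x))"
      by (rule integral_dominated_convergence[where w="\<lambda>_. 1"]) (use lim gb in auto)
    moreover have "(\<lambda>k. LINT y|N. g k (Y y)) \<longlonglongrightarrow> (LINT y|N. indicator C (Y y))"
      by (rule integral_dominated_convergence[where w="\<lambda>_. 1"]) (use lim gb in auto)
    ultimately have "(LINT x|M. indicator C (X x) :: real) = (LINT y|N. indicator C (Y y))"
      using eq[OF gc gb] LIMSEQ_unique by simp
    also have "(LINT x|M. indicator C (X x) :: real) = (LINT x|M. indicator (X -` C \<inter> space M) x)"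
      by (rule Bochner_Integration.integral_cong) (auto simp: indicator_def)
    also have "(LINT y|N. indicator C (Y y) :: real) = (LINT y|N. indicator (Y -` C \<inter> space N) y)"
      by (rule Bochner_Integration.integral_cong) (auto simp: indicator_def)
    finally show ?thesis
      by (simp add: emeasure_distr M.emeasure_eq_measure N.emeasure_eq_measure)
  qed simp
qed auto

lemma sum_times_bool:
  "(\<Sum>p\<in>A \<times> (UNIV :: bool set). g p) = (\<Sum>i\<in>A. g (i, False) + g (i, True))"
  using sum.cartesian_product[of "\<lambda>i b. g (i, b)" "UNIV :: bool set" A]
  by (simp add: case_prod_beta UNIV_bool add.commute)

section \<open>Invariance of Wiener measure under mixtures\<close>

context wiener_space
begin

text \<open>For each grid the characteristic functions fix the joint law of all real and imaginary
  parts of the increments, hence the integrals of functions of the interpolated path; dominated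
  convergence then removes the interpolation.\<close>

lemma distr_eq_wiener:
  assumes M: "prob_space M" and Z: "Z \<in> measurable M \<mu>"
    and ch: "\<And>n d. 0 < n \<Longrightarrow> (CLINT \<omega>|M. iexp (Re (\<Sum>i<n. d i * incr T n (Z \<omega>) i))) =
      exp (- of_real (T / n * (\<Sum>i<n. (cmod (d i))\<^sup>2)) / 2)"
  shows "distr M \<mu> Z = \<mu>"
proof -
  interpret M: prob_space M by fact
  have Zb [measurable]: "Z \<in> borel_measurable M"
    using measurable_compose[OF Z measurable_id_wiener] .
  have ZT: "Z \<omega> \<in> path_space T" if "\<omega> \<in> space M" for \<omega>
    using measurable_space[OF Z that] by (simp add: space_wiener)
  have mincr [measurable]: "(\<lambda>\<omega>. incr T n (Z \<omega>) i) \<in> borel_measurable M" for n i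
    by (rule measurable_compose[OF Z measurable_incr])
  note [measurable] = measurable_incr measurable_id_wiener
  have fin: "(LINT \<omega>|M. f (interpolate T n (incr T n (Z \<omega>)))) = (LINT x|\<mu>. f (interpolate T n (incr T n x)))"
    if f: "continuous_on UNIV f" and n: "0 < n" for f :: "_ \<Rightarrow> real" and n
  proof -
    let ?I = "{..<n} \<times> (UNIV :: bool set)"
    let ?P = "PiM ?I (\<lambda>_. borel :: real measure)"
    define X where "X p x = (if snd p then Im (incr T n x (fst p)) else Re (incr T n x (fst p)))" for p x
    define R where "R v = interpolate T n (\<lambda>i. of_real (v (i, False)) + \<i> * of_real (v (i, True)))" for v
    have XR: "R (\<lambda>p\<in>?I. X p x) = interpolate T n (incr T n x)" for x
      unfolding R_def interpolate_def by (intro sum.cong) (auto simp: X_def complex_eq[symmetric])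
    have fR: "(\<lambda>v. f (R v)) \<in> borel_measurable ?P"
      unfolding R_def
      by (intro measurable_compose[OF _ borel_measurable_continuous_onI[OF f]] measurable_interpolate
        borel_measurable_add borel_measurable_times borel_measurable_const measurable_compose[OF _ borel_measurable_of_real]
        measurable_component_singleton) auto
    have Xm: "X p \<in> borel_measurable \<mu>" for p
      unfolding X_def by (cases "snd p") auto
    have XZm: "(\<lambda>\<omega>. X p (Z \<omega>)) \<in> borel_measurable M" for p
      unfolding X_def by (cases "snd p") auto
    \<comment> \<open>The minus sign is a conjugation: Re ((s - i s') w) = s Re w + s' Im w.\<close>
    have sumX: "(\<Sum>p\<in>?I. s p * X p x) = Re (\<Sum>i<n. Complex (s (i, False)) (- s (i, True)) * incr T n x i)" for s x
      unfolding sum_times_bool by (simp add: X_def)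
    have law: "distr M ?P (\<lambda>\<omega>. \<lambda>p\<in>?I. X p (Z \<omega>)) = distr \<mu> ?P (\<lambda>x. \<lambda>p\<in>?I. X p x)"
      by (rule distr_PiM_eq_if_char_eq)
        (use Xm XZm M prob_space_axioms ch[OF n] char_incr[OF n] in \<open>auto simp: sumX simp del: Re_sum\<close>)
    have "(LINT \<omega>|M. f (interpolate T n (incr T n (Z \<omega>)))) = (LINT v|distr M ?P (\<lambda>\<omega>. \<lambda>p\<in>?I. X p (Z \<omega>)). f (R v))"
      using XZm by (subst integral_distr[OF measurable_restrict fR]) (auto simp: XR)
    also have "\<dots> = (LINT x|\<mu>. f (interpolate T n (incr T n x)))"
      unfolding law using Xm by (subst integral_distr[OF measurable_restrict fR]) (auto simp: XR)
    finally show ?thesis .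
  qed
  have "distr M borel Z = distr \<mu> borel (\<lambda>x. x)"
  proof (rule distr_borel_eq_if_continuous_integrals_eq[OF M prob_space_axioms Zb measurable_id_wiener])
    fix f :: "(real \<Rightarrow>\<^sub>C complex) \<Rightarrow> real" assume f: "continuous_on UNIV f" and b: "\<And>z. \<bar>f z\<bar> \<le> 1"
    have [measurable]: "f \<in> borel_measurable borel" using f by (rule borel_measurable_continuous_onI)
    have lim: "(\<lambda>n. f (interpolate T (Suc n) (incr T (Suc n) x))) \<longlonglongrightarrow> f x" if "x \<in> path_space T" for x
      by (rule continuous_on_tendsto_compose[OF f interpolate_incr_tendsto[OF T_pos that]]) auto
    have "(\<lambda>n. LINT \<omega>|M. f (interpolate T (Suc n) (incr T (Suc n) (Z \<omega>)))) \<longlonglongrightarrow> (LINT \<omega>|M. f (Z \<omega>))"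
      by (rule integral_dominated_convergence[where w="\<lambda>_. 1"])
        (use lim ZT b in \<open>auto intro!: measurable_compose[OF measurable_interpolate]\<close>)
    moreover have "(\<lambda>n. LINT x|\<mu>. f (interpolate T (Suc n) (incr T (Suc n) x))) \<longlonglongrightarrow> (LINT x|\<mu>. f x)"
      by (rule integral_dominated_convergence[where w="\<lambda>_. 1"])
        (use lim b in \<open>auto intro!: measurable_compose[OF measurable_interpolate] simp: space_wiener\<close>)
    ultimately show "(LINT \<omega>|M. f (Z \<omega>)) = (LINT x|\<mu>. f x)"
      unfolding fin[OF f zero_less_Suc] by (rule LIMSEQ_unique)
  qed
  note law = this
  \<comment> \<open>The laws agree on Borel sets of the ambient space; the measurable sets of
    \<open>\<mu>\<close> are their traces on the path space.\<close>
  show ?thesis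
  proof (rule measure_eqI)
    fix A assume A: "A \<in> sets (distr M \<mu> Z)"
    then obtain B where B: "B \<in> sets borel" "A = B \<inter> path_space T"
      by (auto simp: sets_wiener sets_restrict_space)
    have "emeasure (distr M \<mu> Z) A = emeasure M (Z -` B \<inter> space M)"
      using A ZT by (subst emeasure_distr[OF Z]) (auto simp: B intro!: arg_cong[where f="emeasure M"])
    also have "\<dots> = emeasure (distr M borel Z) B" using B by (simp add: emeasure_distr)
    also have "\<dots> = emeasure \<mu> ((\<lambda>x. x) -` B \<inter> space \<mu>)"
      unfolding law using B by (intro emeasure_distr) auto
    finally show "emeasure (distr M \<mu> Z) A = emeasure \<mu> A" by (simp add: B space_wiener)
  qed simp
qed

text \<open>The argument of the integrand of \<open>ou_integral\<close>, as a map on pairs of paths.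
  General coefficients are kept because the later arguments see them only through
  \<open>(cmod a)\<^sup>2 + b\<^sup>2 = 1\<close>.\<close>

definition mehler :: "complex \<Rightarrow> real \<Rightarrow> (real \<Rightarrow>\<^sub>C complex) \<times> (real \<Rightarrow>\<^sub>C complex) \<Rightarrow> real \<Rightarrow>\<^sub>C complex" where
  "mehler a b p = scale_path a (fst p) + scale_path (of_real b) (snd p)"

text \<open>Each increment of the mixture is a measurable combination of increments of the two
  paths, so the interpolated mixture is measurable, and the mixture is its pointwise limit.\<close>

lemma measurable_mehler: "mehler a b \<in> measurable (\<mu> \<Otimes>\<^sub>M \<mu>) \<mu>"
proof (rule measurable_to_wiener)
  note [measurable] = measurable_incr
  show in_path: "mehler a b p \<in> path_space T" if "p \<in> space (\<mu> \<Otimes>\<^sub>M \<mu>)" for p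
    using that unfolding mehler_def by (intro path_space_add path_space_scale) (auto simp: space_pair_measure space_wiener)
  have eq: "incr T n (mehler a b p) i = a * incr T n (fst p) i + of_real b * incr T n (snd p) i" for n p i
    unfolding mehler_def by (rule incr_scale_add)
  show "mehler a b \<in> borel_measurable (\<mu> \<Otimes>\<^sub>M \<mu>)"
  proof (rule borel_measurable_LIMSEQ_metric)
    show "(\<lambda>p. interpolate T (Suc n) (incr T (Suc n) (mehler a b p))) \<in> borel_measurable (\<mu> \<Otimes>\<^sub>M \<mu>)" for n
      by (rule measurable_interpolate) (simp add: eq)
    show "(\<lambda>n. interpolate T (Suc n) (incr T (Suc n) (mehler a b p))) \<longlonglongrightarrow> mehler a b p"
      if "p \<in> space (\<mu> \<Otimes>\<^sub>M \<mu>)" for p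
      by (rule interpolate_incr_tendsto[OF T_pos in_path[OF that]])
  qed
qed

lemma distr_mehler:
  assumes ab: "(cmod a)\<^sup>2 + b\<^sup>2 = 1"
  shows "distr (\<mu> \<Otimes>\<^sub>M \<mu>) \<mu> (mehler a b) = \<mu>"
proof (rule distr_eq_wiener[OF _ measurable_mehler])
  interpret P: pair_prob_space \<mu> \<mu> ..
  show "prob_space (\<mu> \<Otimes>\<^sub>M \<mu>)" by (rule P.P.prob_space_axioms)
  fix n :: nat and d assume n: "0 < n"
  note [measurable] = measurable_incr
  let ?F = "\<lambda>c x. iexp (Re (\<Sum>i<n. c * d i * incr T n x i))"
  have int: "integrable \<mu> (?F c)" for c
    by (rule integrable_iexp_real) measurable
  have eq: "iexp (Re (\<Sum>i<n. d i * incr T n (mehler a b (x, y)) i)) = ?F a x * ?F (of_real b) y" for x y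
  proof -
    have sp: "Re (\<Sum>i<n. d i * incr T n (mehler a b (x, y)) i) =
      Re (\<Sum>i<n. a * d i * incr T n x i) + Re (\<Sum>i<n. of_real b * d i * incr T n y i)"
      unfolding mehler_def incr_scale_add fst_conv snd_conv
      by (simp add: sum.distrib[symmetric] algebra_simps del: Re_sum flip: plus_complex.sel)
    show ?thesis by (simp only: sp of_real_add distrib_left exp_add)
  qed
  have "(CLINT p|\<mu> \<Otimes>\<^sub>M \<mu>. iexp (Re (\<Sum>i<n. d i * incr T n (mehler a b p) i))) =
      (CLINT p|\<mu> \<Otimes>\<^sub>M \<mu>. ?F a (fst p) * ?F (of_real b) (snd p))"
    by (intro Bochner_Integration.integral_cong refl) (metis eq prod.collapse)
  also have "\<dots> = (CLINT x|\<mu>. ?F a x) * (CLINT y|\<mu>. ?F (of_real b) y)"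
  proof -
    have "integrable (\<mu> \<Otimes>\<^sub>M \<mu>) (\<lambda>p. ?F a (fst p) * ?F (of_real b) (snd p))"
      by (rule P.P.integrable_const_bound[where B=1]) (auto simp: norm_mult)
    from P.integral_fst'[OF this] show ?thesis by simp
  qed
  also have "\<dots> = exp (- of_real (T / n * (\<Sum>i<n. (cmod (a * d i))\<^sup>2)) / 2) * exp (- of_real (T / n * (\<Sum>i<n. (cmod (of_real b * d i))\<^sup>2)) / 2)"
    using n by (simp only: char_incr)
  also have "\<dots> = exp (- of_real (T / n * (((cmod a)\<^sup>2 + b\<^sup>2) * (\<Sum>i<n. (cmod (d i))\<^sup>2))) / 2)"
    by (simp add: exp_add[symmetric] norm_mult power_mult_distrib sum_distrib_left[symmetric] algebra_simps
      add_divide_distrib diff_divide_distrib)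
  finally show "(CLINT p|\<mu> \<Otimes>\<^sub>M \<mu>. iexp (Re (\<Sum>i<n. d i * incr T n (mehler a b p) i))) =
      exp (- of_real (T / n * (\<Sum>i<n. (cmod (d i))\<^sup>2)) / 2)" unfolding ab by simp
qed

end

section \<open>Hermite-Laguerre-Ito polynomials under a complex Gaussian law\<close>

text \<open>
  The recursion is \<open>J\<^bsub>m+1,n\<^esub> = z J\<^bsub>m,n\<^esub> - 2 \<partial>J\<^bsub>m,n\<^esub>/\<partial>cnj z\<close> combined with
  \<open>\<partial>J\<^bsub>m,n\<^esub>/\<partial>cnj z = n J\<^bsub>m,n-1\<^esub>\<close>. Truncated subtraction is harmless since \<open>n - 1\<close> always occurs with
  the factor \<open>n\<close>.
\<close>

fun hli :: "nat \<Rightarrow> nat \<Rightarrow> complex \<Rightarrow> complex" where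
  "hli 0 n z = cnj z ^ n"
| "hli (Suc m) n z = z * hli m n z - 2 * of_nat n * hli m (n - 1) z"

text \<open>The coefficient of \<open>h\<close> when the recursion is differentiated. For positive
  \<open>m\<close> the two terms with \<open>of_nat m\<close> combine to
  \<open>of_nat m * hli m n z\<close> by the recursion one level lower; for \<open>m = 0\<close>
  they vanish.\<close>

lemma hli_dz_step:
  "hli m n z + z * (of_nat m * hli (m - 1) n z) - 2 * of_nat n * (of_nat m * hli (m - 1) (n - 1) z)
    = of_nat (Suc m) * hli m n z"
  by (cases m) (simp_all add: algebra_simps)

text \<open>The coefficient of \<open>cnj h\<close>: the recursion for the index
  \<open>n - 1\<close> multiplied by \<open>n\<close>, with \<open>n - 2\<close> arising as
  \<open>n - 1 - 1\<close>.\<close>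

lemma hli_dzbar_step:
  "z * (of_nat n * hli m (n - 1) z) - 2 * of_nat n * (of_nat (n - 1) * hli m (n - 2) z)
    = of_nat n * hli (Suc m) (n - 1) z"
  by (simp add: algebra_simps numeral_2_eq_2)

text \<open>The coefficients of \<open>h\<close> and \<open>cnj h\<close> are the two Wirtinger
  derivatives, so one real derivative carries both lowering rules through the induction.\<close>

lemma hli_has_derivative:
  "((\<lambda>z. hli m n z) has_derivative
    (\<lambda>h. of_nat m * hli (m - 1) n z * h + of_nat n * hli m (n - 1) z * cnj h)) (at z)"
proof (induction m arbitrary: n)
  case 0
  have "((\<lambda>z. cnj z ^ n) has_derivative (\<lambda>h. of_nat n * cnj h * cnj z ^ (n - 1))) (at z)"
    by (rule has_derivative_power) (rule bounded_linear.has_derivative[OF bounded_linear_cnj has_derivative_ident])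
  then show ?case by (simp add: mult_ac)
next
  case (Suc m)
  have "((\<lambda>z. z * hli m n z - 2 * of_nat n * hli m (n - 1) z) has_derivative
     (\<lambda>h. (z * (of_nat m * hli (m - 1) n z * h + of_nat n * hli m (n - 1) z * cnj h) + h * hli m n z) -
       2 * of_nat n * (of_nat m * hli (m - 1) (n - 1) z * h + of_nat (n - 1) * hli m (n - 1 - 1) z * cnj h))) (at z)"
    by (intro has_derivative_diff has_derivative_mult has_derivative_ident has_derivative_mult_right Suc)
  also have "(\<lambda>h. (z * (of_nat m * hli (m - 1) n z * h + of_nat n * hli m (n - 1) z * cnj h) + h * hli m n z) -
       2 * of_nat n * (of_nat m * hli (m - 1) (n - 1) z * h + of_nat (n - 1) * hli m (n - 1 - 1) z * cnj h)) =
     (\<lambda>h. (hli m n z + z * (of_nat m * hli (m - 1) n z) - 2 * of_nat n * (of_nat m * hli (m - 1) (n - 1) z)) * h +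
       (z * (of_nat n * hli m (n - 1) z) - 2 * of_nat n * (of_nat (n - 1) * hli m (n - 2) z)) * cnj h)"
    by (intro ext) (simp add: algebra_simps numeral_2_eq_2)
  finally show ?case unfolding hli_dz_step hli_dzbar_step by simp
qed

text \<open>The constant \<open>c\<close> is carried along because every application of an adjoint
  adds a factor 1/2 to the polynomial.\<close>

lemma hli_partials:
  shows partial_re_hli: "partial_re (\<lambda>z. c * hli m n z) z = c * (of_nat m * hli (m - 1) n z + of_nat n * hli m (n - 1) z)"
    and partial_im_hli: "partial_im (\<lambda>z. c * hli m n z) z = c * \<i> * (of_nat m * hli (m - 1) n z - of_nat n * hli m (n - 1) z)"
proof -
  have d: "((\<lambda>z. c * hli m n z) has_derivative
    (\<lambda>h. c * (of_nat m * hli (m - 1) n z * h + of_nat n * hli m (n - 1) z * cnj h))) (at z)"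
    by (intro has_derivative_mult_right hli_has_derivative)
  then have d': "((\<lambda>z. c * hli m n z) has_derivative
    (\<lambda>h. c * (of_nat m * hli (m - 1) n z * h + of_nat n * hli m (n - 1) z * cnj h))) (at (Complex (Re z) (Im z)))"
    by simp
  have "((\<lambda>s. Complex s (Im z)) has_derivative (\<lambda>s. of_real s)) (at (Re z))"
    unfolding Complex_eq by (auto intro!: derivative_eq_intros)
  from has_derivative_compose[OF this d']
  have "((\<lambda>s. c * hli m n (Complex s (Im z))) has_vector_derivative
      c * (of_nat m * hli (m - 1) n z + of_nat n * hli m (n - 1) z)) (at (Re z))"
    unfolding has_vector_derivative_def by (simp add: scaleR_conv_of_real algebra_simps)
  then show "partial_re (\<lambda>z. c * hli m n z) z = c * (of_nat m * hli (m - 1) n z + of_nat n * hli m (n - 1) z)"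
    unfolding partial_re_def by (rule vector_derivative_at)
  have "((\<lambda>s. Complex (Re z) s) has_derivative (\<lambda>s. \<i> * of_real s)) (at (Im z))"
    unfolding Complex_eq by (auto intro!: derivative_eq_intros)
  from has_derivative_compose[OF this d']
  have "((\<lambda>s. c * hli m n (Complex (Re z) s)) has_vector_derivative
      c * \<i> * (of_nat m * hli (m - 1) n z - of_nat n * hli m (n - 1) z)) (at (Im z))"
    unfolding has_vector_derivative_def by (simp add: scaleR_conv_of_real algebra_simps)
  then show "partial_im (\<lambda>z. c * hli m n z) z = c * \<i> * (of_nat m * hli (m - 1) n z - of_nat n * hli m (n - 1) z)"
    unfolding partial_im_def by (rule vector_derivative_at)
qed

text \<open>Powers of cnj z are killed by the holomorphic derivative, so each application only
  multiplies by cnj z / 2.\<close>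

lemma wirtinger_bar_adj_power: "(wirtinger_bar_adj ^^ n) (\<lambda>_. 1) = (\<lambda>z. 1 / 2 ^ n * hli 0 n z)"
proof (induction n)
  case (Suc n)
  have "wirtinger_bar_adj (\<lambda>z. 1 / 2 ^ n * hli 0 n z) z = 1 / 2 ^ Suc n * hli 0 (Suc n) z" for z
    unfolding wirtinger_bar_adj_def wirtinger_def partial_re_hli partial_im_hli
    by (simp add: algebra_simps)
  then show ?case by (simp add: Suc fun_eq_iff)
qed simp

lemma wirtinger_adj_hli: "wirtinger_adj (\<lambda>z. c * hli m n z) z = c / 2 * hli (Suc m) n z"
  unfolding wirtinger_adj_def wirtinger_bar_def partial_re_hli partial_im_hli
  by (simp add: algebra_simps)

text \<open>The factors 1/2 collected by the m + n adjoints cancel the prefactor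
  \<open>2 ^ (m + n)\<close>.\<close>

lemma hermite_laguerre_ito_eq_hli: "hermite_laguerre_ito m n z = hli m n z"
proof -
  have "(wirtinger_adj ^^ m) (\<lambda>z. c * hli 0 n z) = (\<lambda>z. c / 2 ^ m * hli m n z)" for c
  proof (induction m)
    case (Suc m)
    show ?case
    proof
      fix z
      have "(wirtinger_adj ^^ Suc m) (\<lambda>z. c * hli 0 n z) z = wirtinger_adj (\<lambda>z. c / 2 ^ m * hli m n z) z"
        by (simp only: funpow.simps o_apply Suc.IH)
      also have "\<dots> = c / 2 ^ m / 2 * hli (Suc m) n z" by (rule wirtinger_adj_hli)
      finally show "(wirtinger_adj ^^ Suc m) (\<lambda>z. c * hli 0 n z) z = c / 2 ^ Suc m * hli (Suc m) n z"
        by (simp add: mult.commute)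
    qed
  qed simp
  from this[of "1 / 2 ^ n"] show ?thesis unfolding hermite_laguerre_ito_def wirtinger_bar_adj_power
    by (simp add: power_add del: hli.simps)
qed

section \<open>Growth, Gaussian moments and integration by parts\<close>

lemma hli_measurable [measurable]: "hli m n \<in> borel_measurable borel"
  by (rule borel_measurable_continuous_onI)
    (auto intro!: continuous_at_imp_continuous_on has_derivative_continuous hli_has_derivative)

text \<open>The base \<open>1 + cmod z\<close> is at least 1, so the term of lower degree is
  absorbed into the same power. The bound serves the integrability of real powers of the
  polynomials.\<close>

lemma hli_growth: "\<exists>C\<ge>0. \<forall>z. cmod (hli m n z) \<le> C * (1 + cmod z) ^ (m + n)"
proof (induction m arbitrary: n)
  case 0
  have "cmod (cnj z ^ n) \<le> 1 * (1 + cmod z) ^ n" for z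
    by (simp add: norm_power power_mono)
  then show ?case by (intro exI[of _ 1]) simp
next
  case (Suc m)
  obtain C where C: "C \<ge> 0" "\<And>z. cmod (hli m n z) \<le> C * (1 + cmod z) ^ (m + n)" using Suc by blast
  obtain D where D: "D \<ge> 0" "\<And>z. cmod (hli m (n - 1) z) \<le> D * (1 + cmod z) ^ (m + (n - 1))" using Suc by blast
  have "cmod (hli (Suc m) n z) \<le> (C + 2 * n * D) * (1 + cmod z) ^ (Suc m + n)" for z
  proof -
    have "cmod (hli (Suc m) n z) \<le> cmod z * cmod (hli m n z) + 2 * n * cmod (hli m (n - 1) z)"
      using norm_triangle_ineq4[of "z * hli m n z" "2 * of_nat n * hli m (n - 1) z"] by (simp add: norm_mult)
    also have "\<dots> \<le> (1 + cmod z) * (C * (1 + cmod z) ^ (m + n)) + 2 * n * (D * (1 + cmod z) ^ (Suc m + n))"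
    proof (intro add_mono mult_mono mult_left_mono)
      show "cmod (hli m (n - 1) z) \<le> D * (1 + cmod z) ^ (Suc m + n)"
        using D by (intro order_trans[OF D(2)] mult_left_mono power_increasing) auto
    qed (use C in auto)
    also have "\<dots> = (C + 2 * n * D) * (1 + cmod z) ^ (Suc m + n)" by (simp add: algebra_simps)
    finally show ?thesis .
  qed
  then show ?case using C D by (intro exI[of _ "C + 2 * n * D"]) auto
qed

text \<open>Gaussian integration by parts for a monomial. For even \<open>k\<close> both sides
  vanish, by odd moments or by the factor 0; for odd \<open>k\<close> the closed formula for even
  moments applies.\<close>

lemma std_normal_moment_rec:
  "(LINT x|std_normal_distribution. x ^ Suc k) = k * (LINT x|std_normal_distribution. x ^ (k - 1))"
proof (cases "even k")
  case True
  then show ?thesis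
    using integral_std_normal_distribution_moment_odd[of "Suc k"] integral_std_normal_distribution_moment_odd[of "k - 1"]
    by (cases "k = 0") (simp_all del: power_Suc)
next
  case False
  then obtain j where k: "k = 2 * j + 1" by (rule oddE)
  have "Suc k = 2 * Suc j" "k - 1 = 2 * j" using k by simp_all
  then have m: "(LINT x|std_normal_distribution. x ^ Suc k) = fact (2 * Suc j) / (2 ^ Suc j * fact (Suc j))"
    "(LINT x|std_normal_distribution. x ^ (k - 1)) = fact (2 * j) / (2 ^ j * fact j)"
    by (simp_all only: std_normal_distribution_even_moments)
  have num: "fact (2 * Suc j) = (2 * real (Suc j)) * (real (2 * j + 1) * fact (2 * j))"
    by (simp add: algebra_simps)
  have den: "2 ^ Suc j * fact (Suc j) = (2 * real (Suc j)) * (2 ^ j * fact j)"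
    by (simp add: algebra_simps)
  have "(LINT x|std_normal_distribution. x ^ Suc k) = real (2 * j + 1) * fact (2 * j) / (2 ^ j * fact j)"
    unfolding m(1) num den by (rule mult_divide_mult_cancel_left) simp
  also have "\<dots> = k * (fact (2 * j) / (2 ^ j * fact j))" by (simp add: k)
  finally show ?thesis unfolding m(2) .
qed

text \<open>\<open>W\<close> has the law \<nu>, the planar Gaussian with E |W|^2 = 2, with respect
  to which the adjoints are taken.\<close>

locale complex_gaussian = prob_space +
  fixes W :: "'a \<Rightarrow> complex"
  assumes indep: "indep_var borel (\<lambda>x. Re (W x)) borel (\<lambda>x. Im (W x))"
    and Re_law: "distr M borel (\<lambda>x. Re (W x)) = std_normal_distribution"
    and Im_law: "distr M borel (\<lambda>x. Im (W x)) = std_normal_distribution"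
begin

abbreviation "X x \<equiv> complex_of_real (Re (W x))"
abbreviation "Y x \<equiv> complex_of_real (Im (W x))"

lemma Re_W_measurable [measurable]: "(\<lambda>x. Re (W x)) \<in> borel_measurable M"
  and Im_W_measurable [measurable]: "(\<lambda>x. Im (W x)) \<in> borel_measurable M"
  using indep_var_rv1[OF indep] indep_var_rv2[OF indep] by auto

lemma W_measurable [measurable]: "W \<in> borel_measurable M"
  by (subst borel_measurable_complex_iff) simp

lemma monomial_moment:
  shows integrable_monomial: "integrable M (\<lambda>x. X x ^ m * Y x ^ n)"
    and integral_monomial: "(CLINT x|M. X x ^ m * Y x ^ n) =
      of_real ((LINT x|std_normal_distribution. x ^ m) * (LINT x|std_normal_distribution. x ^ n))"
proof -
  have ind: "indep_var borel (\<lambda>x. Re (W x) ^ m) borel (\<lambda>x. Im (W x) ^ n)"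
    using indep_var_compose[OF indep, of "\<lambda>x. x ^ m" borel "\<lambda>x. x ^ n" borel] by (simp add: o_def)
  have 1: "integrable M (\<lambda>x. Re (W x) ^ m)" "(LINT x|M. Re (W x) ^ m) = (LINT x|std_normal_distribution. x ^ m)"
    using integrable_std_normal_distribution_moment[of m] 
    by (simp_all flip: Re_law add: integrable_distr_eq integral_distr)
  have 2: "integrable M (\<lambda>x. Im (W x) ^ n)" "(LINT x|M. Im (W x) ^ n) = (LINT x|std_normal_distribution. x ^ n)"
    using integrable_std_normal_distribution_moment[of n] 
    by (simp_all flip: Im_law add: integrable_distr_eq integral_distr)
  have eq: "X x ^ m * Y x ^ n = of_real (Re (W x) ^ m * Im (W x) ^ n)" for x by simp
  show "integrable M (\<lambda>x. X x ^ m * Y x ^ n)"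
    unfolding eq using indep_var_integrable[OF ind 1(1) 2(1)] by (rule integrable_of_real)
  show "(CLINT x|M. X x ^ m * Y x ^ n) =
      of_real ((LINT x|std_normal_distribution. x ^ m) * (LINT x|std_normal_distribution. x ^ n))"
    unfolding eq using indep_var_lebesgue_integral[OF ind 1(1) 2(1)] 1 2 by (simp del: of_real_mult)
qed

text \<open>Integrability against all monomials is preserved by multiplication with \<open>X\<close>
  and \<open>Y\<close>, so the steps below need no separate moment estimates.\<close>

definition tame :: "('a \<Rightarrow> complex) \<Rightarrow> bool" where
  "tame F \<longleftrightarrow> (\<forall>m n. integrable M (\<lambda>x. X x ^ m * Y x ^ n * F x))"

lemma tameD: "tame F \<Longrightarrow> integrable M (\<lambda>x. X x ^ m * Y x ^ n * F x)"
  by (simp add: tame_def)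

lemma tame_integrable: "tame F \<Longrightarrow> integrable M F"
  using tameD[of F 0 0] by simp

lemma tame_const: "tame (\<lambda>_. c)"
  unfolding tame_def using integrable_monomial by auto

lemma tame_add: "tame F \<Longrightarrow> tame G \<Longrightarrow> tame (\<lambda>x. F x + G x)"
  unfolding tame_def distrib_left by (intro allI Bochner_Integration.integrable_add) auto

lemma tame_cmult: "tame F \<Longrightarrow> tame (\<lambda>x. c * F x)"
  unfolding tame_def mult.left_commute[of _ c] by (intro allI integrable_mult_right) auto

lemma tame_X: "tame F \<Longrightarrow> tame (\<lambda>x. X x * F x)"
  unfolding tame_def
proof (intro allI)
  fix m n assume "\<forall>m n. integrable M (\<lambda>x. X x ^ m * Y x ^ n * F x)"
  then have "integrable M (\<lambda>x. X x ^ Suc m * Y x ^ n * F x)" by blast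
  then show "integrable M (\<lambda>x. X x ^ m * Y x ^ n * (X x * F x))" by (simp add: mult_ac)
qed

lemma tame_Y: "tame F \<Longrightarrow> tame (\<lambda>x. Y x * F x)"
  unfolding tame_def
proof (intro allI)
  fix m n assume "\<forall>m n. integrable M (\<lambda>x. X x ^ m * Y x ^ n * F x)"
  then have "integrable M (\<lambda>x. X x ^ m * Y x ^ Suc n * F x)" by blast
  then show "integrable M (\<lambda>x. X x ^ m * Y x ^ n * (Y x * F x))" by (simp add: mult_ac)
qed

text \<open>
  Gaussian integration by parts for \<open>F = f(X, Y)\<close> with partial derivatives \<open>Fx\<close> and \<open>Fy\<close>. Testing
  against all monomials makes the property stable under multiplication by \<open>X\<close> and \<open>Y\<close>.
\<close>

definition stein :: "('a \<Rightarrow> complex) \<Rightarrow> ('a \<Rightarrow> complex) \<Rightarrow> ('a \<Rightarrow> complex) \<Rightarrow> bool" where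
  "stein F Fx Fy \<longleftrightarrow> tame F \<and> tame Fx \<and> tame Fy \<and>
    (\<forall>m n. (CLINT x|M. X x ^ Suc m * Y x ^ n * F x) =
        of_nat m * (CLINT x|M. X x ^ (m - 1) * Y x ^ n * F x) + (CLINT x|M. X x ^ m * Y x ^ n * Fx x)) \<and>
    (\<forall>m n. (CLINT x|M. X x ^ m * Y x ^ Suc n * F x) =
        of_nat n * (CLINT x|M. X x ^ m * Y x ^ (n - 1) * F x) + (CLINT x|M. X x ^ m * Y x ^ n * Fy x))"

text \<open>By independence the moments of \<open>X\<close> and \<open>Y\<close> factor, and the
  claim for a monomial is \<open>std_normal_moment_rec\<close> in one variable.\<close>

lemma stein_const: "stein (\<lambda>_. c) (\<lambda>_. 0) (\<lambda>_. 0)"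
proof -
  define I where "I m = (LINT x|std_normal_distribution. x ^ m)" for m
  have eq: "(CLINT x|M. X x ^ m * Y x ^ n * c) = of_real (I m * I n) * c" for m n
    using integral_monomial[of m n] by (simp add: I_def)
  have rec: "I (Suc m) = m * I (m - 1)" for m
    unfolding I_def by (rule std_normal_moment_rec)
  show ?thesis
    unfolding stein_def eq rec by (auto intro: tame_const)
qed

lemma stein_add:
  assumes "stein F Fx Fy" "stein G Gx Gy"
  shows "stein (\<lambda>x. F x + G x) (\<lambda>x. Fx x + Gx x) (\<lambda>x. Fy x + Gy x)"
proof -
  have t: "tame F" "tame Fx" "tame Fy" "tame G" "tame Gx" "tame Gy" using assms by (auto simp: stein_def)
  have a: "(CLINT x|M. X x ^ m * Y x ^ n * (H x + K x)) = (CLINT x|M. X x ^ m * Y x ^ n * H x) + (CLINT x|M. X x ^ m * Y x ^ n * K x)"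
    if "tame H" "tame K" for m n H K
    unfolding distrib_left by (intro Bochner_Integration.integral_add tameD that)
  have s: "(CLINT x|M. X x ^ Suc m * Y x ^ n * H x) =
        of_nat m * (CLINT x|M. X x ^ (m - 1) * Y x ^ n * H x) + (CLINT x|M. X x ^ m * Y x ^ n * Hx x)"
    "(CLINT x|M. X x ^ m * Y x ^ Suc n * H x) =
        of_nat n * (CLINT x|M. X x ^ m * Y x ^ (n - 1) * H x) + (CLINT x|M. X x ^ m * Y x ^ n * Hy x)" 
    if "stein H Hx Hy" for m n H Hx Hy
    using that unfolding stein_def by blast+
  show ?thesis unfolding stein_def
    by (intro conjI allI tame_add t; (simp only: a[OF t(1,4)] a[OF t(2,5)] a[OF t(3,6)])?; (simp only: s[OF assms(1)] s[OF assms(2)])?; simp only: distrib_left add_ac)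
qed

lemma stein_cmult:
  assumes "stein F Fx Fy"
  shows "stein (\<lambda>x. c * F x) (\<lambda>x. c * Fx x) (\<lambda>x. c * Fy x)"
proof -
  have t: "tame F" "tame Fx" "tame Fy" using assms by (auto simp: stein_def)
  show ?thesis using assms unfolding stein_def mult.left_commute[of _ c]
    by (simp add: tame_cmult algebra_simps del: power_Suc)
qed

text \<open>Raising the exponent \<open>m\<close> by one splits its factor \<open>Suc m\<close> into
  \<open>m\<close> and 1; the extra 1 is the term \<open>F\<close> of the product rule.\<close>

lemma stein_X:
  assumes "stein F Fx Fy"
  shows "stein (\<lambda>x. X x * F x) (\<lambda>x. F x + X x * Fx x) (\<lambda>x. X x * Fy x)"
proof -
  have t: "tame F" "tame Fx" "tame Fy" using assms by (auto simp: stein_def)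
  have s: "(CLINT x|M. X x ^ Suc m * Y x ^ n * F x) =
        of_nat m * (CLINT x|M. X x ^ (m - 1) * Y x ^ n * F x) + (CLINT x|M. X x ^ m * Y x ^ n * Fx x)"
    "(CLINT x|M. X x ^ m * Y x ^ Suc n * F x) =
        of_nat n * (CLINT x|M. X x ^ m * Y x ^ (n - 1) * F x) + (CLINT x|M. X x ^ m * Y x ^ n * Fy x)" for m n
    using assms unfolding stein_def by blast+
  have sh: "X x ^ m * Y x ^ n * (X x * G x) = X x ^ Suc m * Y x ^ n * G x" for m n x and G :: "'a \<Rightarrow> complex"
    by (simp add: mult_ac)
  \<comment> \<open>For \<open>m = 0\<close> the truncated exponent is wrong, but it is multiplied
    by 0.\<close>
  have pr: "of_nat m * (CLINT x|M. X x ^ (m - 1) * Y x ^ n * (X x * F x)) = of_nat m * (CLINT x|M. X x ^ m * Y x ^ n * F x)" for m n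
    by (cases m) (simp_all add: sh del: power_Suc)
  show ?thesis unfolding stein_def
  proof (intro conjI allI)
    fix m n
    have "(CLINT x|M. X x ^ m * Y x ^ n * (F x + X x * Fx x)) =
        (CLINT x|M. X x ^ m * Y x ^ n * F x) + (CLINT x|M. X x ^ Suc m * Y x ^ n * Fx x)"
      unfolding distrib_left sh by (intro Bochner_Integration.integral_add tameD t)
    then show "(CLINT x|M. X x ^ Suc m * Y x ^ n * (X x * F x)) =
        of_nat m * (CLINT x|M. X x ^ (m - 1) * Y x ^ n * (X x * F x)) + (CLINT x|M. X x ^ m * Y x ^ n * (F x + X x * Fx x))"
      unfolding pr unfolding sh s(1)[of "Suc m"] by (simp add: algebra_simps del: power_Suc)
    show "(CLINT x|M. X x ^ m * Y x ^ Suc n * (X x * F x)) =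
        of_nat n * (CLINT x|M. X x ^ m * Y x ^ (n - 1) * (X x * F x)) + (CLINT x|M. X x ^ m * Y x ^ n * (X x * Fy x))"
      unfolding sh by (rule s(2))
  qed (intro tame_add tame_X t)+
qed

lemma stein_Y:
  assumes "stein F Fx Fy"
  shows "stein (\<lambda>x. Y x * F x) (\<lambda>x. Y x * Fx x) (\<lambda>x. F x + Y x * Fy x)"
proof -
  have t: "tame F" "tame Fx" "tame Fy" using assms by (auto simp: stein_def)
  have s: "(CLINT x|M. X x ^ Suc m * Y x ^ n * F x) =
        of_nat m * (CLINT x|M. X x ^ (m - 1) * Y x ^ n * F x) + (CLINT x|M. X x ^ m * Y x ^ n * Fx x)"
    "(CLINT x|M. X x ^ m * Y x ^ Suc n * F x) =
        of_nat n * (CLINT x|M. X x ^ m * Y x ^ (n - 1) * F x) + (CLINT x|M. X x ^ m * Y x ^ n * Fy x)" for m n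
    using assms unfolding stein_def by blast+
  have sh: "X x ^ m * Y x ^ n * (Y x * G x) = X x ^ m * Y x ^ Suc n * G x" for m n x and G :: "'a \<Rightarrow> complex"
    by (simp add: mult_ac)
  have pr: "of_nat n * (CLINT x|M. X x ^ m * Y x ^ (n - 1) * (Y x * F x)) = of_nat n * (CLINT x|M. X x ^ m * Y x ^ n * F x)" for m n
    by (cases n) (simp_all add: sh del: power_Suc)
  show ?thesis unfolding stein_def
  proof (intro conjI allI)
    fix m n
    have "(CLINT x|M. X x ^ m * Y x ^ n * (F x + Y x * Fy x)) =
        (CLINT x|M. X x ^ m * Y x ^ n * F x) + (CLINT x|M. X x ^ m * Y x ^ Suc n * Fy x)"
      unfolding distrib_left sh by (intro Bochner_Integration.integral_add tameD t)
    then show "(CLINT x|M. X x ^ m * Y x ^ Suc n * (Y x * F x)) =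
        of_nat n * (CLINT x|M. X x ^ m * Y x ^ (n - 1) * (Y x * F x)) + (CLINT x|M. X x ^ m * Y x ^ n * (F x + Y x * Fy x))"
      unfolding pr unfolding sh s(2)[of _ "Suc n"] by (simp add: algebra_simps del: power_Suc)
    show "(CLINT x|M. X x ^ Suc m * Y x ^ n * (Y x * F x)) =
        of_nat m * (CLINT x|M. X x ^ (m - 1) * Y x ^ n * (Y x * F x)) + (CLINT x|M. X x ^ m * Y x ^ n * (Y x * Fx x))"
      unfolding sh by (rule s(1))
  qed (intro tame_add tame_Y t)+
qed

lemma stein_affine:
  assumes "stein F Fx Fy"
  shows "stein (\<lambda>x. (\<alpha> + \<beta> * X x + \<gamma> * Y x) * F x)
    (\<lambda>x. (\<alpha> + \<beta> * X x + \<gamma> * Y x) * Fx x + \<beta> * F x) (\<lambda>x. (\<alpha> + \<beta> * X x + \<gamma> * Y x) * Fy x + \<gamma> * F x)"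
  using stein_add[OF stein_add[OF stein_cmult[OF assms, of \<alpha>] stein_cmult[OF stein_X[OF assms], of \<beta>]]
      stein_cmult[OF stein_Y[OF assms], of \<gamma>]]
  by (simp add: algebra_simps)

text \<open>For u = z + b W the chain rule turns the derivative in \<open>X\<close> into b times the
  sum, and that in \<open>Y\<close> into i b times the difference, of the two Wirtinger derivatives;
  the induction follows the recursion through \<open>stein_affine\<close>.\<close>

lemma stein_hli:
  fixes b :: real
  shows "stein (\<lambda>x. hli m n (z + b * W x))
    (\<lambda>x. b * (of_nat m * hli (m - 1) n (z + b * W x) + of_nat n * hli m (n - 1) (z + b * W x)))
    (\<lambda>x. \<i> * b * (of_nat m * hli (m - 1) n (z + b * W x) - of_nat n * hli m (n - 1) (z + b * W x)))"
proof (induction m arbitrary: n)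
  case 0
  show ?case
  proof (induction n)
    case 0
    show ?case using stein_const[of 1] by simp
  next
    case (Suc n)
    have aff: "cnj (z + b * W x) = cnj z + b * X x + (- \<i> * b) * Y x" for x
      by (simp add: complex_eq_iff)
    have e0: "cnj u * hli 0 n u = hli 0 (Suc n) u" for u by simp
    have e1: "cnj u * (b * (of_nat 0 * hli (0 - 1) n u + of_nat n * hli 0 (n - 1) u)) + b * hli 0 n u =
        b * (of_nat 0 * hli (0 - 1) (Suc n) u + of_nat (Suc n) * hli 0 (Suc n - 1) u)" for u
      by (cases n) (simp_all add: algebra_simps)
    have e2: "cnj u * (\<i> * b * (of_nat 0 * hli (0 - 1) n u - of_nat n * hli 0 (n - 1) u)) + - \<i> * b * hli 0 n u =
        \<i> * b * (of_nat 0 * hli (0 - 1) (Suc n) u - of_nat (Suc n) * hli 0 (Suc n - 1) u)" for u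
      by (cases n) (simp_all add: algebra_simps)
    show ?case
      using stein_affine[OF Suc, of "cnj z" "of_real b" "- \<i> * b"] unfolding aff[symmetric] e0 e1 e2 .
  qed
next
  case (Suc m)
  have aff: "z + b * W x = z + b * X x + (\<i> * b) * Y x" for x
    by (simp add: complex_eq_iff)
  let ?u = "\<lambda>x. z + b * W x"
  have "stein (\<lambda>x. ?u x * hli m n (?u x) + (- 2 * of_nat n) * hli m (n - 1) (?u x))
    (\<lambda>x. (?u x * (b * (of_nat m * hli (m - 1) n (?u x) + of_nat n * hli m (n - 1) (?u x))) + b * hli m n (?u x))
      + (- 2 * of_nat n) * (b * (of_nat m * hli (m - 1) (n - 1) (?u x) + of_nat (n - 1) * hli m (n - 1 - 1) (?u x))))
    (\<lambda>x. (?u x * (\<i> * b * (of_nat m * hli (m - 1) n (?u x) - of_nat n * hli m (n - 1) (?u x))) + \<i> * b * hli m n (?u x))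
      + (- 2 * of_nat n) * (\<i> * b * (of_nat m * hli (m - 1) (n - 1) (?u x) - of_nat (n - 1) * hli m (n - 1 - 1) (?u x))))"
    using stein_affine[OF Suc[of n], of z "of_real b" "\<i> * b"] unfolding aff[symmetric]
    by (rule stein_add[OF _ stein_cmult[OF Suc]])
  moreover have "(?u x * (b * (of_nat m * hli (m - 1) n (?u x) + of_nat n * hli m (n - 1) (?u x))) + b * hli m n (?u x))
      + (- 2 * of_nat n) * (b * (of_nat m * hli (m - 1) (n - 1) (?u x) + of_nat (n - 1) * hli m (n - 1 - 1) (?u x)))
    = b * (of_nat (Suc m) * hli m n (?u x) + of_nat n * hli (Suc m) (n - 1) (?u x))" for x
    unfolding hli_dz_step[symmetric] hli_dzbar_step[symmetric] by (simp add: algebra_simps numeral_2_eq_2)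
  moreover have "(?u x * (\<i> * b * (of_nat m * hli (m - 1) n (?u x) - of_nat n * hli m (n - 1) (?u x))) + \<i> * b * hli m n (?u x))
      + (- 2 * of_nat n) * (\<i> * b * (of_nat m * hli (m - 1) (n - 1) (?u x) - of_nat (n - 1) * hli m (n - 1 - 1) (?u x)))
    = \<i> * b * (of_nat (Suc m) * hli m n (?u x) - of_nat n * hli (Suc m) (n - 1) (?u x))" for x
    unfolding hli_dz_step[symmetric] hli_dzbar_step[symmetric] by (simp add: algebra_simps numeral_2_eq_2)
  ultimately show ?case by simp
qed

lemma stein_integral:
  assumes "stein F Fx Fy"
  shows "integrable M F" "integrable M Fx" "integrable M Fy"
    "integrable M (\<lambda>x. X x * F x)" "integrable M (\<lambda>x. Y x * F x)"
    "(CLINT x|M. X x * F x) = (CLINT x|M. Fx x)" "(CLINT x|M. Y x * F x) = (CLINT x|M. Fy x)"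
proof -
  have t: "tame F" "tame Fx" "tame Fy" using assms by (auto simp: stein_def)
  then show "integrable M F" "integrable M Fx" "integrable M Fy"
    "integrable M (\<lambda>x. X x * F x)" "integrable M (\<lambda>x. Y x * F x)"
    by (auto intro!: tame_integrable tame_X tame_Y)
  have "(CLINT x|M. X x ^ Suc 0 * Y x ^ 0 * F x) =
      of_nat 0 * (CLINT x|M. X x ^ (0 - 1) * Y x ^ 0 * F x) + (CLINT x|M. X x ^ 0 * Y x ^ 0 * Fx x)"
    using assms unfolding stein_def by blast
  then show "(CLINT x|M. X x * F x) = (CLINT x|M. Fx x)" by simp
  have "(CLINT x|M. X x ^ 0 * Y x ^ Suc 0 * F x) =
      of_nat 0 * (CLINT x|M. X x ^ 0 * Y x ^ (0 - 1) * F x) + (CLINT x|M. X x ^ 0 * Y x ^ 0 * Fy x)"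
    using assms unfolding stein_def by blast
  then show "(CLINT x|M. Y x * F x) = (CLINT x|M. Fy x)" by simp
qed

lemma integrable_hli: "integrable M (\<lambda>x. hli m n (z + of_real b * W x))"
  using stein_integral(1)[OF stein_hli] .

text \<open>Integration by parts gives E (b W F) = 2 b^2 E (dF / d cnj z), since the holomorphic
  derivatives coming from \<open>X\<close> and \<open>Y\<close> cancel. For F = J_(m,n) this is 2 n
  b^2 E J_(m,n-1), so the term with -2 n in the recursion acquires the factor 1 - b^2 = a (cnj a),
  exactly what restores the recursion on the right-hand side. For m = 0 the recursion multiplies by
  cnj u instead, and the correction vanishes because powers of cnj u have no holomorphic
  derivative.\<close>

lemma integral_hli:
  assumes ab: "(cmod a)\<^sup>2 + b\<^sup>2 = 1"
  shows "(CLINT x|M. hli m n (a * z + of_real b * W x)) = a ^ m * cnj a ^ n * hli m n z"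
proof (induction m arbitrary: n)
  case 0
  show ?case
  proof (induction n)
    case 0
    show ?case by (simp add: prob_space)
  next
    case (Suc n)
    let ?F = "\<lambda>x. hli 0 n (a * z + of_real b * W x)"
    note st = stein_integral[OF stein_hli[of 0 n "a * z" b]]
    have "(CLINT x|M. hli 0 (Suc n) (a * z + of_real b * W x)) =
        (CLINT x|M. cnj (a * z) * ?F x + of_real b * (X x * ?F x) + (- \<i> * of_real b) * (Y x * ?F x))"
    proof (rule Bochner_Integration.integral_cong[OF refl])
      fix x
      have e: "hli 0 (Suc n) u = cnj u * hli 0 n u" for u by simp
      have aff: "cnj (a * z + of_real b * W x) = cnj (a * z) + of_real b * X x + (- \<i> * of_real b) * Y x"
        by (simp add: complex_eq_iff)
      show "hli 0 (Suc n) (a * z + of_real b * W x) = cnj (a * z) * ?F x + of_real b * (X x * ?F x) + (- \<i> * of_real b) * (Y x * ?F x)"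
        unfolding e aff by (simp only: distrib_right mult.assoc)
    qed
    also have "\<dots> = cnj (a * z) * (CLINT x|M. ?F x) + of_real b * (CLINT x|M. X x * ?F x) + (- \<i> * of_real b) * (CLINT x|M. Y x * ?F x)"
      using st(1,4,5) by (simp add: Bochner_Integration.integral_diff)
    also have "\<dots> = cnj (a * z) * (CLINT x|M. ?F x)"
      unfolding st(6,7) by (simp add: algebra_simps)
    finally show ?case using Suc by (simp add: algebra_simps)
  qed
next
  case (Suc m)
  let ?u = "\<lambda>x. a * z + of_real b * W x"
  let ?F = "\<lambda>x. hli m n (?u x)"
  note st = stein_integral[OF stein_hli[of m n "a * z" b]]
  have "(CLINT x|M. hli (Suc m) n (?u x)) =
      (CLINT x|M. a * z * ?F x + of_real b * (X x * ?F x) + (\<i> * of_real b) * (Y x * ?F x) + (- 2 * of_nat n) * hli m (n - 1) (?u x))"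
  proof (rule Bochner_Integration.integral_cong[OF refl])
    fix x
    have aff: "?u x = a * z + of_real b * X x + (\<i> * of_real b) * Y x"
      by (simp add: complex_eq_iff)
    have "hli (Suc m) n (?u x) = ?u x * ?F x + (- 2 * of_nat n) * hli m (n - 1) (?u x)" by simp
    also have "?u x * ?F x = a * z * ?F x + of_real b * (X x * ?F x) + (\<i> * of_real b) * (Y x * ?F x)"
      by (subst aff) (simp only: distrib_right mult.assoc)
    finally show "hli (Suc m) n (?u x) = a * z * ?F x + of_real b * (X x * ?F x) + (\<i> * of_real b) * (Y x * ?F x) + (- 2 * of_nat n) * hli m (n - 1) (?u x)"
      .
  qed
  also have "\<dots> = a * z * (CLINT x|M. ?F x) + of_real b * (CLINT x|M. X x * ?F x) + (\<i> * of_real b) * (CLINT x|M. Y x * ?F x)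
      + (- 2 * of_nat n) * (CLINT x|M. hli m (n - 1) (?u x))"
    using st(1,4,5) integrable_hli[of m "n - 1" "a * z" b] by (simp add: Bochner_Integration.integral_diff del: hli.simps)
  finally have E1: "(CLINT x|M. hli (Suc m) n (?u x)) = a * z * (CLINT x|M. ?F x) +
      (of_real b * (CLINT x|M. X x * ?F x) + (\<i> * of_real b) * (CLINT x|M. Y x * ?F x))
      + (- 2 * of_nat n) * (CLINT x|M. hli m (n - 1) (?u x))" by (simp only: add.assoc)
  have E2: "of_real b * (CLINT x|M. X x * ?F x) + (\<i> * of_real b) * (CLINT x|M. Y x * ?F x) =
      2 * of_nat n * of_real (b\<^sup>2) * (CLINT x|M. hli m (n - 1) (?u x))"
  proof -
    have "of_real b * (CLINT x|M. X x * ?F x) + (\<i> * of_real b) * (CLINT x|M. Y x * ?F x) =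
      (CLINT x|M. of_real b * (of_real b * (of_nat m * hli (m - 1) n (?u x) + of_nat n * hli m (n - 1) (?u x)))
        + (\<i> * of_real b) * (\<i> * of_real b * (of_nat m * hli (m - 1) n (?u x) - of_nat n * hli m (n - 1) (?u x))))"
      unfolding st(6,7) using st(2,3) by (subst Bochner_Integration.integral_add) auto
    also have "\<dots> = (CLINT x|M. 2 * of_nat n * of_real (b\<^sup>2) * hli m (n - 1) (?u x))"
      by (intro Bochner_Integration.integral_cong refl) (simp add: algebra_simps power2_eq_square)
    finally show ?thesis by simp
  qed
  have "(CLINT x|M. hli (Suc m) n (?u x)) = a * z * (a ^ m * cnj a ^ n * hli m n z)
      - 2 * of_nat n * (1 - of_real (b\<^sup>2)) * (a ^ m * cnj a ^ (n - 1) * hli m (n - 1) z)"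
    unfolding E1 E2 Suc by (simp add: algebra_simps)
  also have "1 - complex_of_real (b\<^sup>2) = a * cnj a"
  proof -
    have "1 - b\<^sup>2 = (cmod a)\<^sup>2" using ab by simp
    then have "complex_of_real (1 - b\<^sup>2) = a * cnj a" by (simp only: complex_norm_square)
    then show ?thesis by simp
  qed
  also have "a * z * (a ^ m * cnj a ^ n * hli m n z) - 2 * of_nat n * (a * cnj a) * (a ^ m * cnj a ^ (n - 1) * hli m (n - 1) z)
      = a ^ Suc m * cnj a ^ n * hli (Suc m) n z"
    by (cases n) (simp_all add: algebra_simps)
  finally show ?case .
qed

text \<open>From 1 + c \<le> 2 (1 + c^2) the power is dominated by a multiple of
  \<open>G x ^ N\<close>, where \<open>G\<close> is 1 + |W|^2 and \<open>d * p \<le> N\<close>; this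
  is a polynomial in \<open>X\<close> and \<open>Y\<close>, hence integrable.\<close>

lemma integrable_powr_if_growth:
  assumes g [measurable]: "g \<in> borel_measurable borel"
    and bd: "\<And>z. cmod (g z) \<le> C * (1 + cmod z) ^ d" and C: "0 \<le> C" and p: "0 \<le> p"
  shows "integrable M (\<lambda>x. cmod (g (W x)) powr p)"
proof -
  obtain N :: nat where N: "d * p \<le> N" using real_arch_simple by blast
  define G where "G x = 1 + X x * X x + Y x * Y x" for x
  have "tame (\<lambda>x. G x ^ k)" for k
  proof (induction k)
    case 0
    show ?case using tame_const[of 1] by simp
  next
    case (Suc k)
    have "tame (\<lambda>x. 1 * G x ^ k + X x * (X x * G x ^ k) + Y x * (Y x * G x ^ k))"
      by (intro tame_add tame_cmult tame_X tame_Y Suc)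
    then show ?case by (simp add: G_def algebra_simps)
  qed
  then have "integrable M (\<lambda>x. Re (G x ^ N))" by (intro integrable_Re tame_integrable)
  then have "integrable M (\<lambda>x. C powr p * 2 ^ N * Re (G x ^ N))" by simp
  then show ?thesis
  proof (rule Bochner_Integration.integrable_bound)
    show "AE x in M. norm (cmod (g (W x)) powr p) \<le> norm (C powr p * 2 ^ N * Re (G x ^ N))"
    proof (intro AE_I2)
      fix x
      have G: "G x = of_real (1 + (cmod (W x))\<^sup>2)"
        unfolding G_def cmod_power2 by (simp add: power2_eq_square)
      have lin: "2 * c \<le> q + 1 \<Longrightarrow> 0 \<le> q \<Longrightarrow> 1 + c \<le> 2 * 1 + 2 * q" for c q :: real by linarith
      have "2 * cmod (W x) \<le> (cmod (W x))\<^sup>2 + 1"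
        using zero_le_power2[of "cmod (W x) - 1"] by (simp add: power2_diff)
      then have 1: "1 + cmod (W x) \<le> 2 * (1 + (cmod (W x))\<^sup>2)"
        using zero_le_power2[of "cmod (W x)"] unfolding distrib_left
        by (meson lin)
      have "cmod (g (W x)) powr p \<le> (C * (1 + cmod (W x)) ^ d) powr p"
        using bd p by (intro powr_mono2) auto
      also have "\<dots> = C powr p * (1 + cmod (W x)) powr (d * p)"
      proof -
        have pw: "(1 + cmod (W x)) ^ d = (1 + cmod (W x)) powr d"
          by (simp add: powr_realpow add_pos_nonneg)
        show ?thesis unfolding pw using C by (simp add: powr_mult powr_powr)
      qed
      also have "(1 + cmod (W x)) powr (d * p) \<le> (1 + cmod (W x)) powr N"
        using N by (intro powr_mono) auto
      also have "\<dots> = (1 + cmod (W x)) ^ N" by (simp add: powr_realpow add_pos_nonneg)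
      also have "\<dots> \<le> (2 * (1 + (cmod (W x))\<^sup>2)) ^ N" using 1 by (intro power_mono) auto
      also have "\<dots> = 2 ^ N * Re (G x ^ N)" unfolding G power_mult_distrib of_real_power[symmetric] by simp
      finally show "norm (cmod (g (W x)) powr p) \<le> norm (C powr p * 2 ^ N * Re (G x ^ N))"
        using C by (simp add: mult_left_mono)
    qed
  qed measurable
qed

end

section \<open>Orthonormal systems of functionals\<close>

context wiener_space
begin

text \<open>On an interpolated path the combination is a linear form in the increments with
  coefficients \<open>d n i\<close>. The variance of its real part expands into discretised
  covariances of pairs \<open>\<phi> k\<close>, \<open>\<phi> l\<close>, whose limit is the identity
  matrix; dominated convergence treats the other side.\<close>

lemma char_basis:
  assumes ons: "complete_orthonormal_system T \<phi>"
  shows "(CLINT x|\<mu>. iexp (Re (\<Sum>k<K. c k * \<phi> k x))) = exp (- of_real (\<Sum>k<K. (cmod (c k))\<^sup>2) / 2)"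
proof -
  have \<phi>: "\<phi> k \<in> path_dual T" for k using ons by (simp add: complete_orthonormal_system_def)
  note [measurable] = measurable_path_dual[OF \<phi>] measurable_incr
  define e where "e n i = ramp (grid T (Suc n) i) (grid T (Suc n) (Suc i))" for n i
  define d where "d n i = (\<Sum>k<K. c k * \<phi> k (e n i))" for n i
  have sumd: "(\<Sum>k<K. c k * \<phi> k (interpolate T (Suc n) (incr T (Suc n) x))) = (\<Sum>i<Suc n. d n i * incr T (Suc n) x i)" for n x
    unfolding path_dual_interpolate[OF T_pos \<phi>] d_def e_def sum_distrib_left sum_distrib_right
    by (subst sum.swap) (simp add: mult_ac)
  have "(\<lambda>n. CLINT x|\<mu>. iexp (Re (\<Sum>i<Suc n. d n i * incr T (Suc n) x i))) \<longlonglongrightarrow> (CLINT x|\<mu>. iexp (Re (\<Sum>k<K. c k * \<phi> k x)))"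
  proof (rule integral_dominated_convergence[where w="\<lambda>_. 1"])
    show "AE x in \<mu>. (\<lambda>n. iexp (Re (\<Sum>i<Suc n. d n i * incr T (Suc n) x i))) \<longlonglongrightarrow> iexp (Re (\<Sum>k<K. c k * \<phi> k x))"
    proof (rule AE_I2)
      fix x assume "x \<in> space \<mu>"
      then have "x \<in> path_space T" by (simp add: space_wiener)
      then show "(\<lambda>n. iexp (Re (\<Sum>i<Suc n. d n i * incr T (Suc n) x i))) \<longlonglongrightarrow> iexp (Re (\<Sum>k<K. c k * \<phi> k x))"
        unfolding sumd[symmetric]
        by (intro tendsto_intros path_dual_interpolate_tendsto[OF T_pos \<phi>])
    qed
  qed auto
  moreover have "(\<lambda>n. exp (- complex_of_real (T / Suc n * (\<Sum>i<Suc n. (cmod (d n i))\<^sup>2)) / 2)) \<longlonglongrightarrow>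
      exp (- of_real (\<Sum>k<K. (cmod (c k))\<^sup>2) / 2)"
  proof -
    have gram: "(\<lambda>n. of_real (T / Suc n) * (\<Sum>i<Suc n. \<phi> k (e n i) * cnj (\<phi> l (e n i)))) \<longlonglongrightarrow> (if k = l then 1 else 0)" for k l
    proof -
      have "cm_dual_inner T (\<phi> k) (\<phi> l) (if k = l then 1 else 0)"
        using ons by (simp add: complete_orthonormal_system_def)
      then obtain h g where "riesz_representer T (\<phi> k) h" and g: "riesz_representer T (\<phi> l) g"
        and "(if k = l then 1 else 0) = cm_inner T g h"
        unfolding cm_dual_inner_def by blast
      \<comment> \<open>Orthonormality enters by evaluating \<open>\<phi> k\<close> at the
        representer \<open>g\<close> of \<open>\<phi> l\<close>, which is the limit of the
        discretised covariance.\<close>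
      then have "\<phi> k g = (if k = l then 1 else 0)" by (simp add: riesz_representer_def)
      then show ?thesis using path_dual_gram_tendsto[OF T_pos \<phi>[of k] g] by (simp add: e_def)
    qed
    have "complex_of_real (T / Suc n * (\<Sum>i<Suc n. (cmod (d n i))\<^sup>2)) =
      (\<Sum>k<K. \<Sum>l<K. c k * cnj (c l) * (of_real (T / Suc n) * (\<Sum>i<Suc n. \<phi> k (e n i) * cnj (\<phi> l (e n i)))))" for n
    proof -
      have "complex_of_real (T / Suc n * (\<Sum>i<Suc n. (cmod (d n i))\<^sup>2)) = of_real (T / Suc n) * (\<Sum>i<Suc n. d n i * cnj (d n i))"
        by (simp only: of_real_mult of_real_sum complex_norm_square)
      also have "(\<Sum>i<Suc n. d n i * cnj (d n i)) =
          (\<Sum>i<Suc n. \<Sum>k<K. \<Sum>l<K. c k * cnj (c l) * (\<phi> k (e n i) * cnj (\<phi> l (e n i))))"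
        unfolding d_def cnj_sum sum_product by (intro sum.cong refl) (simp add: mult_ac)
      also have "\<dots> = (\<Sum>k<K. \<Sum>i<Suc n. \<Sum>l<K. c k * cnj (c l) * (\<phi> k (e n i) * cnj (\<phi> l (e n i))))"
        by (rule sum.swap)
      also have "\<dots> = (\<Sum>k<K. \<Sum>l<K. \<Sum>i<Suc n. c k * cnj (c l) * (\<phi> k (e n i) * cnj (\<phi> l (e n i))))"
        by (intro sum.cong refl sum.swap)
      finally show ?thesis
        unfolding sum_distrib_left by (simp only: mult.left_commute)
    qed
    then have "(\<lambda>n. complex_of_real (T / Suc n * (\<Sum>i<Suc n. (cmod (d n i))\<^sup>2))) \<longlonglongrightarrow>
        (\<Sum>k<K. \<Sum>l<K. c k * cnj (c l) * (if k = l then 1 else 0))"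
      by (simp only:) (intro tendsto_sum tendsto_mult tendsto_const gram)
    also have "(\<Sum>k<K. \<Sum>l<K. c k * cnj (c l) * (if k = l then 1 else 0)) = of_real (\<Sum>k<K. (cmod (c k))\<^sup>2)"
      unfolding of_real_sum complex_norm_square by (simp add: if_distrib cong: if_cong)
    finally have L: "(\<lambda>n. complex_of_real (T / Suc n * (\<Sum>i<Suc n. (cmod (d n i))\<^sup>2))) \<longlonglongrightarrow> of_real (\<Sum>k<K. (cmod (c k))\<^sup>2)" .
    show ?thesis by (rule tendsto_exp, rule tendsto_divide[OF tendsto_minus[OF L] tendsto_const]) (rule numeral_neq_zero)
  qed
  ultimately show ?thesis
    unfolding char_incr[OF zero_less_Suc] by (rule LIMSEQ_unique)
qed

text \<open>\<open>char_basis\<close> is the characteristic function of independent standard normal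
  real and imaginary parts. Grouping them in pairs gives independence of the complex variables;
  splitting one pair gives the Gaussian law.\<close>

lemma basis_gaussian:
  assumes ons: "complete_orthonormal_system T \<phi>"
  shows basis_indep: "indep_vars (\<lambda>_. borel) \<phi> {..<K}"
    and basis_complex_gaussian: "complex_gaussian \<mu> (\<phi> k)"
proof -
  have \<phi>: "\<phi> k \<in> path_dual T" for k using ons by (simp add: complete_orthonormal_system_def)
  note [measurable] = measurable_path_dual[OF \<phi>]
  define X where "X p x = (if snd p then Im (\<phi> (fst p) x) else Re (\<phi> (fst p) x))" for p x
  have Xm: "X p \<in> borel_measurable \<mu>" for p unfolding X_def by (cases "snd p") auto
  have ch: "(CLINT x|\<mu>. iexp (\<Sum>p\<in>{..<K} \<times> UNIV. s p * X p x)) = exp (- of_real (\<Sum>p\<in>{..<K} \<times> UNIV. (s p)\<^sup>2) / 2)" for s K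
  proof -
    have 1: "(\<Sum>p\<in>{..<K} \<times> UNIV. s p * X p x) = Re (\<Sum>k<K. Complex (s (k, False)) (- s (k, True)) * \<phi> k x)" for x
      unfolding sum_times_bool by (simp add: X_def)
    have 2: "(\<Sum>p\<in>{..<K} \<times> UNIV. (s p)\<^sup>2) = (\<Sum>k<K. (cmod (Complex (s (k, False)) (- s (k, True))))\<^sup>2)"
      unfolding sum_times_bool by (simp add: cmod_power2)
    show ?thesis unfolding 1 2 by (rule char_basis[OF ons])
  qed
  have ind: "indep_vars (\<lambda>_. borel) X ({..<K} \<times> UNIV)" for K
    by (rule indep_std_normal_if_char(1)) (use Xm ch in auto)
  have law: "distr \<mu> borel (X p) = std_normal_distribution" for p
    by (rule indep_std_normal_if_char(2)[of "{..<Suc (fst p)} \<times> UNIV"]) (use Xm ch in \<open>auto simp: mem_Times_iff\<close>)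
  have "indep_vars (\<lambda>k. PiM ({k} \<times> UNIV) (\<lambda>_. borel)) (\<lambda>k x. restrict (\<lambda>p. X p x) ({k} \<times> UNIV)) {..<K}"
    by (rule indep_vars_restrict[OF ind]) (auto simp: disjoint_family_on_def)
  from indep_vars_compose2[OF this, of "\<lambda>k v. of_real (v (k, False)) + \<i> * of_real (v (k, True))" "\<lambda>_. borel"]
  show "indep_vars (\<lambda>_. borel) \<phi> {..<K}"
    by (simp add: X_def complex_eq[symmetric] measurable_component_singleton)
  show "complex_gaussian \<mu> (\<phi> k)"
  proof
    have "indep_var (PiM {(k, False)} (\<lambda>_. borel)) (\<lambda>x. \<lambda>p\<in>{(k, False)}. X p x)
        (PiM {(k, True)} (\<lambda>_. borel)) (\<lambda>x. \<lambda>p\<in>{(k, True)}. X p x)"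
      by (rule indep_var_restrict[OF ind[of "Suc k"]]) auto
    from indep_var_compose[OF this, of "\<lambda>v. v (k, False)" borel "\<lambda>v. v (k, True)" borel]
    have "indep_var borel (X (k, False)) borel (X (k, True))"
      by (simp add: o_def measurable_component_singleton)
    then show "indep_var borel (\<lambda>x. Re (\<phi> k x)) borel (\<lambda>x. Im (\<phi> k x))" by (simp add: X_def[abs_def])
  qed (use law[of "(k, False)"] law[of "(k, True)"] in \<open>simp_all add: X_def[abs_def]\<close>)
qed

end

section \<open>The Ornstein-Uhlenbeck semigroup on \<open>L\<^sup>p\<close>\<close>

text \<open>The tangent line of the convex power function at \<open>v\<close>, the ingredient of
  Jensen's inequality below. With r = u/v it is Bernoulli's inequality 1 + p (r - 1) \<le>
  r^p.\<close>

lemma powr_ge_tangent: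
  fixes u v p :: real
  assumes u: "0 \<le> u" and v: "0 < v" and p: "1 \<le> p"
  shows "v powr p + p * v powr (p - 1) * (u - v) \<le> u powr p"
proof (cases "u = 0")
  case True
  have "v powr p = v powr (p - 1) * v" using v by (simp add: powr_mult_base mult.commute)
  then have "v powr p + p * v powr (p - 1) * (u - v) = (1 - p) * (v powr (p - 1) * v)"
    using True by (simp add: algebra_simps)
  also have "\<dots> \<le> 0" using p v by (intro mult_nonpos_nonneg) auto
  finally show ?thesis using True p by simp
next
  case False
  define r where "r = u / v"
  have r: "0 < r" "u = r * v" using u v False by (simp_all add: r_def)
  \<comment> \<open>Young's inequality with second factor 1 turns into Bernoulli's inequality after
    multiplication by \<open>p\<close>.\<close>
  have "(r powr p) powr (1 / p) * 1 powr (1 - 1 / p) \<le> (1 / p) * (r powr p) + (1 - 1 / p) * 1"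
    using p r by (intro Youngs_inequality_0) auto
  then have "r \<le> (1 / p) * r powr p + (1 - 1 / p)" using p r by (simp add: powr_powr)
  then have "p * r \<le> p * ((1 / p) * r powr p + (1 - 1 / p))" using p by (intro mult_left_mono) auto
  then have "1 + p * (r - 1) \<le> r powr p" using p by (simp add: algebra_simps)
  then have "v powr p * (1 + p * (r - 1)) \<le> v powr p * r powr p" by (intro mult_left_mono) auto
  also have "v powr p * r powr p = u powr p" using r v by (simp add: powr_mult mult.commute)
  also have "v powr p * (1 + p * (r - 1)) = v powr p + p * v powr (p - 1) * (u - v)"
  proof -
    have vp: "v powr p = v powr (p - 1) * v" using v by (simp add: powr_mult_base mult.commute)
    show ?thesis unfolding vp r(2) by (simp add: algebra_simps)
  qed
  finally show ?thesis .
qed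

text \<open>Jensen's inequality, from the tangent at the mean of |f|. The nonnegative integral on
  the right admits every measurable \<open>f\<close>: a non-integrable one has Bochner integral 0,
  and an infinite right-hand side is trivial.\<close>

lemma (in prob_space) powr_norm_integral_le:
  fixes f :: "'a \<Rightarrow> complex"
  assumes f [measurable]: "f \<in> borel_measurable M" and p: "1 \<le> p"
  shows "ennreal (cmod (integral\<^sup>L M f) powr p) \<le> (\<integral>\<^sup>+x. ennreal (cmod (f x) powr p) \<partial>M)"
proof (cases "integrable M f \<and> integral\<^sup>L M f \<noteq> 0 \<and> (\<integral>\<^sup>+x. ennreal (cmod (f x) powr p) \<partial>M) < \<infinity>")
  case True
  define v where "v = (LINT x|M. cmod (f x))"
  have int: "integrable M (\<lambda>x. cmod (f x))" using True by (intro integrable_norm) auto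
  have le: "cmod (integral\<^sup>L M f) \<le> v" unfolding v_def by (rule integral_norm_bound)
  then have v: "0 < v" using True by (metis norm_le_zero_iff not_le order_trans)
  have intp: "integrable M (\<lambda>x. cmod (f x) powr p)"
    using True by (intro integrableI_nonneg) auto
  have "v powr p = (LINT x|M. v powr p + p * v powr (p - 1) * (cmod (f x) - v))"
    using int by (simp add: v_def[symmetric] prob_space)
  also have "\<dots> \<le> (LINT x|M. cmod (f x) powr p)"
    using int intp powr_ge_tangent[OF norm_ge_zero v p] by (intro integral_mono) auto
  finally have "cmod (integral\<^sup>L M f) powr p \<le> (LINT x|M. cmod (f x) powr p)"
    using powr_mono2[OF _ _ le, of p] p by simp
  then have "ennreal (cmod (integral\<^sup>L M f) powr p) \<le> ennreal (LINT x|M. cmod (f x) powr p)"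
    by (rule ennreal_leI)
  also have "\<dots> = (\<integral>\<^sup>+x. ennreal (cmod (f x) powr p) \<partial>M)"
    using intp by (intro nn_integral_eq_integral[symmetric]) auto
  finally show ?thesis .
next
  case False
  then consider "integral\<^sup>L M f = 0" | "(\<integral>\<^sup>+x. ennreal (cmod (f x) powr p) \<partial>M) = \<infinity>"
    by (auto simp: not_integrable_integral_eq not_less top_unique)
  then show ?thesis using p by cases auto
qed

section \<open>Elementary properties of L^p convergence\<close>

lemma Lp_measurable: "F \<in> Lp M p \<Longrightarrow> F \<in> borel_measurable M"
  and Lp_integrable: "F \<in> Lp M p \<Longrightarrow> integrable M (\<lambda>x. cmod (F x) powr p)"
  by (auto simp: Lp_def)

lemma LpI: "F \<in> borel_measurable M \<Longrightarrow> integrable M (\<lambda>x. cmod (F x) powr p) \<Longrightarrow> F \<in> Lp M p"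
  by (simp add: Lp_def)

text \<open>With the crude constant \<open>2 powr p\<close> this stands in for Minkowski's
  inequality; it suffices for closure under differences and for uniqueness of limits.\<close>

lemma cmod_diff_powr_le:
  assumes "0 \<le> p"
  shows "cmod (a - b) powr p \<le> 2 powr p * (cmod a powr p + cmod b powr p)"
proof -
  have "cmod (a - b) \<le> 2 * max (cmod a) (cmod b)"
    using norm_triangle_ineq4[of a b] by linarith
  then have "cmod (a - b) powr p \<le> (2 * max (cmod a) (cmod b)) powr p"
    using assms by (intro powr_mono2) auto
  also have "\<dots> = 2 powr p * max (cmod a) (cmod b) powr p" by (simp add: powr_mult)
  also have "\<dots> \<le> 2 powr p * (cmod a powr p + cmod b powr p)"
    by (intro mult_left_mono) (auto simp: max_def)
  finally show ?thesis .
qed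

lemma Lp_diff:
  assumes F: "F \<in> Lp M p" and G: "G \<in> Lp M p" and p: "0 \<le> p"
  shows "(\<lambda>x. F x - G x) \<in> Lp M p"
proof (rule LpI)
  note [measurable] = Lp_measurable[OF F] Lp_measurable[OF G]
  show "(\<lambda>x. F x - G x) \<in> borel_measurable M" by measurable
  have "integrable M (\<lambda>x. 2 powr p * (cmod (F x) powr p + cmod (G x) powr p))"
    using Lp_integrable[OF F] Lp_integrable[OF G] by auto
  then show "integrable M (\<lambda>x. cmod (F x - G x) powr p)"
    by (rule Bochner_Integration.integrable_bound) (use cmod_diff_powr_le[OF p] in auto)
qed

lemma Lp_cmult:
  assumes F: "F \<in> Lp M p"
  shows "(\<lambda>x. c * F x) \<in> Lp M p"
  using Lp_measurable[OF F] Lp_integrable[OF F] by (intro LpI) (auto simp: norm_mult powr_mult)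

lemma Lp_norm_cmult:
  assumes "0 < p"
  shows "Lp_norm M p (\<lambda>x. c * F x) = cmod c * Lp_norm M p F"
  using assms by (simp add: Lp_norm_def norm_mult powr_mult powr_powr)

lemma Lp_norm_powr: "0 < p \<Longrightarrow> (Lp_norm M p F) powr p = (LINT x|M. cmod (F x) powr p)"
  by (simp add: Lp_norm_def powr_powr)

lemma Lp_tendsto_unique:
  assumes F: "Lp_tendsto M p Fs F \<A>" and G: "Lp_tendsto M p Fs G \<A>" and p: "0 < p" and "\<A> \<noteq> bot"
  shows "AE x in M. F x = G x"
proof -
  have FL: "F \<in> Lp M p" and GL: "G \<in> Lp M p" and ev: "eventually (\<lambda>i. Fs i \<in> Lp M p) \<A>"
    using F G by (auto simp: Lp_tendsto_def)
  have FG: "(\<lambda>x. F x - G x) \<in> Lp M p" using FL GL p by (intro Lp_diff) auto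
  define I where "I = (LINT x|M. cmod (F x - G x) powr p)"
  have conv: "((\<lambda>i. LINT x|M. cmod (Fs i x - H x) powr p) \<longlongrightarrow> 0) \<A>" if "Lp_tendsto M p Fs H \<A>" for H
  proof -
    have "((\<lambda>i. Lp_norm M p (\<lambda>x. Fs i x - H x) powr p) \<longlongrightarrow> 0) \<A>"
      using that p by (intro tendsto_zero_powrI[where b=p]) (auto simp: Lp_tendsto_def Lp_norm_def)
    then show ?thesis by (simp add: Lp_norm_powr[OF p])
  qed
  have "((\<lambda>i. 2 powr p * ((LINT x|M. cmod (Fs i x - G x) powr p) + (LINT x|M. cmod (Fs i x - F x) powr p))) \<longlongrightarrow> 2 powr p * (0 + 0)) \<A>"
    by (intro tendsto_intros conv F G)
  moreover have "\<forall>\<^sub>F i in \<A>. I \<le> 2 powr p * ((LINT x|M. cmod (Fs i x - G x) powr p) + (LINT x|M. cmod (Fs i x - F x) powr p))"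
    using ev
  proof eventually_elim
    case (elim i)
    have d: "(\<lambda>x. Fs i x - G x) \<in> Lp M p" "(\<lambda>x. Fs i x - F x) \<in> Lp M p"
      using elim FL GL p by (auto intro!: Lp_diff)
    have "I \<le> (LINT x|M. 2 powr p * (cmod (Fs i x - G x) powr p + cmod (Fs i x - F x) powr p))"
      unfolding I_def
    proof (rule integral_mono)
      show "integrable M (\<lambda>x. cmod (F x - G x) powr p)" by (rule Lp_integrable[OF FG])
      show "integrable M (\<lambda>x. 2 powr p * (cmod (Fs i x - G x) powr p + cmod (Fs i x - F x) powr p))"
        using d[THEN Lp_integrable] by auto
      show "cmod (F x - G x) powr p \<le> 2 powr p * (cmod (Fs i x - G x) powr p + cmod (Fs i x - F x) powr p)" for x
        using cmod_diff_powr_le[of p "Fs i x - G x" "Fs i x - F x"] p by simp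
    qed
    also have "\<dots> = 2 powr p * ((LINT x|M. cmod (Fs i x - G x) powr p) + (LINT x|M. cmod (Fs i x - F x) powr p))"
      using d[THEN Lp_integrable] by simp
    finally show ?case .
  qed
  ultimately have "I \<le> 2 powr p * (0 + 0)"
    by (rule tendsto_lowerbound) fact
  moreover have "0 \<le> I" unfolding I_def by simp
  ultimately have "I = 0" by simp
  then have "AE x in M. cmod (F x - G x) powr p = 0"
    using integral_nonneg_eq_0_iff_AE[OF Lp_integrable[OF FG]] by (simp add: I_def)
  then show ?thesis by eventually_elim simp
qed

lemma (in finite_measure) bounded_borel_in_Lp:
  assumes "bounded_borel M F" "0 \<le> p"
  shows "F \<in> Lp M p"
proof (rule LpI)
  show [measurable]: "F \<in> borel_measurable M" using assms by (simp add: bounded_borel_def)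
  obtain B where B: "\<And>x. x \<in> space M \<Longrightarrow> cmod (F x) \<le> B"
    using assms unfolding bounded_borel_def bounded_iff by blast
  show "integrable M (\<lambda>x. cmod (F x) powr p)"
    by (rule integrable_const_bound[where B="B powr p"]) (use B assms in \<open>auto intro!: AE_I2 powr_mono2\<close>)
qed

lemma (in finite_measure) bounded_borel_dense:
  assumes F: "F \<in> Lp M p" and p: "0 < p"
  obtains Fs :: "nat \<Rightarrow> 'a \<Rightarrow> complex"
  where "\<And>j. bounded_borel M (Fs j)" "Lp_tendsto M p Fs F sequentially"
proof -
  note [measurable] = Lp_measurable[OF F]
  define Fs where "Fs j x = (if cmod (F x) \<le> real j then F x else 0)" for j x
  have [measurable]: "Fs j \<in> borel_measurable M" for j unfolding Fs_def by measurable
  have b: "bounded_borel M (Fs j)" for j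
    unfolding bounded_borel_def by (auto simp: Fs_def intro!: boundedI[where B="real j"])
  have "(\<lambda>j. LINT x|M. cmod (Fs j x - F x) powr p) \<longlonglongrightarrow> (LINT x|M. 0)"
  proof (rule integral_dominated_convergence[where w="\<lambda>x. cmod (F x) powr p"])
    show "AE x in M. (\<lambda>j. cmod (Fs j x - F x) powr p) \<longlonglongrightarrow> 0"
    proof (rule AE_I2)
      fix x
      obtain K :: nat where K: "cmod (F x) \<le> K" using real_arch_simple by blast
      have "cmod (Fs j x - F x) powr p = 0" if "K \<le> j" for j
        using K that by (auto simp: Fs_def)
      then show "(\<lambda>j. cmod (Fs j x - F x) powr p) \<longlonglongrightarrow> 0"
        by (intro tendsto_eventually eventually_sequentiallyI[of K]) auto
    qed
    show "AE x in M. norm (cmod (Fs j x - F x) powr p) \<le> cmod (F x) powr p" for j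
      using p by (intro AE_I2) (auto simp: Fs_def)
  qed (use Lp_integrable[OF F] in auto)
  then have "(\<lambda>j. Lp_norm M p (\<lambda>x. Fs j x - F x)) \<longlonglongrightarrow> 0"
    unfolding Lp_norm_def using p by (intro tendsto_zero_powrI[where b="1/p"]) auto
  moreover have "Fs j \<in> Lp M p" for j using b p by (intro bounded_borel_in_Lp) auto
  ultimately have "Lp_tendsto M p Fs F sequentially"
    using F by (auto simp: Lp_tendsto_def)
  then show ?thesis using b that by blast
qed

section \<open>Mehler integrals as operators on L^p\<close>

context wiener_space
begin

definition mehler_integral :: "complex \<Rightarrow> real \<Rightarrow> ((real \<Rightarrow>\<^sub>C complex) \<Rightarrow> complex) \<Rightarrow> (real \<Rightarrow>\<^sub>C complex) \<Rightarrow> complex" where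
  "mehler_integral a b F x = (CLINT y|\<mu>. F (mehler a b (x, y)))"

lemma measurable_comp_mehler: "F \<in> borel_measurable \<mu> \<Longrightarrow> (\<lambda>p. F (mehler a b p)) \<in> borel_measurable (\<mu> \<Otimes>\<^sub>M \<mu>)"
  by (rule measurable_compose[OF measurable_mehler])

lemma measurable_mehler_integral:
  assumes "F \<in> borel_measurable \<mu>"
  shows "mehler_integral a b F \<in> borel_measurable \<mu>"
  unfolding mehler_integral_def
  by (rule borel_measurable_lebesgue_integral) (use measurable_comp_mehler[OF assms] in \<open>simp add: case_prod_unfold\<close>)

text \<open>Jensen's inequality in the integration variable, then Tonelli and the invariance of
  \<open>\<mu>\<close> under \<open>mehler\<close>.\<close>

lemma mehler_integral_contraction:
  assumes ab: "(cmod a)\<^sup>2 + b\<^sup>2 = 1" and F: "F \<in> borel_measurable \<mu>" and p: "1 \<le> p"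
  shows "(\<integral>\<^sup>+x. ennreal (cmod (mehler_integral a b F x) powr p) \<partial>\<mu>) \<le> (\<integral>\<^sup>+x. ennreal (cmod (F x) powr p) \<partial>\<mu>)"
proof -
  have m: "(\<lambda>x. ennreal (cmod (F x) powr p)) \<in> borel_measurable \<mu>" using F by measurable
  have "(\<integral>\<^sup>+x. ennreal (cmod (mehler_integral a b F x) powr p) \<partial>\<mu>) \<le>
      (\<integral>\<^sup>+x. \<integral>\<^sup>+y. ennreal (cmod (F (mehler a b (x, y))) powr p) \<partial>\<mu> \<partial>\<mu>)"
    unfolding mehler_integral_def
  proof (intro nn_integral_mono powr_norm_integral_le p)
    fix x assume "x \<in> space \<mu>"
    then show "(\<lambda>y. F (mehler a b (x, y))) \<in> borel_measurable \<mu>"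
      by (rule measurable_compose[OF measurable_Pair1' measurable_comp_mehler[OF F]])
  qed
  also have "\<dots> = (\<integral>\<^sup>+q. ennreal (cmod (F (mehler a b q)) powr p) \<partial>(\<mu> \<Otimes>\<^sub>M \<mu>))"
    using measurable_comp_mehler[OF F, of a b] by (intro nn_integral_fst) measurable
  also have "\<dots> = (\<integral>\<^sup>+x. ennreal (cmod (F x) powr p) \<partial>(distr (\<mu> \<Otimes>\<^sub>M \<mu>) \<mu> (mehler a b)))"
    using m by (intro nn_integral_distr[symmetric] measurable_mehler) simp
  finally show ?thesis unfolding distr_mehler[OF ab] .
qed

lemma mehler_integral_Lp:
  assumes ab: "(cmod a)\<^sup>2 + b\<^sup>2 = 1" and F: "F \<in> Lp \<mu> p" and p: "1 \<le> p"
  shows "mehler_integral a b F \<in> Lp \<mu> p" "Lp_norm \<mu> p (mehler_integral a b F) \<le> Lp_norm \<mu> p F"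
proof -
  have mF: "F \<in> borel_measurable \<mu>" using F by (rule Lp_measurable)
  have mG: "mehler_integral a b F \<in> borel_measurable \<mu>" using mF by (rule measurable_mehler_integral)
  have le: "(\<integral>\<^sup>+x. ennreal (cmod (mehler_integral a b F x) powr p) \<partial>\<mu>) \<le> ennreal (LINT x|\<mu>. cmod (F x) powr p)"
    using mehler_integral_contraction[OF ab mF p] Lp_integrable[OF F] by (subst nn_integral_eq_integral[symmetric]) auto
  have int: "integrable \<mu> (\<lambda>x. cmod (mehler_integral a b F x) powr p)"
    using mG le by (intro integrableI_nonneg) (auto simp: less_top[symmetric] top_unique)
  then show "mehler_integral a b F \<in> Lp \<mu> p" using mG by (intro LpI)
  have "(LINT x|\<mu>. cmod (mehler_integral a b F x) powr p) \<le> (LINT x|\<mu>. cmod (F x) powr p)"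
    using le int by (subst (asm) nn_integral_eq_integral) auto
  then show "Lp_norm \<mu> p (mehler_integral a b F) \<le> Lp_norm \<mu> p F"
    unfolding Lp_norm_def using p by (intro powr_mono2) auto
qed

text \<open>Contraction is applied to \<open>Fs j - J\<close>. Splitting its Mehler integral
  requires \<open>J\<close> to be integrable along \<open>mehler\<close> at every path, which is
  assumed separately because \<open>J\<close> may be unbounded.\<close>

lemma mehler_integral_continuous:
  assumes ab: "(cmod a)\<^sup>2 + b\<^sup>2 = 1" and p: "1 \<le> p"
    and J: "\<And>x. x \<in> path_space T \<Longrightarrow> integrable \<mu> (\<lambda>y. J (mehler a b (x, y)))"
    and Fs: "\<And>j :: nat. bounded_borel \<mu> (Fs j)" "Lp_tendsto \<mu> p Fs J sequentially"
  shows "Lp_tendsto \<mu> p (\<lambda>j. mehler_integral a b (Fs j)) (mehler_integral a b J) sequentially"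
proof -
  have JL: "J \<in> Lp \<mu> p" using Fs by (simp add: Lp_tendsto_def)
  have FL: "Fs j \<in> Lp \<mu> p" for j using Fs(1) p by (intro bounded_borel_in_Lp) auto
  have FJ: "(\<lambda>x. Fs j x - J x) \<in> Lp \<mu> p" for j using FL JL p by (intro Lp_diff) auto
  have diff: "mehler_integral a b (\<lambda>x. Fs j x - J x) x = mehler_integral a b (Fs j) x - mehler_integral a b J x"
    if x: "x \<in> space \<mu>" for j x
  proof -
    have x': "x \<in> path_space T" using x by (simp add: space_wiener)
    obtain B where B: "\<And>x. x \<in> space \<mu> \<Longrightarrow> cmod (Fs j x) \<le> B"
      using Fs(1) unfolding bounded_borel_def bounded_iff by blast
    have "integrable \<mu> (\<lambda>y. Fs j (mehler a b (x, y)))"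
    proof (rule integrable_const_bound[where B=B])
      show "AE y in \<mu>. cmod (Fs j (mehler a b (x, y))) \<le> B"
        using x measurable_space[OF measurable_mehler, of "(x, _)"] by (intro AE_I2 B) (auto simp: space_pair_measure)
      show "(\<lambda>y. Fs j (mehler a b (x, y))) \<in> borel_measurable \<mu>"
        by (rule measurable_compose[OF measurable_Pair1'[OF x] measurable_comp_mehler[OF Lp_measurable[OF FL]]])
    qed
    then show ?thesis unfolding mehler_integral_def using J[OF x'] by (rule Bochner_Integration.integral_diff)
  qed
  have norm: "Lp_norm \<mu> p (\<lambda>x. mehler_integral a b (Fs j) x - mehler_integral a b J x) \<le> Lp_norm \<mu> p (\<lambda>x. Fs j x - J x)" for j
  proof -
    have "Lp_norm \<mu> p (\<lambda>x. mehler_integral a b (Fs j) x - mehler_integral a b J x) = Lp_norm \<mu> p (mehler_integral a b (\<lambda>x. Fs j x - J x))"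
      unfolding Lp_norm_def by (intro arg_cong[where f="\<lambda>I. I powr (1 / p)"] Bochner_Integration.integral_cong) (simp_all add: diff)
    also have "\<dots> \<le> Lp_norm \<mu> p (\<lambda>x. Fs j x - J x)" by (rule mehler_integral_Lp[OF ab FJ p])
    finally show ?thesis .
  qed
  have "(\<lambda>j. Lp_norm \<mu> p (\<lambda>x. mehler_integral a b (Fs j) x - mehler_integral a b J x)) \<longlonglongrightarrow> 0"
    by (rule tendsto_sandwich[OF _ _ tendsto_const, where h="\<lambda>j. Lp_norm \<mu> p (\<lambda>x. Fs j x - J x)"])
      (use Fs(2) norm in \<open>auto simp: Lp_tendsto_def Lp_norm_def\<close>)
  then show ?thesis
    using mehler_integral_Lp(1)[OF ab JL p] mehler_integral_Lp(1)[OF ab FL p] by (auto simp: Lp_tendsto_def)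
qed

lemma ou_integral_eq_mehler_integral:
  "ou_integral \<mu> \<theta> t F =
    mehler_integral (exp (- (of_real (cos \<theta>) + \<i> * of_real (sin \<theta>)) * of_real t)) (sqrt (1 - exp (- 2 * t * cos \<theta>))) F"
  by (simp add: fun_eq_iff ou_integral_def mehler_integral_def mehler_def)

lemma ou_coefficients:
  assumes "0 \<le> cos \<theta>" "0 \<le> t"
  shows "(cmod (exp (- (of_real (cos \<theta>) + \<i> * of_real (sin \<theta>)) * of_real t)))\<^sup>2 + (sqrt (1 - exp (- 2 * t * cos \<theta>)))\<^sup>2 = 1"
proof -
  have "exp (- 2 * t * cos \<theta>) \<le> 1" using assms by simp
  moreover have "(cmod (exp (- (of_real (cos \<theta>) + \<i> * of_real (sin \<theta>)) * of_real t)))\<^sup>2 = exp (- 2 * t * cos \<theta>)"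
    by (simp add: norm_exp_eq_Re power2_eq_square exp_add[symmetric] algebra_simps)
  ultimately show ?thesis by simp
qed

text \<open>\<open>P\<close> is the property by which \<open>SOME\<close> selects the semigroup. The
  explicit integral satisfies it, so the choice does too, and truncations of \<open>J\<close>
  provide one sequence whose images converge to both.\<close>

lemma ou_semigroup_eigenfunction:
  assumes \<theta>: "0 \<le> cos \<theta>" and t: "0 \<le> t" and p: "1 \<le> p" and J: "J \<in> Lp \<mu> p"
    and int: "\<And>a b x. (cmod a)\<^sup>2 + b\<^sup>2 = 1 \<Longrightarrow> x \<in> path_space T \<Longrightarrow> integrable \<mu> (\<lambda>y. J (mehler a b (x, y)))"
    and eigen: "\<And>x. x \<in> path_space T \<Longrightarrow> ou_integral \<mu> \<theta> t J x = c * J x"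
  shows "ou_semigroup \<mu> \<theta> p t J \<in> Lp \<mu> p" "AE x in \<mu>. ou_semigroup \<mu> \<theta> p t J x = c * J x"
proof -
  define P where "P G \<longleftrightarrow> G \<in> Lp \<mu> p \<and>
     (\<forall>Fs :: nat \<Rightarrow> _. (\<forall>j. bounded_borel \<mu> (Fs j)) \<and> Lp_tendsto \<mu> p Fs J sequentially \<longrightarrow>
        Lp_tendsto \<mu> p (\<lambda>j. ou_integral \<mu> \<theta> t (Fs j)) G sequentially)" for G
  note ab = ou_coefficients[OF \<theta> t]
  have "P (ou_integral \<mu> \<theta> t J)"
    unfolding P_def ou_integral_eq_mehler_integral
    by (intro conjI allI impI mehler_integral_Lp(1)[OF ab J p] mehler_integral_continuous[OF ab p int[OF ab]]) auto
  note P0 = this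
  then have "P (SOME G. P G)" by (rule someI[of P])
  moreover have S: "ou_semigroup \<mu> \<theta> p t J = (SOME G. P G)"
    unfolding ou_semigroup_def P_def by simp
  ultimately have P1: "P (ou_semigroup \<mu> \<theta> p t J)" by simp
  then show "ou_semigroup \<mu> \<theta> p t J \<in> Lp \<mu> p" by (simp add: P_def)
  obtain Fs :: "nat \<Rightarrow> _" where Fs: "\<And>j. bounded_borel \<mu> (Fs j)" "Lp_tendsto \<mu> p Fs J sequentially"
    using bounded_borel_dense[OF J] p by (metis less_le_trans zero_less_one)
  have "AE x in \<mu>. ou_semigroup \<mu> \<theta> p t J x = ou_integral \<mu> \<theta> t J x"
    by (rule Lp_tendsto_unique[of _ _ "\<lambda>j. ou_integral \<mu> \<theta> t (Fs j)" _ sequentially])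
      (use P0 P1 Fs p in \<open>auto simp: P_def\<close>)
  then show "AE x in \<mu>. ou_semigroup \<mu> \<theta> p t J x = c * J x"
    using AE_space by eventually_elim (simp add: eigen space_wiener)
qed

end

lemma exp_difference_quotient:
  "((\<lambda>t. (exp (c * complex_of_real t) - 1) / of_real t) \<longlongrightarrow> c) (at_right 0)"
proof -
  have "((\<lambda>z. exp (c * z)) has_field_derivative c) (at 0)"
    by (auto intro!: derivative_eq_intros)
  then have "((\<lambda>z. (exp (c * z) - 1) / z) \<longlongrightarrow> c) (at 0)"
    by (simp add: has_field_derivative_iff)
  moreover have "filterlim complex_of_real (at 0) (at_right 0)"
    unfolding filterlim_at by (auto intro!: tendsto_eq_intros simp: eventually_at_right_field intro: exI[of _ 1])
  ultimately show ?thesis by (rule filterlim_compose)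
qed

text \<open>Almost everywhere the difference quotient minus c J is a scalar multiple of
  \<open>J\<close>, so its norm is the modulus of that scalar times a constant;
  \<open>exp_difference_quotient\<close> sends the scalar to 0.\<close>

lemma Lp_generator_eigenfunction:
  assumes p: "0 < p" and J: "J \<in> Lp M p"
    and S: "\<And>t. 0 \<le> t \<Longrightarrow> S t J \<in> Lp M p" "\<And>t. 0 \<le> t \<Longrightarrow> AE x in M. S t J x = exp (c * of_real t) * J x"
  shows "Lp_generator M p S J (\<lambda>x. c * J x)"
  unfolding Lp_generator_def Lp_tendsto_def
proof (intro conjI J Lp_cmult)
  have pos: "\<forall>\<^sub>F t in at_right 0. (0 :: real) < t" by (simp add: eventually_at_right_less)
  have inL: "(\<lambda>x. (S t J x - J x) / of_real t) \<in> Lp M p" if "0 \<le> t" for t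
    using Lp_cmult[OF Lp_diff[OF S(1)[OF that] J], of "1 / of_real t"] p by simp
  show "\<forall>\<^sub>F t in at_right 0. (\<lambda>x. (S t J x - J x) / of_real t) \<in> Lp M p"
    using pos by eventually_elim (simp add: inL)
  have "((\<lambda>t. cmod ((exp (c * of_real t) - 1) / of_real t - c) * Lp_norm M p J) \<longlongrightarrow> cmod (c - c) * Lp_norm M p J) (at_right 0)"
    by (intro tendsto_intros exp_difference_quotient)
  then have lim: "((\<lambda>t. cmod ((exp (c * of_real t) - 1) / of_real t - c) * Lp_norm M p J) \<longlongrightarrow> 0) (at_right 0)" by simp
  show "((\<lambda>t. Lp_norm M p (\<lambda>x. (S t J x - J x) / of_real t - c * J x)) \<longlongrightarrow> 0) (at_right 0)"
  proof (rule Lim_transform_eventually[OF lim])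
    show "\<forall>\<^sub>F t in at_right 0. cmod ((exp (c * of_real t) - 1) / of_real t - c) * Lp_norm M p J =
      Lp_norm M p (\<lambda>x. (S t J x - J x) / of_real t - c * J x)"
      using pos
    proof eventually_elim
      case (elim t)
      then have t: "0 \<le> t" by simp
      let ?k = "(exp (c * of_real t) - 1) / of_real t - c"
      note [measurable] = Lp_measurable[OF J] Lp_measurable[OF S(1)[OF t]]
      have "(LINT x|M. cmod ((S t J x - J x) / of_real t - c * J x) powr p) = (LINT x|M. cmod (?k * J x) powr p)"
      proof (rule integral_cong_AE)
        show "AE x in M. cmod ((S t J x - J x) / of_real t - c * J x) powr p = cmod (?k * J x) powr p"
          using S(2)[OF t]
        proof eventually_elim
          case (elim x)
          have "(S t J x - J x) / of_real t - c * J x = ?k * J x"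
            unfolding elim by (simp add: algebra_simps diff_divide_distrib)
          then show ?case by simp
        qed
      qed measurable
      then have "Lp_norm M p (\<lambda>x. (S t J x - J x) / of_real t - c * J x) = Lp_norm M p (\<lambda>x. ?k * J x)"
        by (simp add: Lp_norm_def)
      then show ?case by (simp add: Lp_norm_cmult[OF p])
    qed
  qed
qed

section \<open>Fourier-Hermite-Ito polynomials\<close>

text \<open>Convergent partial sums of natural numbers are eventually constant, as the topology is
  discrete.\<close>

lemma summable_nat_eventually_zero:
  fixes f :: "nat \<Rightarrow> nat"
  assumes "summable f"
  shows "\<forall>\<^sub>F k in sequentially. f k = 0"
proof -
  obtain s where "(\<lambda>n. \<Sum>i<n. f i) \<longlonglongrightarrow> s" using assms by (auto simp: summable_def sums_def)
  then obtain N where N: "\<And>n. N \<le> n \<Longrightarrow> (\<Sum>i<n. f i) = s"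
    by (auto simp: tendsto_discrete eventually_sequentially)
  have "f k = 0" if "N \<le> k" for k
    using N[of k] N[of "Suc k"] that by simp
  then show ?thesis by (auto simp: eventually_sequentially)
qed

section \<open>Products of polynomials over finitely supported multi-indices\<close>

context wiener_space
begin

context
  fixes \<phi> :: "nat \<Rightarrow> (real \<Rightarrow>\<^sub>C complex) \<Rightarrow> complex" and ms ns :: "nat \<Rightarrow> nat" and K :: nat
  assumes ons: "complete_orthonormal_system T \<phi>"
    and K: "\<And>k. K \<le> k \<Longrightarrow> ms k = 0 \<and> ns k = 0"
begin

lemma basis_dual: "\<phi> k \<in> path_dual T"
  using ons by (simp add: complete_orthonormal_system_def)

lemma basis_measurable: "\<phi> k \<in> borel_measurable \<mu>"
  by (rule measurable_path_dual[OF basis_dual])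

lemma fourier_hermite_ito_eq:
  "fourier_hermite_ito \<phi> ms ns x = (\<Prod>k<K. 1 / of_real (sqrt (2 ^ (ms k + ns k) * fact (ms k) * fact (ns k)))
     * hli (ms k) (ns k) (\<phi> k x))"
  unfolding fourier_hermite_ito_def hermite_laguerre_ito_eq_hli
  by (rule prodinf_finite) (auto simp: K not_less)

text \<open>For fixed \<open>x\<close>, linearity makes the \<open>k\<close>-th factor a function of
  \<open>\<phi> k y\<close> alone, so independence reduces the integral to
  \<open>integral_hli\<close> at the points \<open>\<phi> k x\<close>.\<close>

lemma fourier_hermite_ito_mehler:
  assumes x: "x \<in> path_space T" and ab: "(cmod a)\<^sup>2 + b\<^sup>2 = 1"
  shows integrable_fourier_hermite_ito_mehler: "integrable \<mu> (\<lambda>y. fourier_hermite_ito \<phi> ms ns (mehler a b (x, y)))"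
    and mehler_integral_fourier_hermite_ito: "mehler_integral a b (fourier_hermite_ito \<phi> ms ns) x =
      a ^ (\<Sum>k<K. ms k) * cnj a ^ (\<Sum>k<K. ns k) * fourier_hermite_ito \<phi> ms ns x"
proof -
  define c where "c k = 1 / complex_of_real (sqrt (2 ^ (ms k + ns k) * fact (ms k) * fact (ns k)))" for k
  let ?Z = "\<lambda>k y. c k * hli (ms k) (ns k) (a * \<phi> k x + of_real b * \<phi> k y)"
  have J: "fourier_hermite_ito \<phi> ms ns (mehler a b (x, y)) = (\<Prod>k<K. ?Z k y)" if "y \<in> space \<mu>" for y
  proof -
    have "\<phi> k (mehler a b (x, y)) = a * \<phi> k x + of_real b * \<phi> k y" for k
      using that x by (simp add: mehler_def space_wiener path_space_scale path_dual_add[OF basis_dual] path_dual_scale[OF basis_dual])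
    then show ?thesis unfolding fourier_hermite_ito_eq c_def by simp
  qed
  have ind: "indep_vars (\<lambda>_. borel) ?Z {..<K}"
    by (rule indep_vars_compose2[OF basis_indep[OF ons]]) measurable
  interpret C: complex_gaussian \<mu> "\<phi> k" for k by (rule basis_complex_gaussian[OF ons])
  have int: "integrable \<mu> (?Z k)" for k
    by (intro integrable_mult_right C.integrable_hli)
  have "integrable \<mu> (\<lambda>y. \<Prod>k<K. ?Z k y)"
    by (rule indep_vars_integrable[OF _ ind int]) auto
  then show "integrable \<mu> (\<lambda>y. fourier_hermite_ito \<phi> ms ns (mehler a b (x, y)))"
    using J by (simp cong: Bochner_Integration.integrable_cong)
  have "mehler_integral a b (fourier_hermite_ito \<phi> ms ns) x = (CLINT y|\<mu>. \<Prod>k<K. ?Z k y)"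
    unfolding mehler_integral_def using J by (intro Bochner_Integration.integral_cong) auto
  also have "\<dots> = (\<Prod>k<K. CLINT y|\<mu>. ?Z k y)"
    by (rule indep_vars_lebesgue_integral[OF _ ind int]) auto
  also have "\<dots> = (\<Prod>k<K. a ^ ms k * cnj a ^ ns k * (c k * hli (ms k) (ns k) (\<phi> k x)))"
    by (intro prod.cong refl) (simp add: C.integral_hli[OF ab])
  also have "\<dots> = a ^ (\<Sum>k<K. ms k) * cnj a ^ (\<Sum>k<K. ns k) * fourier_hermite_ito \<phi> ms ns x"
    unfolding fourier_hermite_ito_eq c_def by (simp only: prod.distrib power_sum)
  finally show "mehler_integral a b (fourier_hermite_ito \<phi> ms ns) x =
      a ^ (\<Sum>k<K. ms k) * cnj a ^ (\<Sum>k<K. ns k) * fourier_hermite_ito \<phi> ms ns x" .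
qed

text \<open>The powers of the factors are independent, and each is integrable by polynomial
  growth.\<close>

lemma fourier_hermite_ito_in_Lp:
  assumes p: "0 \<le> p"
  shows "fourier_hermite_ito \<phi> ms ns \<in> Lp \<mu> p"
proof (rule LpI)
  define c where "c k = 1 / complex_of_real (sqrt (2 ^ (ms k + ns k) * fact (ms k) * fact (ns k)))" for k
  define g where "g k z = c k * hli (ms k) (ns k) z" for k z
  note [measurable] = basis_measurable
  have [measurable]: "g k \<in> borel_measurable borel" for k unfolding g_def by measurable
  have J: "fourier_hermite_ito \<phi> ms ns x = (\<Prod>k<K. g k (\<phi> k x))" for x
    unfolding fourier_hermite_ito_eq c_def g_def ..
  show "fourier_hermite_ito \<phi> ms ns \<in> borel_measurable \<mu>"
    unfolding J[abs_def] by measurable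
  have "indep_vars (\<lambda>_. borel) (\<lambda>k x. cmod (g k (\<phi> k x)) powr p) {..<K}"
    by (rule indep_vars_compose2[OF basis_indep[OF ons]]) measurable
  moreover have "integrable \<mu> (\<lambda>x. cmod (g k (\<phi> k x)) powr p)" for k
  proof -
    interpret C: complex_gaussian \<mu> "\<phi> k" by (rule basis_complex_gaussian[OF ons])
    obtain C where C: "C \<ge> 0" "\<And>z. cmod (hli (ms k) (ns k) z) \<le> C * (1 + cmod z) ^ (ms k + ns k)"
      using hli_growth by blast
    have "cmod (g k z) \<le> cmod (c k) * C * (1 + cmod z) ^ (ms k + ns k)" for z
      unfolding g_def norm_mult mult.assoc using C by (intro mult_left_mono) auto
    then show ?thesis using C p
      by (intro C.integrable_powr_if_growth[where C="cmod (c k) * C" and d="ms k + ns k"]) auto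
  qed
  ultimately have "integrable \<mu> (\<lambda>x. \<Prod>k<K. cmod (g k (\<phi> k x)) powr p)"
    by (intro indep_vars_integrable) auto
  then show "integrable \<mu> (\<lambda>x. cmod (fourier_hermite_ito \<phi> ms ns x) powr p)"
    by (simp add: J prod_norm[symmetric] prod_powr_distrib)
qed

end

end

theorem theorem4p4:
  fixes T \<theta> p :: real and \<mu> :: "(real \<Rightarrow>\<^sub>C complex) measure"
    and \<phi> :: "nat \<Rightarrow> (real \<Rightarrow>\<^sub>C complex) \<Rightarrow> complex"
    and ms ns :: "nat \<Rightarrow> nat" and m n :: nat
  assumes "T > 0"
    and "complex_wiener_measure T \<mu>"
    and "- pi / 2 < \<theta>" and "\<theta> < pi / 2"
    and "1 \<le> p"
    and "complete_orthonormal_system T \<phi>"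
    and "summable ms" and "m = (\<Sum>k. ms k)"
    and "summable ns" and "n = (\<Sum>k. ns k)"
  shows "Lp_generator \<mu> p (ou_semigroup \<mu> \<theta> p) (fourier_hermite_ito \<phi> ms ns)
           (\<lambda>x. - (of_real ((real m + real n) * cos \<theta>) + \<i> * of_real ((real m - real n) * sin \<theta>))
                  * fourier_hermite_ito \<phi> ms ns x)
       \<and> (\<forall>t\<ge>0. AE x in \<mu>. ou_semigroup \<mu> \<theta> p t (fourier_hermite_ito \<phi> ms ns) x
           = exp (- (of_real ((real m + real n) * cos \<theta>) + \<i> * of_real ((real m - real n) * sin \<theta>))
                  * of_real t)
             * fourier_hermite_ito \<phi> ms ns x)"
proof -
  interpret wiener_space T \<mu> by standard fact+
  let ?J = "fourier_hermite_ito \<phi> ms ns"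
  let ?l = "- (complex_of_real ((real m + real n) * cos \<theta>) + \<i> * of_real ((real m - real n) * sin \<theta>))"
  have "\<forall>\<^sub>F k in sequentially. ms k = 0 \<and> ns k = 0"
    using summable_nat_eventually_zero[OF \<open>summable ms\<close>] summable_nat_eventually_zero[OF \<open>summable ns\<close>]
    by (rule eventually_conj)
  then obtain K where K: "\<And>k. K \<le> k \<Longrightarrow> ms k = 0 \<and> ns k = 0"
    unfolding eventually_sequentially by blast
  have mn: "m = (\<Sum>k<K. ms k)" "n = (\<Sum>k<K. ns k)"
    unfolding assms(8,10) by (rule suminf_finite; simp add: K not_less)+
  have \<theta>: "0 \<le> cos \<theta>" using assms(3,4) by (intro cos_ge_zero) auto
  have JL: "?J \<in> Lp \<mu> p"
    by (rule fourier_hermite_ito_in_Lp[OF assms(6) K]) (use assms(5) in auto)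
  have eigen: "ou_integral \<mu> \<theta> t ?J x = exp (?l * of_real t) * ?J x" if t: "0 \<le> t" and x: "x \<in> path_space T" for t x
  proof -
    define u where "u = - (of_real (cos \<theta>) + \<i> * of_real (sin \<theta>)) * complex_of_real t"
    have "ou_integral \<mu> \<theta> t ?J x = exp u ^ m * cnj (exp u) ^ n * ?J x"
      unfolding ou_integral_eq_mehler_integral mn u_def
      by (rule mehler_integral_fourier_hermite_ito[OF assms(6) K x ou_coefficients[OF \<theta> t]])
    also have "exp u ^ m * cnj (exp u) ^ n = exp (of_nat m * u + of_nat n * cnj u)"
      by (simp add: exp_add exp_of_nat_mult exp_cnj)
    \<comment> \<open>Conjugating \<open>u\<close> flips only the sign of the sine term, so the
      cosine terms add up with m + n and the sine terms with m - n.\<close>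
    also have "of_nat m * u + of_nat n * cnj u = ?l * of_real t"
      by (simp add: u_def algebra_simps)
    finally show ?thesis .
  qed
  note S = ou_semigroup_eigenfunction[OF \<theta> _ assms(5) JL
      integrable_fourier_hermite_ito_mehler[OF assms(6) K] eigen]
  have "Lp_generator \<mu> p (ou_semigroup \<mu> \<theta> p) ?J (\<lambda>x. ?l * ?J x)"
    using assms(5) by (intro Lp_generator_eigenfunction JL S) auto
  moreover have "\<forall>t\<ge>0. AE x in \<mu>. ou_semigroup \<mu> \<theta> p t ?J x = exp (?l * of_real t) * ?J x"
    by (intro allI impI S(2))
  ultimately show ?thesis by (rule conjI)
qed

end
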